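(* Let $\alpha,\beta$ be integers different from $1$ with $v_2(\alpha-1)=v_2(\beta-1)=m\ge 5$, and let $\ell=v_2(\alpha-\beta)$ satisfy $2\ell+2=3m+1$. Write $\alpha=1+2^m u$ with $u$ odd and $\alpha-\beta=2^\ell k$ with $k$ odd, and set $s=v_2(k^2-u^3)$. Then the nilpotency class of $G_2$ is $6$. If $s<(m-3)/2$, then $m\ge 7$, $|G_2|=2^{(13m+2s-3)/2}$, $o(a)=o(b)=2^{(5m+2s+1)/2}$ and $o(c)=2^{2m+s}$. If $s\ge (m-3)/2$, then $|G_2|=2^{7m-3}$, $o(a)=o(b)=2^{3m-1}$ and $o(c)=2^{(5m-3)/2}$.
   Context: $G(\alpha,\beta)=\langle A,B\mid A^{[A,B]}=A^{\alpha},\ B^{[B,A]}=B^{\beta}\rangle$ with $[x,y]=x^{-1}y^{-1}xy$, $y^x=x^{-1}yx$, and $C=[A,B]$. The group $G(\alpha,\beta)$ is finite and nilpotent, hence the direct product of its Sylow subgroups; $G_2$ denotes its Sylow $2$-subgroup and $a,b,c$ denote the images of $A,B,C$ under the canonical projection $G(\alpha,\beta)\to G_2$. $v_2$ is the $2$-adic valuation and $o(x)$ the order of $x$. *)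

theory Defs
  imports "HOL-Algebra.Algebra" "HOL-Computational_Algebra.Factorial_Ring"
begin

text \<open>Letters: (g, inverted) with g = False for A, g = True for B.\<close>
type_synonym letter = "bool \<times> bool"
type_synonym word = "letter list"

definition winv :: "word \<Rightarrow> word" where
  "winv w = rev (map (\<lambda>(g, e). (g, \<not> e)) w)"

definition wpow :: "word \<Rightarrow> int \<Rightarrow> word" where
  "wpow w n = (if 0 \<le> n then concat (replicate (nat n) w)
               else concat (replicate (nat (- n)) (winv w)))"

definition wA :: word where "wA = [(False, False)]"
definition wB :: word where "wB = [(True, False)]"

definition wC :: word where "wC = winv wA @ winv wB @ wA @ wB"

text \<open>Relators: A^[A,B] A^-alpha and B^[B,A] B^-beta, using [B,A] = C^-1.\<close>
definition relators :: "int \<Rightarrow> int \<Rightarrow> word set" where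
  "relators \<alpha> \<beta> =
     { winv wC @ wA @ wC @ wpow wA (- \<alpha>),
       wC @ wB @ winv wC @ wpow wB (- \<beta>) }"

inductive word_eq :: "word set \<Rightarrow> word \<Rightarrow> word \<Rightarrow> bool" for R where
  refl: "word_eq R w w"
| sym: "word_eq R u v \<Longrightarrow> word_eq R v u"
| trans: "word_eq R u v \<Longrightarrow> word_eq R v w \<Longrightarrow> word_eq R u w"
| cancel: "word_eq R (u @ [(g, e), (g, \<not> e)] @ v) (u @ v)"
| relator: "r \<in> R \<Longrightarrow> word_eq R (u @ r @ v) (u @ v)"

definition presented :: "word set \<Rightarrow> word set monoid" where
  "presented R =
     \<lparr> carrier = UNIV // {(u, v). word_eq R u v},
       monoid.mult = (\<lambda>xs ys. {w. \<exists>u\<in>xs. \<exists>v\<in>ys. word_eq R (u @ v) w}),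
       monoid.one = {w. word_eq R [] w} \<rparr>"

definition word_class :: "word set \<Rightarrow> word \<Rightarrow> word set" where
  "word_class R w = {v. word_eq R w v}"

definition Gab :: "int \<Rightarrow> int \<Rightarrow> word set monoid" where
  "Gab \<alpha> \<beta> = presented (relators \<alpha> \<beta>)"

fun lower_central :: "('a, 'b) monoid_scheme \<Rightarrow> nat \<Rightarrow> 'a set" where
  "lower_central G 0 = carrier G"
| "lower_central G (Suc i) =
     generate G {inv\<^bsub>G\<^esub> x \<otimes>\<^bsub>G\<^esub> inv\<^bsub>G\<^esub> y \<otimes>\<^bsub>G\<^esub> x \<otimes>\<^bsub>G\<^esub> y | x y.
                  x \<in> lower_central G i \<and> y \<in> carrier G}"

definition nilpotency_class :: "('a, 'b) monoid_scheme \<Rightarrow> nat" where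
  "nilpotency_class G = (LEAST c. lower_central G c = {\<one>\<^bsub>G\<^esub>})"

text \<open>The 2-part of an element of a finite group (its image under the projection
  onto the Sylow 2-subgroup when the group is nilpotent).\<close>
definition two_part :: "('a, 'b) monoid_scheme \<Rightarrow> 'a \<Rightarrow> 'a" where
  "two_part G g = (THE p. p \<in> carrier G \<and> (\<exists>n::nat. p = g [^]\<^bsub>G\<^esub> n)
      \<and> (\<exists>k::nat. group.ord G p = 2 ^ k) \<and> odd (group.ord G (g \<otimes>\<^bsub>G\<^esub> inv\<^bsub>G\<^esub> p)))"

end

theory Submission
  imports Defs
begin

text \<open>Two mechanisms recur in the upper bound. An element that is both a power of a and a
  power of b commutes with a and b, hence with c; since c acts on powers of b by
  \<open>\<beta>\<close>, this bounds its order. Further, the relations are symmetric under a <-> b,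
  c -> c^-1, which exchanges u and u' and changes the sign of k. The quantity k^2 - u^3 arises from
  composing the relation \<open>star\<close> between b^(2R^5) and a^(2R^5) with its mirror image:
  this gives o^2 = p^2 on a^(2R^5), with o = u^4 - 2k^2u and p = R - u^4, and o^2 - p^2 is
  4k^2u^2(k^2 - u^3) modulo 2R.

  The delicate point throughout is the half-modulus 2R^6: such terms cannot be dropped modulo 4R^6
  and cancel only in pairs, by parity. This is why expansions are carried to second order, and why
  \<open>\<mu>\<close> contains 2R^6.

  The sign of \<open>\<alpha>\<close> and \<open>\<beta>\<close> is a separate obstacle, since the
  explicit power formulas need natural exponents. In the quotient of 2-power exponent
  \<open>\<alpha>\<close> and \<open>\<beta>\<close> may be shifted by a common large multiple of
  that exponent.\<close>

text \<open>
  Write \<open>m = 2 r + 1\<close> and \<open>R = 2 ^ r\<close>, so that \<open>\<alpha> = 1 + 2 R\<^sup>2 u\<close> and \<open>\<beta> = 1 + 2 R\<^sup>2 u'\<close> with \<open>u' = u - R k\<close>, and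
  let \<open>2 ^ e = gcd (8 R\<^sup>5 (k\<^sup>2 - u\<^sup>3)) (4 R\<^sup>6)\<close>.

  Upper bound. Evaluating the conjugate of \<open>A\<close> by \<open>B ^ \<beta> = C B C\<^sup>-\<^sup>1\<close> in two ways gives relations between powers of
  \<open>A\<close>, \<open>B\<close>, \<open>C\<close> which force \<open>A\<close>, \<open>B\<close>, \<open>C\<close> to be torsion; since every element has the form \<open>B ^ i C ^ j A ^ n\<close>,
  the group is finite. The elements for which \<open>i, j, n\<close> are divisible by the \<open>2\<close>-part of the group order
  form a normal subgroup of odd order, whose quotient is isomorphic to the Sylow \<open>2\<close>-subgroup. In that quotient the
  relations become \<open>b ^ (2 R\<^sup>5) \<in> \<langle>a\<rangle>\<close>, \<open>a ^ (4 R\<^sup>6) = 1\<close> and \<open>a ^ (8 R\<^sup>5 (k\<^sup>2 - u\<^sup>3)) = 1\<close>, which bound the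
  order by \<open>2 ^ (8 r + 2 + e)\<close>.

  Lower bound. The group acts transitively on a set of \<open>2 ^ (8 r + 2 + e)\<close> normal forms of triples \<open>(j, i, n)\<close>,
  thought of as \<open>c ^ j a ^ i b ^ n\<close>; hence all the bounds are attained. The class is read off from a central
  series with six steps and from a power of \<open>c\<close> in the sixth term of the lower central series, which is
  nontrivial because \<open>a ^ (8 R\<^sup>5) \<noteq> 1\<close>.
\<close>

section \<open>Normal forms and the right multiplications by the generators\<close>

text \<open>The binomial coefficients (n+1 choose 2) and (n+1 choose 3) as polynomials, so that
  negative exponents n are covered.\<close>

definition tri :: "int \<Rightarrow> int" where "tri n = n * (n + 1) div 2"
definition tet :: "int \<Rightarrow> int" where "tet n = (n - 1) * n * (n + 1) div 6"

lemma two_tri: "2 * tri n = n * (n + 1)"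
  by (simp add: tri_def)

lemma six_tet: "6 * tet n = (n - 1) * n * (n + 1)"
proof -
  have "even ((n - 1) * n * (n + 1))" by simp
  moreover have "3 dvd (n - 1) * n * (n + 1)"
  proof -
    have "n mod 3 = 0 \<or> n mod 3 = 1 \<or> n mod 3 = 2" by presburger
    then have "3 dvd n \<or> 3 dvd n - 1 \<or> 3 dvd n + 1" by presburger
    then show ?thesis by auto
  qed
  ultimately have "6 dvd (n - 1) * n * (n + 1)"
    using divides_mult[of 2 "(n - 1) * n * (n + 1)" 3] by simp
  then show ?thesis by (simp add: tet_def)
qed

lemma tri_add: "tri (a + b) = tri a + tri b + a * b"
proof -
  have "2 * tri (a + b) = 2 * (tri a + tri b + a * b)"
    unfolding distrib_left two_tri by Groebner_Basis.algebra
  then show ?thesis by simp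
qed

lemma tet_Suc: "tet (n + 1) = tet n + tri n"
proof -
  have "6 * tet (n + 1) = 6 * tet n + 3 * (2 * tri n)"
    unfolding six_tet two_tri by Groebner_Basis.algebra
  then show ?thesis by simp
qed

text \<open>Deals with the 3 in the denominator of \<open>tet\<close>: it is a unit modulo powers of
  2.\<close>

lemma three_cancel:
  assumes "2 ^ n dvd (3::int) * z" shows "2 ^ n dvd z"
proof -
  have "coprime (2 ^ n) (3::int)" by simp
  then show ?thesis using assms coprime_dvd_mult_right_iff by blast
qed

text \<open>\<open>\<theta>\<close> inverts u'^2 modulo 4R^6. Raising a^(-2R^4u^2) = b^(2R^4u'^2)
  c^(-2R^3k) to the power \<open>\<theta>\<close> and solving for b^Q gives \<open>\<delta>\<close>
  and \<open>\<omega>\<close>. The number \<open>\<epsilon>\<close> is the first-order part of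
  (1+x)^\<open>\<delta>\<close> - 1, the effect of moving a past c^\<open>\<delta>\<close>.\<close>

locale model =
  fixes r e :: nat and u k \<theta> R u' x y Q E \<delta> \<omega> \<mu> \<epsilon> :: int
  assumes r: "r \<ge> 2" and odd_u: "odd u" and odd_k: "odd k"
    and R_def: "R = 2 ^ r" and E_def: "E = 2 ^ e"
    and u'_def: "u' = u - R * k"
    and x_def: "x = 2 * R ^ 2 * u" and y_def: "y = 2 * R ^ 2 * u'" and Q_def: "Q = 2 * R ^ 4"
    and \<theta>: "4 * R ^ 6 dvd \<theta> * u' ^ 2 - 1"
    and E1: "E dvd 4 * R ^ 6" and E2: "E dvd 8 * R ^ 5 * (k ^ 2 - u ^ 3)"
    and \<delta>_def: "\<delta> = 2 * R ^ 3 * k * \<theta>" and \<omega>_def: "\<omega> = - Q * u ^ 2 * \<theta>"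
    and \<mu>_def: "\<mu> = \<theta> * (2 * R ^ 6 + 4 * R ^ 5 * k * u)" and \<epsilon>_def: "\<epsilon> = \<delta> * x"
begin

lemma R_pos: "R > 0" and R4: "4 dvd R"
proof -
  show "R > 0" by (simp add: R_def)
  have "(2::int) ^ 2 dvd 2 ^ r" using r le_imp_power_dvd by blast
  then show "4 dvd R" by (simp add: R_def)
qed

lemma R_even: "even R" using R4 by presburger

lemma odds: "odd \<theta>" "odd u'"
proof -
  have ev: "even R" using R4 by presburger
  then show "odd u'" using odd_u by (simp add: u'_def)
  have "even (4 * R ^ 6)" by simp
  then have "even (\<theta> * u' ^ 2 - 1)" using \<theta> dvd_trans by blast
  then show "odd \<theta>" by auto
qed

text \<open>
  Modulo \<open>4 R\<^sup>6\<close>, \<open>pw n\<close> is \<open>(1 + x) ^ (- n)\<close> and \<open>ff n\<close> is \<open>(1 + y) + \<dots> + (1 + y) ^ n\<close> up to higher powers of \<open>y\<close>, the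
  exponents produced by moving \<open>a\<close> past \<open>c ^ (- n)\<close> and past \<open>b ^ n\<close>. The relation \<open>rel\<close> identifies triples
  according to \<open>c ^ Q = a ^ \<mu>\<close> and \<open>b ^ Q = c ^ \<delta> a ^ \<omega>\<close>, the relations expected among the powers of \<open>a\<close>, \<open>b\<close>, \<open>c\<close>.
\<close>

definition pw :: "int \<Rightarrow> int" where "pw n = 1 - n * x + tri n * x ^ 2"
definition ff :: "int \<Rightarrow> int" where "ff n = n + y * tri n + y ^ 2 * tet n"

definition rel :: "int \<times> int \<times> int \<Rightarrow> int \<times> int \<times> int \<Rightarrow> bool" where
  "rel = (\<lambda>(j, i, n) (j', i', n'). \<exists>t s. n = n' + Q * t \<and> j + \<delta> * t = j' + Q * s \<and>
      E dvd i * (1 + \<epsilon> * t) + \<omega> * t + \<mu> * s - i')"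

definition nf :: "int \<times> int \<times> int \<Rightarrow> int \<times> int \<times> int" where
  "nf = (\<lambda>(j, i, n). let t = n div Q; j' = j + \<delta> * t in
      (j' mod Q, (i * (1 + \<epsilon> * t) + \<omega> * t + \<mu> * (j' div Q)) mod E, n mod Q))"

lemma Edvd: "4 * R ^ 6 dvd z \<Longrightarrow> E dvd z"
  using E1 dvd_trans by blast

lemma Q_pos: "Q > 0" and E_pos: "E > 0"
  using R_pos by (auto simp: Q_def E_def)

text \<open>The difference is a half-modulus term, to be absorbed by parity in
  \<open>actA_rel\<close>.\<close>

lemma mu_eps: "\<mu> = \<epsilon> + 2 * R ^ 6 * \<theta>"
  unfolding \<mu>_def \<epsilon>_def \<delta>_def x_def by Groebner_Basis.algebra

lemma mu_half: "R = 2 * h \<Longrightarrow> \<mu> = R ^ 5 * 4 * \<theta> * (h + k * u)"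
proof -
  assume h: "R = 2 * h"
  have "\<mu> = R ^ 5 * 4 * \<theta> * (h + k * u) + (R - 2 * h) * (2 * R ^ 5 * \<theta>)"
    unfolding \<mu>_def by Groebner_Basis.algebra
  moreover have "R - 2 * h = 0" using h by linarith
  ultimately show ?thesis by simp
qed

lemma nf_rel: "rel z (nf z)"
proof -
  obtain j i n where z: "z = (j, i, n)" by (cases z)
  let ?t = "n div Q" let ?j = "j + \<delta> * ?t" let ?s = "?j div Q"
  let ?i = "i * (1 + \<epsilon> * ?t) + \<omega> * ?t + \<mu> * ?s"
  have "n = n mod Q + Q * ?t" by simp
  moreover have "j + \<delta> * ?t = ?j mod Q + Q * ?s" by simp
  moreover have "E dvd ?i - ?i mod E" by (rule dvd_minus_mod)
  ultimately show ?thesis unfolding z rel_def nf_def Let_def prod.case by (intro exI conjI)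
qed

text \<open>Reducing in two stages adds the shifts t and s, up to the products
  \<open>\<mu>\<epsilon>\<close>, \<open>\<omega>\<epsilon>\<close> and
  \<open>\<epsilon>\<epsilon>\<close>, which are multiples of 4R^6. Together with
  \<open>nf_rel\<close> this stands in for a proof that \<open>rel\<close> is an
  equivalence.\<close>

lemma nf_eqI:
  assumes "rel z z'" shows "nf z = nf z'"
proof -
  obtain j i n where z: "z = (j, i, n)" by (cases z)
  obtain j' i' n' where z': "z' = (j', i', n')" by (cases z')
  obtain t s where n: "n = n' + Q * t" and j: "j + \<delta> * t = j' + Q * s"
    and i: "E dvd i * (1 + \<epsilon> * t) + \<omega> * t + \<mu> * s - i'"
    using assms unfolding z z' rel_def prod.case by blast
  define t' where "t' = n' div Q"
  have t: "n div Q = t' + t" using Q_pos by (simp add: n t'_def)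
  have jj: "j + \<delta> * (t' + t) = (j' + \<delta> * t') + Q * s" using j by (simp add: algebra_simps)
  define s' where "s' = (j' + \<delta> * t') div Q"
  have s: "(j + \<delta> * (t' + t)) div Q = s' + s" unfolding jj using Q_pos by (simp add: s'_def)
  have jm: "(j + \<delta> * (t' + t)) mod Q = (j' + \<delta> * t') mod Q" unfolding jj by simp
  have nm: "n mod Q = n' mod Q" by (simp add: n)
  obtain h where h: "R = 2 * h" using R_even by blast
  have me: "4 * R ^ 6 dvd \<mu> * \<epsilon>" unfolding \<mu>_def \<epsilon>_def \<delta>_def x_def
    by (rule dvdI[where k = "\<theta> * (2 * R + 4 * k * u) * R ^ 4 * k * \<theta> * u"]) Groebner_Basis.algebra
  have oe: "4 * R ^ 6 dvd \<omega> * \<epsilon>" unfolding \<omega>_def Q_def \<epsilon>_def \<delta>_def x_def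
    by (rule dvdI[where k = "- 2 * R ^ 3 * u ^ 3 * \<theta> ^ 2 * k"]) Groebner_Basis.algebra
  have ee: "4 * R ^ 6 dvd \<epsilon> * \<epsilon>" unfolding \<epsilon>_def \<delta>_def x_def
    by (rule dvdI[where k = "4 * R ^ 4 * k ^ 2 * \<theta> ^ 2 * u ^ 2"]) Groebner_Basis.algebra
  let ?I = "i * (1 + \<epsilon> * t) + \<omega> * t + \<mu> * s"
  have "(i * (1 + \<epsilon> * (t' + t)) + \<omega> * (t' + t) + \<mu> * (s' + s)) - (i' * (1 + \<epsilon> * t') + \<omega> * t' + \<mu> * s')
     = (?I - i') * (1 + \<epsilon> * t') - (\<epsilon> * \<epsilon> * (i * t * t') + \<omega> * \<epsilon> * (t * t') + \<mu> * \<epsilon> * (s * t'))"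
    by Groebner_Basis.algebra
  moreover have "E dvd \<dots>"
    by (intro dvd_diff dvd_add dvd_mult2[OF i] dvd_mult2[OF Edvd] me oe ee)
  ultimately have "(i * (1 + \<epsilon> * (t' + t)) + \<omega> * (t' + t) + \<mu> * (s' + s)) mod E = (i' * (1 + \<epsilon> * t') + \<omega> * t' + \<mu> * s') mod E"
    by (simp add: mod_eq_dvd_iff)
  then show ?thesis
    unfolding z z' nf_def Let_def prod.case t t'_def[symmetric] s jm nm s'_def[symmetric] by simp
qed

text \<open>A shift of n by 4R^6 corresponds to t divisible by 2R^2, and then both this t and a
  shift of j by 2R^5 are compensated by an s divisible by R. For such t and s every correction to
  the exponent of a is a multiple of 4R^6, so plain congruences suffice.\<close>

lemma relI:
  assumes n: "4 * R ^ 6 dvd n - n'" and j: "2 * R ^ 5 dvd j - j'" and i: "4 * R ^ 6 dvd i - i'"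
  shows "rel (j, i, n) (j', i', n')"
proof -
  obtain h where h: "R = 2 * h" using R_even by blast
  obtain n1 where n1: "n - n' = 4 * R ^ 6 * n1" using n by blast
  obtain j1 where j1: "j - j' = 2 * R ^ 5 * j1" using j by blast
  obtain i1 where i1: "i - i' = 4 * R ^ 6 * i1" using i by blast
  define t where "t = 2 * R ^ 2 * n1"
  define s where "s = R * (j1 + 2 * k * \<theta> * n1)"
  have n2: "n = n' + 4 * R ^ 6 * n1" using n1 by simp
  have j2: "j = j' + 2 * R ^ 5 * j1" using j1 by simp
  have i2: "i' = i - 4 * R ^ 6 * i1" using i1 by simp
  have mR: "\<mu> = R ^ 5 * 4 * \<theta> * (h + k * u)" by (rule mu_half[OF h])
  have "n = n' + Q * t" unfolding n2 t_def Q_def by Groebner_Basis.algebra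
  moreover have "j + \<delta> * t = j' + Q * s" unfolding j2 t_def Q_def s_def \<delta>_def by Groebner_Basis.algebra
  moreover have "i * (1 + \<epsilon> * t) + \<omega> * t + \<mu> * s - i' =
     4 * R ^ 6 * (i1 + i * 2 * R * k * \<theta> * u * n1 - u ^ 2 * \<theta> * n1 + \<theta> * (h + k * u) * (j1 + 2 * k * \<theta> * n1))"
    unfolding i2 mR \<epsilon>_def \<delta>_def x_def \<omega>_def Q_def t_def s_def by Groebner_Basis.algebra
  then have "E dvd i * (1 + \<epsilon> * t) + \<omega> * t + \<mu> * s - i'" by (simp only: Edvd dvd_triv_left)
  ultimately show ?thesis unfolding rel_def by blast
qed

lemma tri_diff: "tri (n + Q * t) = tri n + R ^ 4 * t * (2 * n + 1 + Q * t)"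
proof -
  have "2 * tri (n + Q * t) = 2 * (tri n + R ^ 4 * t * (2 * n + 1 + Q * t))"
    unfolding distrib_left two_tri Q_def by Groebner_Basis.algebra
  then show ?thesis by simp
qed

lemma tet_diff: "\<exists>\<tau>. tet (n + Q * t) = tet n + R ^ 4 * \<tau>"
proof -
  have "2 * (3 * (tet (n + Q * t) - tet n)) = 6 * tet (n + Q * t) - 6 * tet n" by simp
  also have "\<dots> = 2 * (R ^ 4 * (t * (3 * n ^ 2 + 3 * n * Q * t + Q ^ 2 * t ^ 2 - 1)))"
    unfolding six_tet Q_def by Groebner_Basis.algebra
  finally have "3 * (tet (n + Q * t) - tet n) = R ^ 4 * (t * (3 * n ^ 2 + 3 * n * Q * t + Q ^ 2 * t ^ 2 - 1))"
    by linarith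
  then have "R ^ 4 dvd 3 * (tet (n + Q * t) - tet n)" by simp
  then have "R ^ 4 dvd tet (n + Q * t) - tet n"
    unfolding R_def power_mult[symmetric] by (rule three_cancel)
  then obtain \<tau> where "tet (n + Q * t) - tet n = R ^ 4 * \<tau>" by blast
  then show ?thesis by (intro exI[of _ \<tau>]) simp
qed

text \<open>\<open>actD\<close> is right multiplication by \<open>c\<^sup>-\<^sup>1\<close>.\<close>

definition actA :: "int \<times> int \<times> int \<Rightarrow> int \<times> int \<times> int" where
  "actA = (\<lambda>(j, i, n). (j - n, (i + 1) * pw n, ff n))"
definition actB :: "int \<times> int \<times> int \<Rightarrow> int \<times> int \<times> int" where
  "actB = (\<lambda>(j, i, n). (j, i, n + 1))"
definition actB' :: "int \<times> int \<times> int \<Rightarrow> int \<times> int \<times> int" where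
  "actB' = (\<lambda>(j, i, n). (j, i, n - 1))"
text \<open>These maps transcribe the group law: b^n a = a c^-n b^(ff n) gives \<open>actA\<close>,
  while c b c^-1 = b^\<open>\<beta>\<close> and c^-1 a c = a^\<open>\<alpha>\<close> give
  \<open>actD\<close>.\<close>

definition actD :: "int \<times> int \<times> int \<Rightarrow> int \<times> int \<times> int" where
  "actD = (\<lambda>(j, i, n). (j - 1, i * pw 1, (1 + y) * n))"

section \<open>Compatibility of the right multiplications with the identification of triples\<close>

lemma actA_rel:
  assumes "rel z z'" shows "rel (actA z) (actA z')"
proof -
  obtain j i n where z: "z = (j, i, n)" by (cases z)
  obtain j' i' n' where z': "z' = (j', i', n')" by (cases z')
  obtain t s where n: "n = n' + Q * t" and j: "j + \<delta> * t = j' + Q * s"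
    and i: "E dvd i * (1 + \<epsilon> * t) + \<omega> * t + \<mu> * s - i'"
    using assms unfolding z z' rel_def prod.case by blast
  obtain v where v: "i * (1 + \<epsilon> * t) + \<omega> * t + \<mu> * s - i' = E * v" using i by blast
  obtain h where h: "R = 2 * h" using R_even by blast
  obtain \<tau> where \<tau>: "tet n = tet n' + R ^ 4 * \<tau>" using tet_diff n by blast
  have tri: "tri n = tri n' + R ^ 4 * t * (2 * n' + 1 + Q * t)" unfolding n by (rule tri_diff)
  define p1 where "p1 = - n' * u + 2 * R ^ 2 * u ^ 2 * tri n'"
  define p2 where "p2 = - u * t + u ^ 2 * R ^ 2 * t * (2 * n' + 1 + Q * t)"
  have p1: "pw n' = 1 + 2 * R ^ 2 * p1" unfolding pw_def unfolding p1_def x_def by Groebner_Basis.algebra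
  have p2: "pw n = 1 + 2 * R ^ 2 * p1 + 4 * R ^ 6 * p2"
    unfolding pw_def unfolding tri unfolding p1_def p2_def x_def n Q_def by Groebner_Basis.algebra
  define T1 where "T1 = u' * t * (2 * n' + 1 + Q * t) + 2 * R ^ 2 * u' ^ 2 * \<tau>"
  define T where "T = t + R ^ 2 * T1"
  \<comment> \<open>All factors are odd, so 1 plus their product is even. This pairs the term 2R^6
    of \<open>\<mu>\<close> with the one produced by \<open>\<omega>\<close> R^2 T1 into a multiple
    of 4R^6.\<close>
  have "even (\<theta> * (1 + u ^ 2 * u' * (2 * n' + 1)))" using odds odd_u by simp
  then obtain w where w: "\<theta> * (1 + u ^ 2 * u' * (2 * n' + 1)) = 2 * w" by blast
  \<comment> \<open>The -t accounts for j losing n = n' + Q t instead of n'; the last term is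
    \<open>\<delta>\<close> R^2 T1 divided by Q.\<close>
  define s' where "s' = s - t + R * k * \<theta> * T1"
  have a: "ff n = ff n' + Q * T"
    unfolding ff_def unfolding T_def T1_def tri \<tau> y_def unfolding n Q_def by Groebner_Basis.algebra
  have b: "j - n + \<delta> * T = j' - n' + Q * s'"
  proof -
    have j2: "j = j' + Q * s - \<delta> * t" using j by simp
    show ?thesis unfolding j2 s'_def T_def n \<delta>_def Q_def by Groebner_Basis.algebra
  qed
  have me: "\<mu> - \<epsilon> = 2 * R ^ 6 * \<theta>" by (simp add: mu_eps)
  have i': "i' = i * (1 + \<epsilon> * t) + \<omega> * t + \<mu> * s - E * v" using v by simp
  have mR: "\<mu> = R ^ 5 * 4 * \<theta> * (h + k * u)" by (rule mu_half[OF h])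
  have eR: "\<epsilon> = 4 * R ^ 5 * k * u * \<theta>" unfolding \<epsilon>_def \<delta>_def x_def by Groebner_Basis.algebra
  have wT: "2 * R ^ 6 * \<theta> * t + 2 * R ^ 6 * u ^ 2 * \<theta> * T1 =
      4 * R ^ 6 * (t * w + u ^ 2 * \<theta> * (R ^ 4 * u' * t ^ 2 + R ^ 2 * u' ^ 2 * \<tau>))"
    (is "?L = ?RR")
  proof -
    have "?L = ?RR + 2 * R ^ 6 * t * (\<theta> * (1 + u ^ 2 * u' * (2 * n' + 1)) - 2 * w)"
      unfolding T1_def Q_def by Groebner_Basis.algebra
    then show ?thesis using w by simp
  qed
  have "(i + 1) * pw n * (1 + \<epsilon> * T) + \<omega> * T + \<mu> * s' - (i' + 1) * pw n'
    = 4 * R ^ 6 * ((i + 1) * p2 * (1 + \<epsilon> * T) + (i + 1) * (1 + 2 * R ^ 2 * p1) * R * k * u * \<theta> * T1)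
      + 4 * R ^ 6 * (k * \<theta> ^ 2 * (h + k * u) * T1)
      + (\<epsilon> * t - \<mu> * t + \<omega> * R ^ 2 * T1)
      + 2 * R ^ 2 * p1 * (\<epsilon> * t - \<omega> * t - \<mu> * s) + E * (v * (1 + 2 * R ^ 2 * p1))"
    unfolding p1 p2 i' s'_def T_def
    unfolding mR eR by Groebner_Basis.algebra
  also have "\<epsilon> * t - \<mu> * t + \<omega> * R ^ 2 * T1 = 4 * R ^ 6 * (- (t * w + u ^ 2 * \<theta> * (R ^ 4 * u' * t ^ 2 + R ^ 2 * u' ^ 2 * \<tau>)))"
  proof -
    have "\<epsilon> * t - \<mu> * t + \<omega> * R ^ 2 * T1 = - (2 * R ^ 6 * \<theta> * t + 2 * R ^ 6 * u ^ 2 * \<theta> * T1)"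
      unfolding mu_eps \<omega>_def Q_def by Groebner_Basis.algebra
    then show ?thesis unfolding wT mult_minus_right .
  qed
  also have "2 * R ^ 2 * p1 * (\<epsilon> * t - \<omega> * t - \<mu> * s)
     = 4 * R ^ 6 * (p1 * (2 * R * k * u * \<theta> * t + u ^ 2 * \<theta> * t - 2 * R * \<theta> * (h + k * u) * s))"
    unfolding mR eR \<omega>_def Q_def by Groebner_Basis.algebra
  finally have "E dvd (i + 1) * pw n * (1 + \<epsilon> * T) + \<omega> * T + \<mu> * s' - (i' + 1) * pw n'"
    by (simp only: Edvd dvd_add dvd_triv_left)
  then show ?thesis using a b unfolding z z' rel_def actA_def prod.case by blast
qed

lemma actD_rel:
  assumes "rel z z'" shows "rel (actD z) (actD z')"
proof -
  obtain j i n where z: "z = (j, i, n)" by (cases z)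
  obtain j' i' n' where z': "z' = (j', i', n')" by (cases z')
  obtain t s where n: "n = n' + Q * t" and j: "j + \<delta> * t = j' + Q * s"
    and i: "E dvd i * (1 + \<epsilon> * t) + \<omega> * t + \<mu> * s - i'"
    using assms unfolding z z' rel_def prod.case by blast
  obtain v where v: "i * (1 + \<epsilon> * t) + \<omega> * t + \<mu> * s - i' = E * v" using i by blast
  have i': "i' = i * (1 + \<epsilon> * t) + \<omega> * t + \<mu> * s - E * v" using v by simp
  obtain h where h: "R = 2 * h" using R_even by blast
  have mR: "\<mu> = R ^ 5 * 4 * \<theta> * (h + k * u)" by (rule mu_half[OF h])
  have eR: "\<epsilon> = 4 * R ^ 5 * k * u * \<theta>" unfolding \<epsilon>_def \<delta>_def x_def by Groebner_Basis.algebra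
  define p1 where "p1 = - u + 2 * R ^ 2 * u ^ 2"
  have p1: "pw 1 = 1 + 2 * R ^ 2 * p1" unfolding pw_def unfolding p1_def x_def by (simp add: tri_def power2_eq_square algebra_simps)
  \<comment> \<open>The added term is \<open>\<delta>\<close> y t divided by Q.\<close>
  define s' where "s' = s + 2 * R * k * \<theta> * u' * t"
  have a: "(1 + y) * n = (1 + y) * n' + Q * ((1 + y) * t)" unfolding n by Groebner_Basis.algebra
  have b: "j - 1 + \<delta> * ((1 + y) * t) = j' - 1 + Q * s'"
  proof -
    have j2: "j = j' + Q * s - \<delta> * t" using j by simp
    show ?thesis unfolding j2 s'_def \<delta>_def y_def Q_def by Groebner_Basis.algebra
  qed
  have "i * pw 1 * (1 + \<epsilon> * ((1 + y) * t)) + \<omega> * ((1 + y) * t) + \<mu> * s' - i' * pw 1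
     = 4 * R ^ 6 * (i * (1 + 2 * R ^ 2 * p1) * 2 * R * k * u * \<theta> * u' * t
         - u ^ 2 * \<theta> * t * (u' - p1) - 2 * R * \<theta> * (h + k * u) * s * p1 + 2 * \<theta> ^ 2 * (h + k * u) * k * u' * t)
       + E * (v * (1 + 2 * R ^ 2 * p1))"
    unfolding p1 i' s'_def mR eR \<omega>_def y_def Q_def by Groebner_Basis.algebra
  then have "E dvd i * pw 1 * (1 + \<epsilon> * ((1 + y) * t)) + \<omega> * ((1 + y) * t) + \<mu> * s' - i' * pw 1"
    by (simp only: Edvd dvd_add dvd_triv_left)
  then show ?thesis using a b unfolding z z' rel_def actD_def prod.case by blast
qed

lemma actB_rel:
  assumes "rel z z'" shows "rel (actB z) (actB z')" "rel (actB' z) (actB' z')"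
proof -
  obtain j i n where z: "z = (j, i, n)" by (cases z)
  obtain j' i' n' where z': "z' = (j', i', n')" by (cases z')
  obtain t s where ts: "n = n' + Q * t" "j + \<delta> * t = j' + Q * s"
    "E dvd i * (1 + \<epsilon> * t) + \<omega> * t + \<mu> * s - i'"
    using assms unfolding z z' rel_def prod.case by blast
  have "n + 1 = n' + 1 + Q * t" "n - 1 = n' - 1 + Q * t" using ts(1) by simp_all
  then show "rel (actB z) (actB z')" "rel (actB' z) (actB' z')"
    using ts(2,3) unfolding z z' rel_def actB_def actB'_def prod.case by blast+
qed

lemma R_square_dvdI:
  assumes "3 * z = R ^ 2 * w" obtains v where "z = R ^ 2 * v"
proof -
  have "R ^ 2 dvd 3 * z" using assms by simp
  then have "R ^ 2 dvd z" unfolding R_def power_mult[symmetric] by (rule three_cancel)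
  then show ?thesis using that by blast
qed

lemma tri_1: "tri 1 = 1" by (simp add: tri_def)

text \<open>The truncation after x^2 is harmless because x^3 = 8R^6u^3 vanishes modulo 4R^6.\<close>

lemma pw_mult: "4 * R ^ 6 dvd pw (a + b) - pw a * pw b"
proof -
  have "pw (a + b) - pw a * pw b = 4 * R ^ 6 * (2 * u ^ 3 * (a * tri b + b * tri a) - 4 * R ^ 2 * u ^ 4 * tri a * tri b)"
    unfolding pw_def tri_add unfolding x_def by Groebner_Basis.algebra
  then show ?thesis by simp
qed

text \<open>The relation b a = a b c^-1, with operators applied in the order in which the factors
  are multiplied on the right.\<close>

lemma actA_actB: "rel (actA (actB z)) (actD (actB (actA z)))"
proof -
  obtain j i n where z: "z = (j, i, n)" by (cases z)
  have "ff (n + 1) - (1 + y) * (ff n + 1) = 4 * R ^ 6 * (- 2 * u' ^ 3 * tet n)"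
    unfolding ff_def tri_add tet_Suc tri_1 unfolding y_def by Groebner_Basis.algebra
  then have n: "4 * R ^ 6 dvd ff (n + 1) - (1 + y) * (ff n + 1)" by simp
  have "(i + 1) * pw (n + 1) - (i + 1) * pw n * pw 1 = (i + 1) * (pw (n + 1) - pw n * pw 1)"
    by Groebner_Basis.algebra
  then have i: "4 * R ^ 6 dvd (i + 1) * pw (n + 1) - (i + 1) * pw n * pw 1"
    using pw_mult by simp
  show ?thesis unfolding z actA_def actB_def actD_def prod.case
    by (rule relI[OF n _ i]) simp
qed

text \<open>Closed form of the \<open>i\<close>-th iterate of \<open>actA\<close>, up to \<open>rel\<close>.\<close>

definition FF :: "nat \<Rightarrow> int \<Rightarrow> int" where
  "FF i n = n + int i * y * tri n + y ^ 2 * int i * tet n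
     + 2 * R ^ 4 * u' ^ 2 * int (i choose 2) * tri n * (2 * n + 1) + 2 * R ^ 6 * u' ^ 3 * int (i choose 3) * tri n"
text \<open>This is the sum of \<open>FF t n\<close> over t < i, since each step lowers j by the
  current third coordinate. Similarly \<open>EE\<close> below solves E(i+1) = (E(i) + 1)
  \<open>pw (FF i n)\<close> modulo 4R^6.\<close>

definition SS :: "nat \<Rightarrow> int \<Rightarrow> int" where
  "SS i n = int i * n + int (i choose 2) * y * tri n + y ^ 2 * int (i choose 2) * tet n
     + 2 * R ^ 4 * u' ^ 2 * int (i choose 3) * tri n * (2 * n + 1) + 2 * R ^ 6 * u' ^ 3 * int (i choose 4) * tri n"
definition EE :: "nat \<Rightarrow> int \<Rightarrow> int" where
  "EE i n = int i - x * (int (Suc i choose 2) * n + 2 * y * int (Suc i choose 3) * tri n)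
     + x ^ 2 * (\<Sum>j\<le>i. tri (int j * n))"
definition psi :: "nat \<Rightarrow> int \<times> int \<times> int \<Rightarrow> int \<times> int \<times> int" where
  "psi i = (\<lambda>(j, a, n). (j - SS i n, a * pw (SS i n) + EE i n, FF i n))"

lemma choose_Suc:
  "Suc i choose 2 = (i choose 2) + i" "Suc i choose 3 = (i choose 3) + (i choose 2)"
  "Suc i choose 4 = (i choose 4) + (i choose 3)"
  by (simp_all add: eval_nat_numeral)

lemma SS_Suc: "SS (Suc i) n = SS i n + FF i n"
  unfolding SS_def FF_def choose_Suc of_nat_add of_nat_Suc by Groebner_Basis.algebra

lemma two_choose: "2 * int (i choose 2) = int i * (int i - 1)"
  by (induction i) (simp_all add: choose_Suc algebra_simps)

text \<open>The third coordinate has the form F = n + y G, so \<open>tri F\<close>,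
  \<open>tet F\<close> and \<open>pw F\<close> can be expanded around n; the remainders are
  multiples of 4R^6.\<close>

lemma actA_psi: "rel (actA (psi i z)) (psi (Suc i) z)"
proof -
  obtain j a n where z: "z = (j, a, n)" by (cases z)
  obtain h where h: "R = 2 * h" using R_even by blast
  define I where "I = int i"
  define I2 where "I2 = int (i choose 2)"
  define I3 where "I3 = int (i choose 3)"
  define N2 where "N2 = tri n"
  define N3 where "N3 = tet n"
  define F where "F = FF i n"
  define G1 where "G1 = 2 * u' * I * N3 + u' * I2 * N2 * (2 * n + 1) + R ^ 2 * u' ^ 2 * I3 * N2"
  define G where "G = I * N2 + R ^ 2 * G1"
  have N2: "2 * N2 = n * (n + 1)" unfolding N2_def by (rule two_tri)
  have F: "F = n + y * G"
    unfolding F_def FF_def I_def[symmetric] I2_def[symmetric] I3_def[symmetric] N2_def[symmetric] N3_def[symmetric] G_def G1_def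
    unfolding y_def by Groebner_Basis.algebra
  have triF: "tri F = N2 + R ^ 2 * u' * G * (2 * n + 1 + y * G)"
  proof -
    have "2 * tri F = 2 * N2 + 2 * (R ^ 2 * u' * G * (2 * n + 1 + y * G))"
      unfolding two_tri N2 F y_def by Groebner_Basis.algebra
    then show ?thesis by simp
  qed
  have "6 * (tet F - N3) = 6 * tet F - 6 * N3" by simp
  also have "\<dots> = 2 * (R ^ 2 * (u' * G * (3 * n ^ 2 + 3 * n * y * G + y ^ 2 * G ^ 2 - 1)))"
    unfolding N3_def six_tet F y_def by Groebner_Basis.algebra
  finally have "3 * (tet F - N3) = R ^ 2 * (u' * G * (3 * n ^ 2 + 3 * n * y * G + y ^ 2 * G ^ 2 - 1))" by linarith
  then obtain \<tau> where "tet F - N3 = R ^ 2 * \<tau>" by (rule R_square_dvdI)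
  then have tetF: "tet F = N3 + R ^ 2 * \<tau>" by simp
  have F': "FF (Suc i) n = F + y * N2 + y ^ 2 * N3 + 2 * R ^ 4 * u' ^ 2 * I * N2 * (2 * n + 1) + 2 * R ^ 6 * u' ^ 3 * I2 * N2"
    unfolding F_def FF_def choose_Suc of_nat_add of_nat_Suc I_def I2_def N2_def N3_def by Groebner_Basis.algebra
  \<comment> \<open>The R^8 term carries only one factor 2; the evenness of R supplies the
    other.\<close>
  have R8: "2 * R ^ 8 = 4 * R ^ 6 * (h * R)"
  proof -
    have "2 * R ^ 8 = 4 * R ^ 6 * (h * R) + 2 * R ^ 7 * (R - 2 * h)" by Groebner_Basis.algebra
    then show ?thesis using h by simp
  qed
  have "ff F - FF (Suc i) n = 4 * R ^ 6 * (u' ^ 3 * (2 * n + 1) * I * N3 + 2 * u' ^ 3 * I2 * N2 * n * (n + 1)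
      + u' ^ 3 * G ^ 2 + u' ^ 2 * \<tau>) + 2 * R ^ 8 * u' ^ 4 * I3 * N2 * (2 * n + 1)"
    unfolding F' ff_def triF tetF unfolding F G_def G1_def y_def by Groebner_Basis.algebra
  also have "\<dots> = 4 * R ^ 6 * (u' ^ 3 * (2 * n + 1) * I * N3 + 2 * u' ^ 3 * I2 * N2 * n * (n + 1)
      + u' ^ 3 * G ^ 2 + u' ^ 2 * \<tau> + h * R * u' ^ 4 * I3 * N2 * (2 * n + 1))"
    unfolding R8 by Groebner_Basis.algebra
  finally have nn: "4 * R ^ 6 dvd ff F - FF (Suc i) n" by simp
  define J where "J = int (Suc i choose 2)"
  define K where "K = int (Suc i choose 3)"
  define Z where "Z = (\<Sum>j\<le>i. tri (int j * n))"
  define E0 where "E0 = EE i n"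
  have J: "2 * J = I * (I + 1)" unfolding J_def two_choose I_def by simp
  have tr: "tri ((I + 1) * n) = J * n ^ 2 + (I + 1) * N2"
  proof -
    have "2 * tri ((I + 1) * n) = 2 * J * n ^ 2 + (I + 1) * (2 * N2)"
      unfolding two_tri J N2 by Groebner_Basis.algebra
    then show ?thesis by simp
  qed
  have E': "EE (Suc i) n = E0 + 1 - x * ((I + 1) * n + I * (I + 1) * y * N2) + x ^ 2 * (J * n ^ 2 + (I + 1) * N2)"
  proof -
    have "EE (Suc i) n = I + 1 - x * ((J + I + 1) * n + 2 * y * (K + J) * N2) + x ^ 2 * (Z + tri ((I + 1) * n))"
      unfolding EE_def choose_Suc(1)[of "Suc i"] choose_Suc(2)[of "Suc i"] of_nat_add
      by (simp add: J_def K_def Z_def N2_def I_def algebra_simps)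
    also have "\<dots> = (I - x * (J * n + 2 * y * K * N2) + x ^ 2 * Z) + 1 - x * ((I + 1) * n + (2 * J) * y * N2)
        + x ^ 2 * (J * n ^ 2 + (I + 1) * N2)" unfolding tr by Groebner_Basis.algebra
    also have "I - x * (J * n + 2 * y * K * N2) + x ^ 2 * Z = E0"
      unfolding E0_def EE_def J_def K_def Z_def N2_def I_def ..
    finally show ?thesis unfolding J .
  qed
  define e1 where "e1 = - 2 * u * u' * K * N2 + u ^ 2 * Z"
  have E0: "E0 = I - x * J * n + 4 * R ^ 4 * e1"
    unfolding E0_def EE_def J_def[symmetric] K_def[symmetric] Z_def[symmetric] N2_def[symmetric] I_def[symmetric] e1_def
    unfolding x_def y_def by Groebner_Basis.algebra
  define p3 where "p3 = - u * u' * G1 + u ^ 2 * u' * G * (2 * n + 1 + y * G)"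
  have pF: "pw F = 1 - x * (n + y * I * N2) + x ^ 2 * N2 + 4 * R ^ 6 * p3"
    unfolding pw_def triF unfolding F p3_def unfolding G_def x_def y_def by Groebner_Basis.algebra
  have "(E0 + 1) * pw F - EE (Suc i) n = 4 * R ^ 6 * ((E0 + 1) * p3
       + 2 * u ^ 2 * u' * J * n * I * N2 - 2 * e1 * u * (n + y * I * N2) + 4 * R ^ 2 * e1 * u ^ 2 * N2
       - 2 * u ^ 3 * N2 * J * n)"
    unfolding E' pF unfolding E0 unfolding x_def y_def by Groebner_Basis.algebra
  then have ee: "4 * R ^ 6 dvd (E0 + 1) * pw F - EE (Suc i) n" by simp
  have "(a * pw (SS i n) + E0 + 1) * pw F - (a * pw (SS i n + F) + EE (Suc i) n)
     = ((E0 + 1) * pw F - EE (Suc i) n) - a * (pw (SS i n + F) - pw (SS i n) * pw F)" by Groebner_Basis.algebra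
  then have ii: "4 * R ^ 6 dvd (a * pw (SS i n) + E0 + 1) * pw F - (a * pw (SS i n + F) + EE (Suc i) n)"
    by (simp only: dvd_diff[OF ee dvd_mult[OF pw_mult]])
  show ?thesis unfolding z psi_def actA_def prod.case SS_Suc F_def[symmetric] E0_def[symmetric]
    by (rule relI[OF nn _ ii]) simp
qed

lemma six_choose: "6 * int (i choose 3) = int i * (int i - 1) * (int i - 2)"
proof (induction i)
  case (Suc i)
  have "6 * int (Suc i choose 3) = 6 * int (i choose 3) + 3 * (2 * int (i choose 2))"
    by (simp add: choose_Suc)
  also have "\<dots> = int (Suc i) * (int (Suc i) - 1) * (int (Suc i) - 2)"
    unfolding Suc.IH two_choose of_nat_Suc by Groebner_Basis.algebra
  finally show ?case .
qed simp

lemma sum_tri: "12 * (\<Sum>j\<le>i. tri (int j * n)) = int i * (int i + 1) * (n ^ 2 * (2 * int i + 1) + 3 * n)"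
proof (induction i)
  case (Suc i)
  have "12 * (\<Sum>j\<le>Suc i. tri (int j * n)) = 12 * (\<Sum>j\<le>i. tri (int j * n)) + 6 * (2 * tri (int (Suc i) * n))"
    by simp
  also have "\<dots> = int (Suc i) * (int (Suc i) + 1) * (n ^ 2 * (2 * int (Suc i) + 1) + 3 * n)"
    unfolding Suc.IH two_tri of_nat_Suc by Groebner_Basis.algebra
  finally show ?case .
qed (simp add: tri_def)

text \<open>The relation c^-1 a = a^\<open>\<alpha>\<close> c^-1. Here the divisibility of 8R^5(k^2
  - u^3) by E enters: all other discrepancies are multiples of 4R^6, and what remains is a multiple
  of 8R^5(u - k^2 \<open>\<theta>\<close>).\<close>

lemma actA_actD:
  assumes a: "int a = 1 + x"
  shows "rel (actA (actD z)) (actD (psi a z))"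
proof -
  obtain j i n where z: "z = (j, i, n)" by (cases z)
  obtain h where h: "R = 2 * h" using R_even by blast
  define N2 where "N2 = tri n"
  define N3 where "N3 = tet n"
  have N2: "2 * N2 = n * (n + 1)" unfolding N2_def by (rule two_tri)
  have u: "u = u' + R * k" by (simp add: u'_def)
  obtain \<psi> where "\<theta> * u' ^ 2 - 1 = 4 * R ^ 6 * \<psi>" using \<theta> by blast
  then have \<psi>: "\<theta> * u' ^ 2 = 1 + 4 * R ^ 6 * \<psi>" by simp
  have I2: "int (a choose 2) = R ^ 2 * u * (1 + x)"
  proof -
    have "2 * int (a choose 2) = 2 * (R ^ 2 * u * (1 + x))" unfolding two_choose a x_def by Groebner_Basis.algebra
    then show ?thesis by simp
  qed
  obtain I3 where I3: "int (a choose 3) = R ^ 2 * I3"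
  proof -
    have "2 * (3 * int (a choose 3)) = 6 * int (a choose 3)" by simp
    also have "\<dots> = 2 * (R ^ 2 * (u * (1 + x) * (x - 1)))" unfolding six_choose a x_def by Groebner_Basis.algebra
    finally have "3 * int (a choose 3) = R ^ 2 * (u * (1 + x) * (x - 1))" by linarith
    then show ?thesis using that by (rule R_square_dvdI)
  qed
  have J: "int (Suc a choose 2) = (1 + x) * (1 + R ^ 2 * u)"
  proof -
    have "2 * int (Suc a choose 2) = 2 * ((1 + x) * (1 + R ^ 2 * u))"
      unfolding two_choose of_nat_Suc a x_def by Groebner_Basis.algebra
    then show ?thesis by simp
  qed
  have K: "int (Suc a choose 3) = R ^ 2 * (I3 + u * (1 + x))"
    unfolding choose_Suc of_nat_add I2 I3 by Groebner_Basis.algebra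
  obtain Z where Z: "(\<Sum>j\<le>a. tri (int j * n)) = N2 + R ^ 2 * Z"
  proof -
    define Y where "Y = (\<Sum>j\<le>a. tri (int j * n))"
    have "12 * Y = (1 + x) * (1 + x + 1) * (n ^ 2 * (2 * (1 + x) + 1) + 3 * n)"
      unfolding Y_def sum_tri a by simp
    also have "\<dots> = 12 * N2 + 4 * (R ^ 2 * ((1 + x) * (1 + R ^ 2 * u) * (2 * u * n ^ 2) + 3 * u * (3 + x) * N2))
        + (n * (n + 1) - 2 * N2) * (6 * (1 + x) * (1 + R ^ 2 * u))"
      unfolding x_def by Groebner_Basis.algebra
    finally have "3 * (Y - N2) = R ^ 2 * ((1 + x) * (1 + R ^ 2 * u) * (2 * u * n ^ 2) + 3 * u * (3 + x) * N2)"
      using N2 by simp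
    then obtain Z where "Y - N2 = R ^ 2 * Z" by (rule R_square_dvdI)
    then show ?thesis using that[of Z] unfolding Y_def by simp
  qed
  define S where "S = SS a n"
  define F where "F = FF a n"
  define E0 where "E0 = EE a n"
  define C4 where "C4 = int (a choose 4)"
  have F: "F = n + (1 + x) * y * N2 + y ^ 2 * (1 + x) * N3 + 2 * R ^ 6 * u' ^ 2 * u * (1 + x) * N2 * (2 * n + 1)
      + 2 * R ^ 8 * u' ^ 3 * I3 * N2"
    unfolding F_def FF_def a I2 I3 N2_def N3_def by Groebner_Basis.algebra
  define S2 where "S2 = 2 * u ^ 2 * u' * N2 + 2 * u' ^ 2 * u * (1 + x) * N3 + u' ^ 2 * I3 * N2 * (2 * n + 1) + u' ^ 3 * C4 * N2"
  have S: "S = (1 + x) * n + 2 * R ^ 4 * u * u' * N2 + 2 * R ^ 6 * S2"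
    unfolding S_def SS_def a I2 I3 N2_def N3_def S2_def C4_def unfolding x_def y_def by Groebner_Basis.algebra
  have tri\<beta>: "tri ((1 + y) * n) = (1 + x) * (1 + y) * N2 - R ^ 2 * (1 + y) * n * (R * k * n + u)"
  proof -
    have "2 * tri ((1 + y) * n) = (1 + x) * (1 + y) * (2 * N2) - 2 * (R ^ 2 * (1 + y) * n * (R * k * n + u))"
      unfolding two_tri N2 unfolding x_def y_def u by Groebner_Basis.algebra
    then show ?thesis by simp
  qed
  obtain \<tau> where tet\<beta>: "tet ((1 + y) * n) = (1 + x) * (1 + y) * N3 + R ^ 2 * \<tau>"
  proof -
    have "6 * (tet ((1 + y) * n) - (1 + x) * (1 + y) * N3) = 6 * tet ((1 + y) * n) - (1 + x) * (1 + y) * (6 * N3)" by simp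
    also have "\<dots> = 2 * (R ^ 2 * ((1 + y) * n * (n ^ 2 * (2 * u' + 2 * R ^ 2 * u' ^ 2 - u) + u)))"
      unfolding N3_def six_tet unfolding x_def y_def by Groebner_Basis.algebra
    finally have "3 * (tet ((1 + y) * n) - (1 + x) * (1 + y) * N3)
        = R ^ 2 * ((1 + y) * n * (n ^ 2 * (2 * u' + 2 * R ^ 2 * u' ^ 2 - u) + u))" by linarith
    then obtain \<tau> where "tet ((1 + y) * n) - (1 + x) * (1 + y) * N3 = R ^ 2 * \<tau>" by (rule R_square_dvdI)
    then show ?thesis using that[of \<tau>] by simp
  qed
  define t1 where "t1 = - 2 * u' ^ 2 * n * (R * k * n + u) + 2 * u' ^ 2 * \<tau>
      - (1 + y) * u' ^ 2 * u * (1 + x) * N2 * (2 * n + 1) - (1 + y) * R ^ 2 * u' ^ 3 * I3 * N2"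
  \<comment> \<open>The leading term is chosen for the exponent of c: as \<open>\<theta>\<close>
    u'^2 is 1 modulo 4R^6, it makes \<open>\<delta>\<close> t cancel (x - y) n = 2R^3 k n. The
    equivalent form \<open>t0\<close> is the one that fits the exponent of b.\<close>
  define t where "t = - (u' ^ 2) * n - 2 * R * k * u' * N2 + R ^ 2 * t1"
  have t0: "t = - u' * n * (R * k * n + u) + R ^ 2 * t1"
  proof -
    have "t = - u' * n * (R * k * n + u) + R ^ 2 * t1 + R * k * u' * (n * (n + 1) - 2 * N2)"
      unfolding t_def u by Groebner_Basis.algebra
    then show ?thesis using N2 by simp
  qed
  have n_eq: "ff ((1 + y) * n) = (1 + y) * F + Q * t"
    unfolding ff_def tri\<beta> tet\<beta> F t0 unfolding t1_def Q_def unfolding y_def by Groebner_Basis.algebra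
  \<comment> \<open>Prepares \<open>b7\<close>: the half-modulus terms have coefficients
    \<open>\<theta>\<close> s0 N2 and -u^2 \<open>\<theta>\<close> t1, which must have equal
    parity.\<close>
  have "even (t1 - N2)"
    unfolding t1_def x_def y_def using odds odd_u R_even by auto
  define s0 where "s0 = u * u' - 2 * k ^ 2 * \<theta> * u'"
  define s1 where "s1 = R * S2 + k * \<theta> * t1 - 4 * R ^ 4 * k * \<psi> * n"
  define s where "s = s0 * N2 + R * s1"
  have j_eq: "j - 1 - (1 + y) * n + \<delta> * t = j - S - 1 + Q * s"
  proof -
    have "j - 1 - (1 + y) * n + \<delta> * t - (j - S - 1 + Q * s) = (\<theta> * u' ^ 2 - (1 + 4 * R ^ 6 * \<psi>)) * (- 2 * R ^ 3 * k * n)"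
      unfolding S t_def s_def s0_def s1_def \<delta>_def Q_def unfolding x_def y_def unfolding u by Groebner_Basis.algebra
    then show ?thesis using \<psi> by simp
  qed
  define b1 where "b1 = u ^ 2 * (2 * u * N2 + 2 * u' * (1 + x) * N2 - (1 + y) * n * (R * k * n + u))"
  have p\<beta>: "pw ((1 + y) * n) = 1 - n * x - 4 * R ^ 4 * u * u' * n + 4 * R ^ 4 * u ^ 2 * N2 + 4 * R ^ 6 * b1"
    unfolding pw_def tri\<beta> unfolding b1_def x_def y_def by Groebner_Basis.algebra
  define S' where "S' = u * n + R ^ 2 * u * u' * N2 + R ^ 4 * S2"
  have S': "S = n + 2 * R ^ 2 * S'" unfolding S S'_def x_def by Groebner_Basis.algebra
  have triS: "tri S = N2 + R ^ 2 * S' * (2 * n + 1 + 2 * R ^ 2 * S')"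
  proof -
    have "2 * tri S = 2 * N2 + 2 * (R ^ 2 * S' * (2 * n + 1 + 2 * R ^ 2 * S'))"
      unfolding two_tri S' N2 by Groebner_Basis.algebra
    then show ?thesis by simp
  qed
  define b2 where "b2 = u ^ 2 * S' * (2 * n + 1 + 2 * R ^ 2 * S') - u ^ 2 * u' * N2 - R ^ 2 * u * S2"
  have pS: "pw S = 1 - n * x - 4 * R ^ 4 * u ^ 2 * n + 4 * R ^ 4 * u ^ 2 * N2 + 4 * R ^ 6 * b2"
    unfolding pw_def triS unfolding S'  b2_def unfolding S'_def x_def by Groebner_Basis.algebra
  have E0: "E0 = 1 + x - x * (1 + x) * (1 + R ^ 2 * u) * n + x ^ 2 * N2
     + 4 * R ^ 6 * (- 2 * u * u' * (I3 + u * (1 + x)) * N2 + u ^ 2 * Z)"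
    unfolding E0_def EE_def J K Z a N2_def[symmetric] unfolding x_def y_def by Groebner_Basis.algebra
  have p1: "pw 1 = 1 - x + x ^ 2" by (simp add: pw_def tri_1)
  obtain b3 where b3: "E0 * pw 1 = 1 - n * x - 2 * R ^ 4 * u ^ 2 * n + 4 * R ^ 4 * u ^ 2 * N2 + 4 * R ^ 6 * b3"
  proof -
    have "E0 * pw 1 = 1 - n * x - 2 * R ^ 4 * u ^ 2 * n + 4 * R ^ 4 * u ^ 2 * N2 + 4 * R ^ 6 * (Z * u^2 + 2 * u^3 - 2 * I3 * N2 * u * u' - 2 * N2 * u^2 * u' - 2 * N2 * u^3 - 2 * R^2 * Z * u^3 + 4 * I3 * N2 * R^2 * u^2 * u' + 4 * N2 * R^2 * u^4 - 4 * R^2 * n * u^4 + 4 * R^4 * Z * u^4 - 8 * I3 * N2 * R^4 * u^3 * u' - 4 * R^4 * n * u^5 - 16 * N2 * R^6 * u^5 * u')"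
      unfolding E0 p1 unfolding x_def by Groebner_Basis.algebra
    then show ?thesis using that by blast
  qed
  define b4 where "b4 = - 4 * R ^ 5 * \<psi> * k * u * n - 2 * k ^ 2 * u * u' * \<theta> * N2 + R * k * u * \<theta> * t1"
  have eR: "\<epsilon> = 4 * R ^ 5 * k * u * \<theta>" unfolding \<epsilon>_def \<delta>_def x_def by Groebner_Basis.algebra
  have et: "\<epsilon> * t = - 4 * R ^ 5 * k * u * n + 4 * R ^ 6 * b4"
  proof -
    have "\<epsilon> * t - (- 4 * R ^ 5 * k * u * n + 4 * R ^ 6 * b4) = (\<theta> * u' ^ 2 - (1 + 4 * R ^ 6 * \<psi>)) * (- 4 * R ^ 5 * k * u * n)"
      unfolding eR t_def b4_def by Groebner_Basis.algebra
    then show ?thesis using \<psi> by simp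
  qed
  define pp where "pp = - n * u - 2 * R ^ 2 * u * u' * n + 2 * R ^ 2 * u ^ 2 * N2 + 2 * R ^ 4 * b1"
  have pp: "pw ((1 + y) * n) = 1 + 2 * R ^ 2 * pp" unfolding p\<beta> unfolding pp_def x_def by Groebner_Basis.algebra
  define b5 where "b5 = b1 - b2 + b4 + pp * 2 * (- R * k * u * n + R ^ 2 * b4)"
  have c1: "pw ((1 + y) * n) * (1 + \<epsilon> * t) - pw S = 4 * R ^ 6 * b5"
  proof -
    have "pw ((1 + y) * n) * (1 + \<epsilon> * t) - pw S = (pw ((1 + y) * n) - pw S) + \<epsilon> * t + 2 * R ^ 2 * pp * (\<epsilon> * t)"
      unfolding pp by Groebner_Basis.algebra
    also have "\<dots> = 4 * R ^ 6 * b5" unfolding p\<beta> pS et b5_def unfolding u by Groebner_Basis.algebra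
    finally show ?thesis .
  qed
  define b6 where "b6 = b1 - b3 + b4 + pp * 2 * (- R * k * u * n + R ^ 2 * b4)"
  have c2: "pw ((1 + y) * n) * (1 + \<epsilon> * t) - E0 * pw 1 = - 2 * R ^ 4 * u ^ 2 * n + 4 * R ^ 6 * b6"
  proof -
    have "pw ((1 + y) * n) * (1 + \<epsilon> * t) - E0 * pw 1 = (pw ((1 + y) * n) - E0 * pw 1) + \<epsilon> * t + 2 * R ^ 2 * pp * (\<epsilon> * t)"
      unfolding pp by Groebner_Basis.algebra
    also have "\<dots> = - 2 * R ^ 4 * u ^ 2 * n + 4 * R ^ 6 * b6" unfolding p\<beta> b3 et b6_def unfolding u by Groebner_Basis.algebra
    finally show ?thesis .
  qed
  have mR: "\<mu> = R ^ 5 * 4 * \<theta> * (h + k * u)" by (rule mu_half[OF h])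
  have "even (\<theta> * s0 * N2 - u ^ 2 * \<theta> * t1)"
    using \<open>even (t1 - N2)\<close> odds odd_u unfolding s0_def by auto
  then obtain b7 where b7: "\<theta> * s0 * N2 - u ^ 2 * \<theta> * t1 = 2 * b7" by blast
  have c3: "\<omega> * t + \<mu> * s = 2 * R ^ 4 * u ^ 2 * n
     + 4 * R ^ 6 * (2 * R ^ 4 * \<psi> * u ^ 2 * n + b7 + \<theta> * (h + k * u) * s1) + 8 * R ^ 5 * k * u * \<theta> * u' * N2 * (u - k ^ 2 * \<theta>)"
  proof -
    have "\<omega> * t + \<mu> * s - (2 * R ^ 4 * u ^ 2 * n
      + 4 * R ^ 6 * (2 * R ^ 4 * \<psi> * u ^ 2 * n + b7 + \<theta> * (h + k * u) * s1) + 8 * R ^ 5 * k * u * \<theta> * u' * N2 * (u - k ^ 2 * \<theta>))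
      = (\<theta> * u' ^ 2 - (1 + 4 * R ^ 6 * \<psi>)) * (2 * R ^ 4 * u ^ 2 * n)
       + 2 * R ^ 6 * (\<theta> * s0 * N2 - u ^ 2 * \<theta> * t1 - 2 * b7) + (2 * h - R) * (2 * R ^ 5 * \<theta> * s0 * N2)"
      unfolding mR \<omega>_def Q_def t_def s_def unfolding s0_def by Groebner_Basis.algebra
    then show ?thesis using \<psi> b7 h by simp
  qed
  \<comment> \<open>Since \<open>\<theta>\<close> inverts u'^2 and u' = u - R k, the number u - k^2
    \<open>\<theta>\<close> is -\<open>\<theta>\<close>(k^2 - u^3) up to multiples of R, which the
    factor 8R^5 turns into multiples of 4R^6.\<close>
  have "8 * R ^ 5 * (u - k ^ 2 * \<theta>) = - \<theta> * (8 * R ^ 5 * (k ^ 2 - u ^ 3)) + 4 * R ^ 6 * (- 8 * R ^ 5 * \<psi> * u + 2 * \<theta> * u * (R * k ^ 2 - 2 * k * u))"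
  proof -
    have "8 * R ^ 5 * (u - k ^ 2 * \<theta>) - (- \<theta> * (8 * R ^ 5 * (k ^ 2 - u ^ 3)) + 4 * R ^ 6 * (- 8 * R ^ 5 * \<psi> * u + 2 * \<theta> * u * (R * k ^ 2 - 2 * k * u)))
      = (1 + 4 * R ^ 6 * \<psi> - \<theta> * u' ^ 2) * (8 * R ^ 5 * u)"
      unfolding u'_def by Groebner_Basis.algebra
    then show ?thesis using \<psi> by simp
  qed
  then have "E dvd 8 * R ^ 5 * (u - k ^ 2 * \<theta>)"
    using E2 by (simp only: Edvd dvd_add dvd_triv_left dvd_mult)
  then have c4: "E dvd 8 * R ^ 5 * (u - k ^ 2 * \<theta>) * (k * u * \<theta> * u' * N2)" by (rule dvd_mult2)
  have "(i * pw 1 + 1) * pw ((1 + y) * n) * (1 + \<epsilon> * t) + \<omega> * t + \<mu> * s - (i * pw S + E0) * pw 1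
    = i * pw 1 * (pw ((1 + y) * n) * (1 + \<epsilon> * t) - pw S) + (pw ((1 + y) * n) * (1 + \<epsilon> * t) - E0 * pw 1) + (\<omega> * t + \<mu> * s)"
    by Groebner_Basis.algebra
  also have "\<dots> = 4 * R ^ 6 * (i * pw 1 * b5 + b6 + (2 * R ^ 4 * \<psi> * u ^ 2 * n + b7 + \<theta> * (h + k * u) * s1))
     + 8 * R ^ 5 * (u - k ^ 2 * \<theta>) * (k * u * \<theta> * u' * N2)"
    unfolding c1 c2 c3 by Groebner_Basis.algebra
  finally have "E dvd (i * pw 1 + 1) * pw ((1 + y) * n) * (1 + \<epsilon> * t) + \<omega> * t + \<mu> * s - (i * pw S + E0) * pw 1"
    using c4 by (simp only: Edvd dvd_add dvd_triv_left)
  then show ?thesis using n_eq j_eq unfolding z rel_def psi_def actA_def actD_def prod.case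
     S_def[symmetric] E0_def[symmetric] F_def[symmetric] by blast
qed

end

section \<open>The presented group\<close>

lemma word_eq_append_left: "word_eq R u v \<Longrightarrow> word_eq R (w @ u) (w @ v)"
proof (induction rule: word_eq.induct)
  case (cancel u g e v) then show ?case using word_eq.cancel[of R "w @ u" g e v] by simp
next
  case (relator r u v) then show ?case using word_eq.relator[of r R "w @ u" v] by simp
next
  case (refl w) show ?case by (rule word_eq.refl)
next
  case (sym u v) then show ?case by (metis word_eq.sym)
next
  case (trans u v w) then show ?case by (metis word_eq.trans)
qed

lemma word_eq_append_right: "word_eq R u v \<Longrightarrow> word_eq R (u @ w) (v @ w)"
proof (induction rule: word_eq.induct)
  case (cancel u g e v) then show ?case using word_eq.cancel[of R u g e "v @ w"] by simp
next
  case (relator r u v) then show ?case using word_eq.relator[of r R u "v @ w"] by simp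
next
  case (refl w) show ?case by (rule word_eq.refl)
next
  case (sym u v) then show ?case by (metis word_eq.sym)
next
  case (trans u v w) then show ?case by (metis word_eq.trans)
qed

lemma word_eq_append: "word_eq R u v \<Longrightarrow> word_eq R u' v' \<Longrightarrow> word_eq R (u @ u') (v @ v')"
  by (meson word_eq.trans word_eq_append_left word_eq_append_right)

lemma word_class_eq_iff: "word_class R u = word_class R v \<longleftrightarrow> word_eq R u v"
proof
  assume "word_class R u = word_class R v"
  then have "v \<in> word_class R u" unfolding word_class_def using word_eq.refl by blast
  then show "word_eq R u v" unfolding word_class_def by simp
next
  assume uv: "word_eq R u v"
  have "word_eq R u w = word_eq R v w" for w
    using word_eq.trans[OF uv] word_eq.trans[OF word_eq.sym[OF uv]] by blast
  then show "word_class R u = word_class R v" unfolding word_class_def by (intro Collect_cong)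
qed

lemma word_eq_winv: "word_eq R (winv w @ w) []"
proof (induction w)
  case Nil then show ?case by (simp add: winv_def word_eq.refl)
next
  case (Cons l w)
  obtain g e where l: "l = (g, e)" by (cases l)
  have "word_eq R (winv w @ [(g, \<not> e), (g, \<not> \<not> e)] @ w) (winv w @ w)" by (rule word_eq.cancel)
  from word_eq.trans[OF this Cons] show ?case by (simp add: l winv_def)
qed

lemma carrier_presented: "carrier (presented R) = range (word_class R)"
  by (auto simp: presented_def word_class_def quotient_def)

lemma presented_mult: "word_class R u \<otimes>\<^bsub>presented R\<^esub> word_class R v = word_class R (u @ v)"
proof -
  have "(\<exists>u'. word_eq R u u' \<and> (\<exists>v'. word_eq R v v' \<and> word_eq R (u' @ v') w)) \<longleftrightarrow> word_eq R (u @ v) w" for w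
    using word_eq.refl word_eq.trans[OF word_eq_append] by blast
  then show ?thesis unfolding presented_def word_class_def by simp
qed

lemma presented_one: "\<one>\<^bsub>presented R\<^esub> = word_class R []"
  by (simp add: presented_def word_class_def)

lemma group_presented: "group (presented R)"
proof (rule groupI)
  fix x assume "x \<in> carrier (presented R)"
  then obtain w where w: "x = word_class R w" by (auto simp: carrier_presented)
  have "word_class R (winv w) \<otimes>\<^bsub>presented R\<^esub> x = \<one>\<^bsub>presented R\<^esub>"
    unfolding w presented_mult presented_one word_class_eq_iff by (rule word_eq_winv)
  then show "\<exists>y\<in>carrier (presented R). y \<otimes>\<^bsub>presented R\<^esub> x = \<one>\<^bsub>presented R\<^esub>"
    by (auto simp: carrier_presented)
qed (auto simp: carrier_presented presented_mult presented_one)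

lemma inv_word_class: "inv\<^bsub>presented R\<^esub> word_class R w = word_class R (winv w)"
proof -
  interpret group "presented R" by (rule group_presented)
  show ?thesis
    by (rule inv_equality)
      (auto simp: carrier_presented presented_mult presented_one word_class_eq_iff word_eq_winv)
qed

lemma nat_pow_word_class:
  "word_class R w [^]\<^bsub>presented R\<^esub> (n::nat) = word_class R (concat (replicate n w))"
proof -
  interpret group "presented R" by (rule group_presented)
  show ?thesis
  proof (induction n)
    case 0 show ?case by (simp add: presented_one)
  next
    case (Suc n)
    have "concat (replicate n w) @ w = concat (replicate (Suc n) w)" by (induction n) simp_all
    then show ?case by (simp only: nat_pow_Suc Suc.IH presented_mult)
  qed
qed

lemma int_pow_word_class: "word_class R w [^]\<^bsub>presented R\<^esub> (n::int) = word_class R (wpow w n)"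
proof -
  interpret group "presented R" by (rule group_presented)
  have c: "word_class R w \<in> carrier (presented R)" by (simp add: carrier_presented)
  show ?thesis
  proof (cases "0 \<le> n")
    case True
    then show ?thesis
      by (simp only: wpow_def if_True pow_nat[OF True, symmetric] nat_pow_word_class)
  next
    case False
    then have "word_class R w [^]\<^bsub>presented R\<^esub> n = inv\<^bsub>presented R\<^esub> word_class R w [^]\<^bsub>presented R\<^esub> nat (- n)"
      using nat_pow_inv[OF c, of "nat (- n)"] by (simp only: int_pow_def2 not_le if_True)
    then show ?thesis using False by (simp only: wpow_def inv_word_class nat_pow_word_class if_False)
  qed
qed

lemma word_class_generate: "word_class R w \<in> generate (presented R) {word_class R wA, word_class R wB}"
proof (induction w)
  case Nil then show ?case by (metis generate.one presented_one)
next
  case (Cons l w)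
  interpret group "presented R" by (rule group_presented)
  obtain g e where l: "l = (g, e)" by (cases l)
  have l1: "word_class R [l] \<in> generate (presented R) {word_class R wA, word_class R wB}" (is "_ \<in> ?S")
  proof -
    have A: "word_class R wA \<in> {word_class R wA, word_class R wB}"
      and B: "word_class R wB \<in> {word_class R wA, word_class R wB}" by auto
    have "[l] = wA \<or> [l] = wB \<or> [l] = winv wA \<or> [l] = winv wB"
      unfolding l wA_def wB_def winv_def by (cases g; cases e) auto
    moreover have "word_class R wA \<in> ?S" "word_class R wB \<in> ?S"
      by (auto intro: generate.incl)
    moreover have "word_class R (winv wA) \<in> ?S" "word_class R (winv wB) \<in> ?S"
      using generate.inv[OF A, of "presented R"] generate.inv[OF B, of "presented R"]
      unfolding inv_word_class .
    ultimately show ?thesis by (elim disjE) simp_all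
  qed
  have "word_class R [l] \<otimes>\<^bsub>presented R\<^esub> word_class R w \<in> ?S" by (rule generate.eng[OF l1 Cons])
  then show ?case by (simp add: presented_mult)
qed

lemma relator_word_class: "r \<in> R \<Longrightarrow> word_class R r = \<one>\<^bsub>presented R\<^esub>"
  unfolding presented_one word_class_eq_iff using word_eq.relator[of r R "[]" "[]"] by simp

section \<open>The action of the presented group on normal forms\<close>

text \<open>The action sees \<open>\<alpha>\<close> and \<open>\<beta>\<close> only through periods,
  so congruences suffice and negative values are allowed. The period of \<open>actA\<close> is taken
  as 32R^6 because N choose 4, with denominator 24, must still be divisible by 4R^6.\<close>

locale word_model = model +
  fixes N :: nat and \<alpha> \<beta> :: int
  assumes N: "int N = 32 * R ^ 6" and \<alpha>: "int N dvd \<alpha> - (1 + x)" and \<alpha>_pos: "1 + x > 0"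
    and \<beta>: "4 * R ^ 6 dvd \<beta> - (1 + y)"
begin

lemma N_pos: "N > 0"
  using N R_pos by (metis of_nat_0_less_iff zero_less_mult_iff zero_less_numeral zero_less_power)

lemma three_dvdI:
  assumes "3 * z = 4 * R ^ 6 * w" shows "4 * R ^ 6 dvd z"
proof -
  have "4 * R ^ 6 = 2 ^ (2 + 6 * r)" by (simp add: R_def power_add power_mult power_mult_distrib mult.commute flip: power_mult)
  moreover have "4 * R ^ 6 dvd 3 * z" using assms by simp
  ultimately show ?thesis using three_cancel by metis
qed

lemma pw_0: "pw 0 = 1" by (simp add: pw_def tri_def)

lemma psi_0: "psi 0 z = z"
  by (cases z) (simp add: psi_def SS_def EE_def FF_def tri_def pw_0 binomial_eq_0)

lemma choose_N:
  shows "4 * R ^ 6 dvd int (N choose 2)" "4 * R ^ 6 dvd int (N choose 3)" "4 * R ^ 6 dvd int (N choose 4)"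
proof -
  have "2 * int (N choose 2) = 2 * (4 * R ^ 6 * (4 * (int N - 1)))" unfolding two_choose N by simp
  then have "int (N choose 2) = 4 * R ^ 6 * (4 * (int N - 1))" by simp
  then show "4 * R ^ 6 dvd int (N choose 2)" by simp
  have "2 * (3 * int (N choose 3)) = 6 * int (N choose 3)" by simp
  also have "\<dots> = 2 * (4 * R ^ 6 * (4 * ((int N - 1) * (int N - 2))))" unfolding six_choose N by simp
  finally have "3 * int (N choose 3) = 4 * R ^ 6 * (4 * ((int N - 1) * (int N - 2)))" by linarith
  then show "4 * R ^ 6 dvd int (N choose 3)" by (rule three_dvdI)
  have c4: "24 * int (i choose 4) = int i * (int i - 1) * (int i - 2) * (int i - 3)" for i
  proof (induction i)
    case (Suc i)
    have "24 * int (Suc i choose 4) = 24 * int (i choose 4) + 4 * (6 * int (i choose 3))" by (simp add: choose_Suc)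
    also have "\<dots> = int (Suc i) * (int (Suc i) - 1) * (int (Suc i) - 2) * (int (Suc i) - 3)"
      unfolding Suc.IH six_choose of_nat_Suc by Groebner_Basis.algebra
    finally show ?case .
  qed simp
  have "8 * (3 * int (N choose 4)) = 24 * int (N choose 4)" by simp
  also have "\<dots> = 8 * (4 * R ^ 6 * ((int N - 1) * (int N - 2) * (int N - 3)))" unfolding c4 N by simp
  finally have "3 * int (N choose 4) = 4 * R ^ 6 * ((int N - 1) * (int N - 2) * (int N - 3))" by linarith
  then show "4 * R ^ 6 dvd int (N choose 4)" by (rule three_dvdI)
qed

text \<open>Every correction in \<open>FF\<close>, \<open>SS\<close> and \<open>EE\<close> carries
  N, a binomial coefficient of N or a sum of N + 1 values of \<open>tri\<close>, all divisible by
  4R^6. So a^N acts trivially.\<close>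

lemma psi_N: "rel (psi N z) z"
proof -
  obtain j a n where z: "z = (j, a, n)" by (cases z)
  let ?M = "4 * R ^ 6"
  have N': "?M dvd int N" unfolding N by (rule dvdI[of _ _ 8]) simp
  have "FF N n - n = int N * (y * tri n + y ^ 2 * tet n)
     + int (N choose 2) * (2 * R ^ 4 * u' ^ 2 * tri n * (2 * n + 1)) + int (N choose 3) * (2 * R ^ 6 * u' ^ 3 * tri n)"
    unfolding FF_def by Groebner_Basis.algebra
  then have 1: "?M dvd FF N n - n"
    using N' choose_N by (simp only: dvd_add dvd_mult2)
  have "SS N n = int N * n + int (N choose 2) * (y * tri n + y ^ 2 * tet n)
     + int (N choose 3) * (2 * R ^ 4 * u' ^ 2 * tri n * (2 * n + 1)) + int (N choose 4) * (2 * R ^ 6 * u' ^ 3 * tri n)"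
    unfolding SS_def by Groebner_Basis.algebra
  then have 2: "?M dvd SS N n"
    using N' choose_N by (simp only: dvd_add dvd_mult2)
  have "4 * (3 * (\<Sum>j\<le>N. tri (int j * n))) = 12 * (\<Sum>j\<le>N. tri (int j * n))" by simp
  also have "\<dots> = 4 * (?M * (2 * (int N + 1) * (n ^ 2 * (2 * int N + 1) + 3 * n)))"
    unfolding sum_tri N by simp
  finally have "3 * (\<Sum>j\<le>N. tri (int j * n)) = ?M * (2 * (int N + 1) * (n ^ 2 * (2 * int N + 1) + 3 * n))" by linarith
  then have 3: "?M dvd (\<Sum>j\<le>N. tri (int j * n))" by (rule three_dvdI)
  have "EE N n = int N * (1 - x * n) + int (N choose 2) * (- x * n - 2 * x * y * tri n)
      + int (N choose 3) * (- 2 * x * y * tri n) + (\<Sum>j\<le>N. tri (int j * n)) * x ^ 2"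
    unfolding EE_def choose_Suc of_nat_add by Groebner_Basis.algebra
  then have 4: "?M dvd EE N n"
    using N' choose_N 3 by (simp only: dvd_add dvd_mult2)
  have "2 * (pw (SS N n) - 1) = SS N n * (- 2 * x + (SS N n + 1) * x ^ 2)"
  proof -
    have "2 * (pw (SS N n) - 1) = - 2 * SS N n * x + 2 * tri (SS N n) * x ^ 2"
      unfolding pw_def by Groebner_Basis.algebra
    then show ?thesis unfolding two_tri by Groebner_Basis.algebra
  qed
  moreover have "\<dots> = 2 * (SS N n * (- x + (SS N n + 1) * R ^ 2 * u * x))"
    unfolding x_def by Groebner_Basis.algebra
  ultimately have "pw (SS N n) - 1 = SS N n * (- x + (SS N n + 1) * R ^ 2 * u * x)"
    by (metis mult_left_cancel zero_neq_numeral)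
  then have 5: "?M dvd pw (SS N n) - 1" using 2 by simp
  have "a * pw (SS N n) + EE N n - a = (pw (SS N n) - 1) * a + EE N n" by (simp add: algebra_simps)
  then have 6: "?M dvd a * pw (SS N n) + EE N n - a" using 4 5 by (simp only: dvd_add dvd_mult2)
  have "2 * R ^ 5 dvd ?M" by (rule dvdI[of _ _ "2 * R"]) Groebner_Basis.algebra
  then have 7: "2 * R ^ 5 dvd j - SS N n - j" using 2 dvd_trans by fastforce
  show ?thesis unfolding z psi_def prod.case by (rule relI[OF 1 7 6])
qed

definition eqv :: "int \<times> int \<times> int \<Rightarrow> int \<times> int \<times> int \<Rightarrow> bool" (infix "\<doteq>" 50) where
  "z \<doteq> z' \<longleftrightarrow> nf z = nf z'"

lemma eqv_refl [simp]: "z \<doteq> z" and eqv_sym: "z \<doteq> z' \<Longrightarrow> z' \<doteq> z"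
  and eqv_trans [trans]: "z \<doteq> z' \<Longrightarrow> z' \<doteq> z'' \<Longrightarrow> z \<doteq> z''"
  by (simp_all add: eqv_def)

lemma rel_eqv: "rel z z' \<Longrightarrow> z \<doteq> z'" by (simp add: eqv_def nf_eqI)

lemma eqv_congI:
  assumes f: "\<And>z z'. rel z z' \<Longrightarrow> rel (f z) (f z')" and "z \<doteq> z'"
  shows "f z \<doteq> f z'"
proof -
  have "f z \<doteq> f (nf z)" by (intro rel_eqv f nf_rel)
  also have "f (nf z) \<doteq> f z'" using assms(2) unfolding eqv_def
    using nf_eqI[OF f[OF nf_rel[of z']]] by simp
  finally show ?thesis .
qed

lemma eqv_cong:
  assumes "z \<doteq> z'"
  shows "actA z \<doteq> actA z'" "actB z \<doteq> actB z'" "actB' z \<doteq> actB' z'" "actD z \<doteq> actD z'"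
  by (rule eqv_congI[OF _ assms], erule actA_rel actB_rel actD_rel)+

lemma eqv_pow: "z \<doteq> z' \<Longrightarrow> (actA ^^ i) z \<doteq> (actA ^^ i) z'"
  by (induction i) (auto intro: eqv_cong)

lemma actA_pow: "(actA ^^ i) z \<doteq> psi i z"
proof (induction i)
  case 0 show ?case by (simp add: psi_0)
next
  case (Suc i)
  have "(actA ^^ Suc i) z \<doteq> actA (psi i z)" using eqv_cong(1)[OF Suc] by simp
  also have "\<dots> \<doteq> psi (Suc i) z" by (rule rel_eqv[OF actA_psi])
  finally show ?case .
qed

lemma actA_N: "(actA ^^ N) z \<doteq> z"
  using eqv_trans[OF actA_pow rel_eqv[OF psi_N]] .

lemma actA_N_mult: "(actA ^^ (N * i)) z \<doteq> z"
proof (induction i)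
  case (Suc i)
  have "(actA ^^ (N * Suc i)) z = (actA ^^ N) ((actA ^^ (N * i)) z)" by (simp add: funpow_add)
  also have "\<dots> \<doteq> (actA ^^ (N * i)) z" by (rule actA_N)
  also have "\<dots> \<doteq> z" by (rule Suc)
  finally show ?case .
qed simp

text \<open>The inverse of a acts as an iterate of \<open>actA\<close>, which inverts it up to
  \<open>\<doteq>\<close>; the inverse of b is an exact shift.\<close>

definition act :: "letter \<Rightarrow> int \<times> int \<times> int \<Rightarrow> int \<times> int \<times> int" where
  "act = (\<lambda>(g, e). if g then (if e then actB' else actB) else (if e then actA ^^ (N - 1) else actA))"

definition acts :: "word \<Rightarrow> int \<times> int \<times> int \<Rightarrow> int \<times> int \<times> int" where
  "acts w z = foldl (\<lambda>z l. act l z) z w"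

lemma acts_append: "acts (v @ w) z = acts w (acts v z)" by (simp add: acts_def)
lemma acts_Nil [simp]: "acts [] z = z" by (simp add: acts_def)
lemma acts_Cons: "acts (l # w) z = acts w (act l z)" by (simp add: acts_def)

lemma act_cong: "z \<doteq> z' \<Longrightarrow> act l z \<doteq> act l z'"
  by (cases l) (simp add: act_def eqv_cong eqv_pow)

lemma acts_cong: "z \<doteq> z' \<Longrightarrow> acts w z \<doteq> acts w z'"
proof (induction w arbitrary: z z')
  case (Cons l w)
  show ?case unfolding acts_Cons by (rule Cons.IH[OF act_cong[OF Cons.prems]])
qed simp

lemma act_cancel: "act (g, \<not> b) (act (g, b) z) \<doteq> z"
proof -
  define p where "p = N - 1"
  have p: "N = Suc p" using N_pos by (simp add: p_def)
  have "(actA ^^ Suc p) z \<doteq> z" using actA_N[of z] unfolding p .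
  then have 1: "actA ((actA ^^ p) z) \<doteq> z" by simp
  then have 2: "(actA ^^ p) (actA z) \<doteq> z" by (simp flip: funpow_swap1)
  have 3: "actB (actB' z) = z" "actB' (actB z) = z"
    by (cases z, simp add: actB_def actB'_def)+
  show ?thesis using 1 2 3 by (cases g; cases b) (simp_all add: act_def p_def)
qed

lemma acts_winv: "acts (winv w) (acts w z) \<doteq> z"
proof (induction w arbitrary: z)
  case Nil then show ?case by (simp add: winv_def)
next
  case (Cons l w)
  obtain g e where l: "l = (g, e)" by (cases l)
  have "acts (winv (l # w)) (acts (l # w) z) = act (g, \<not> e) (acts (winv w) (acts w (act l z)))"
    by (simp add: winv_def acts_append acts_Cons l)
  also have "\<dots> \<doteq> act (g, \<not> e) (act (g, e) z)" unfolding l by (intro act_cong Cons)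
  also have "\<dots> \<doteq> z" by (rule act_cancel)
  finally show ?case .
qed

lemma winv_winv: "winv (winv w) = w"
  by (simp add: winv_def rev_map comp_def case_prod_unfold)

lemma acts_winv': "acts w (acts (winv w) z) \<doteq> z"
  using acts_winv[of "winv w" z] by (simp add: winv_winv)

text \<open>As a word, c^-1 is b^-1 a^-1 b a. Applying b a = a b c^-1 at the point z b^-1 a^-1
  leaves z c^-1.\<close>

lemma acts_winv_wC: "acts (winv wC) z \<doteq> actD z"
proof -
  let ?y = "act (False, True) (actB' z)"
  have "acts (winv wC) z = actA (actB ?y)"
    by (simp add: wC_def wA_def wB_def winv_def acts_Cons act_def)
  also have "\<dots> \<doteq> actD (actB (actA ?y))" by (rule rel_eqv[OF actA_actB])
  also have "\<dots> \<doteq> actD (actB (actB' z))"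
    using act_cancel[of False True] by (intro eqv_cong) (simp add: act_def)
  also have "actB (actB' z) = z" by (cases z) (simp add: actB_def actB'_def)
  finally show ?thesis .
qed

lemma acts_wC_actD: "acts wC (actD z) \<doteq> z"
  using eqv_trans[OF acts_cong[OF eqv_sym[OF acts_winv_wC]] acts_winv'] by simp

lemma acts_replicate: "acts (concat (replicate i w)) z = (acts w ^^ i) z"
  by (induction i arbitrary: z) (simp_all add: acts_append funpow_swap1)

lemma acts_wpow_wA: "\<exists>b. int N dvd int b - n \<and> (\<forall>z. acts (wpow wA n) z = (actA ^^ b) z)"
proof (cases "0 \<le> n")
  case True
  have "acts wA = actA" by (rule ext) (simp add: wA_def acts_Cons act_def)
  then show ?thesis using True by (intro exI[of _ "nat n"]) (simp add: wpow_def acts_replicate)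
next
  case False
  have w: "acts (winv wA) = actA ^^ (N - 1)" by (rule ext) (simp add: winv_def wA_def acts_Cons act_def)
  have "int ((N - 1) * nat (- n)) - n = int N * (- n)"
    using False N_pos by (simp add: of_nat_diff algebra_simps)
  then have "int N dvd int ((N - 1) * nat (- n)) - n" by simp
  then show ?thesis using False
    by (intro exI[of _ "(N - 1) * nat (- n)"]) (simp add: wpow_def acts_replicate w funpow_mult mult.commute)
qed

lemma acts_wpow_wB: "acts (wpow wB n) (j, i, p) = (j, i, p + n)"
proof -
  have 1: "(actB ^^ q) (j, i, p) = (j, i, p + int q)" for q by (induction q) (simp_all add: actB_def)
  have 2: "(actB' ^^ q) (j, i, p) = (j, i, p - int q)" for q by (induction q) (simp_all add: actB'_def)
  have 3: "acts wB = actB" "acts (winv wB) = actB'"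
    by (rule ext, simp add: winv_def wB_def acts_Cons act_def)+
  show ?thesis by (simp add: wpow_def acts_replicate 1 2 3)
qed

lemma acts_relator:
  assumes "w \<in> relators \<alpha> \<beta>" shows "acts w z \<doteq> z"
proof -
  consider "w = winv wC @ wA @ wC @ wpow wA (- \<alpha>)" | "w = wC @ wB @ winv wC @ wpow wB (- \<beta>)"
    using assms unfolding relators_def by blast
  then show ?thesis
  proof cases
    case 1
    define a where "a = nat (1 + x)"
    have a: "int a = 1 + x" using \<alpha>_pos by (simp add: a_def)
    obtain b where b: "int N dvd int b - (- \<alpha>)" "\<And>z. acts (wpow wA (- \<alpha>)) z = (actA ^^ b) z"
      using acts_wpow_wA by blast
    \<comment> \<open>Modulo N, b represents -\<open>\<alpha>\<close> and a represents 1 + x, so the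
      two powers of \<open>actA\<close> combine to a multiple of its period.\<close>
    have "int N dvd (int b - (- \<alpha>)) - (\<alpha> - (1 + x))" by (rule dvd_diff[OF b(1) \<alpha>])
    then have "int N dvd int (b + a)" using a by simp
    then have "N dvd b + a" using int_dvd_int_iff by blast
    then obtain q where q: "b + a = N * q" by blast
    have "acts (wA @ wC @ wpow wA (- \<alpha>)) (acts (winv wC) z) \<doteq> acts (wA @ wC @ wpow wA (- \<alpha>)) (actD z)"
      by (intro acts_cong acts_winv_wC)
    also have "\<dots> = acts (wC @ wpow wA (- \<alpha>)) (actA (actD z))"
      by (simp add: acts_append) (simp add: wA_def acts_Cons act_def)
    also have "\<dots> \<doteq> acts (wC @ wpow wA (- \<alpha>)) (actD (psi a z))"
      by (intro acts_cong rel_eqv actA_actD a)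
    also have "\<dots> \<doteq> acts (wpow wA (- \<alpha>)) (psi a z)"
      unfolding acts_append by (intro acts_cong acts_wC_actD)
    also have "\<dots> = (actA ^^ b) (psi a z)" by (rule b(2))
    also have "\<dots> \<doteq> (actA ^^ b) ((actA ^^ a) z)" by (intro eqv_pow eqv_sym[OF actA_pow])
    also have "\<dots> = (actA ^^ (b + a)) z" by (simp add: funpow_add)
    also have "\<dots> \<doteq> z" unfolding q by (rule actA_N_mult)
    finally show ?thesis unfolding 1 acts_append .
  next
    case 2
    define w' where "w' = acts wC z"
    obtain j i n where w': "w' = (j, i, n)" by (cases w')
    have D: "actD w' \<doteq> z"
      using eqv_trans[OF eqv_sym[OF acts_winv_wC] acts_winv] unfolding w'_def by simp
    have "acts wB w' = actB w'" by (simp add: wB_def acts_Cons act_def)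
    then have "acts w z = acts (wpow wB (- \<beta>)) (acts (winv wC) (actB w'))"
      unfolding 2 acts_append w'_def[symmetric] by simp
    also have "\<dots> \<doteq> acts (wpow wB (- \<beta>)) (actD (actB w'))" by (intro acts_cong acts_winv_wC)
    also have "\<dots> = (j - 1, i * pw 1, (1 + y) * (n + 1) - \<beta>)"
      unfolding w' actB_def actD_def prod.case acts_wpow_wB by simp
    also have "\<dots> \<doteq> (j - 1, i * pw 1, (1 + y) * n)"
    proof (rule rel_eqv, rule relI)
      have "(1 + y) * (n + 1) - \<beta> - (1 + y) * n = - (\<beta> - (1 + y))" by (simp add: algebra_simps)
      then show "4 * R ^ 6 dvd (1 + y) * (n + 1) - \<beta> - (1 + y) * n" using \<beta> by (simp only: dvd_minus_iff)
    qed simp_all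
    also have "\<dots> = actD w'" by (simp add: w' actD_def)
    also have "\<dots> \<doteq> z" by (rule D)
    finally show ?thesis .
  qed
qed

lemma acts_word_eq: "word_eq (relators \<alpha> \<beta>) v w \<Longrightarrow> acts v z \<doteq> acts w z"
proof (induction arbitrary: z rule: word_eq.induct)
  case (refl w) show ?case by simp
next
  case (sym u v) then show ?case by (blast intro: eqv_sym)
next
  case (trans u v w) then show ?case by (blast intro: eqv_trans)
next
  case (cancel u g e v)
  then show ?case by (simp only: acts_append acts_Cons acts_Nil) (intro acts_cong act_cancel)
next
  case (relator w u v)
  then show ?case unfolding acts_append by (intro acts_cong acts_relator)
qed

text \<open>Transitivity. The letters are used in the order c, a, b because \<open>actA\<close>
  simply adds 1 to i as long as n = 0.\<close>

lemma reachable: "\<exists>w. acts w (0, 0, 0) \<doteq> (int j, int i, int n)"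
proof -
  have "\<exists>w. acts w (0, 0, 0) \<doteq> (int j, 0, 0)"
  proof (induction j)
    case 0 show ?case by (rule exI[of _ "[]"]) simp
  next
    case (Suc j)
    then obtain w where w: "acts w (0, 0, 0) \<doteq> (int j, 0, 0)" by blast
    have "acts (w @ wC) (0, 0, 0) \<doteq> acts wC (int j, 0, 0)"
      unfolding acts_append by (rule acts_cong[OF w])
    also have "(int j, 0, 0) = actD (int (Suc j), 0, 0)" by (simp add: actD_def)
    also have "acts wC (actD (int (Suc j), 0, 0)) \<doteq> (int (Suc j), 0, 0)" by (rule acts_wC_actD)
    finally show ?case by blast
  qed
  then have "\<exists>w. acts w (0, 0, 0) \<doteq> (int j, int i, 0)"
  proof (induction i)
    case (Suc i)
    then obtain w where w: "acts w (0, 0, 0) \<doteq> (int j, int i, 0)" by auto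
    have "acts (w @ wA) (0, 0, 0) \<doteq> acts wA (int j, int i, 0)"
      unfolding acts_append by (rule acts_cong[OF w])
    also have "\<dots> = (int j, int (Suc i), 0)"
      by (simp add: wA_def acts_Cons act_def actA_def pw_0 ff_def tri_def tet_def)
    finally show ?case by blast
  qed simp
  then obtain w where w: "acts w (0, 0, 0) \<doteq> (int j, int i, 0)" by blast
  have "acts (w @ wpow wB (int n)) (0, 0, 0) \<doteq> acts (wpow wB (int n)) (int j, int i, 0)"
    unfolding acts_append by (rule acts_cong[OF w])
  then show ?thesis unfolding acts_wpow_wB by auto
qed

lemma nf_nf: "0 \<le> j \<Longrightarrow> j < Q \<Longrightarrow> 0 \<le> i \<Longrightarrow> i < E \<Longrightarrow> 0 \<le> n \<Longrightarrow> n < Q \<Longrightarrow> nf (j, i, n) = (j, i, n)"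
  by (simp add: nf_def)

lemma nf_range: "nf z \<in> {0..<Q} \<times> {0..<E} \<times> {0..<Q}"
  using Q_pos E_pos by (cases z) (simp add: nf_def Let_def)

end

section \<open>Torsion\<close>

context group begin

definition cj :: "'a \<Rightarrow> 'a \<Rightarrow> 'a" where "cj t g = t \<otimes> g \<otimes> inv t"

lemma cj_closed [simp]: "t \<in> carrier G \<Longrightarrow> g \<in> carrier G \<Longrightarrow> cj t g \<in> carrier G"
  by (simp add: cj_def)

lemma cj_mult: "t \<in> carrier G \<Longrightarrow> g \<in> carrier G \<Longrightarrow> h \<in> carrier G \<Longrightarrow> cj t (g \<otimes> h) = cj t g \<otimes> cj t h"
  by (simp add: cj_def m_assoc inv_solve_left)

lemma cj_one [simp]: "t \<in> carrier G \<Longrightarrow> cj t \<one> = \<one>"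
  by (simp add: cj_def)

lemma cj_hom: "t \<in> carrier G \<Longrightarrow> cj t \<in> hom G G"
  by (simp add: hom_def cj_mult)

lemma cj_pow: "t \<in> carrier G \<Longrightarrow> g \<in> carrier G \<Longrightarrow> cj t (g [^] (i::int)) = cj t g [^] i"
  using hom_int_pow[OF cj_hom] group_axioms by blast

lemma cj_cj: "s \<in> carrier G \<Longrightarrow> t \<in> carrier G \<Longrightarrow> g \<in> carrier G \<Longrightarrow> cj s (cj t g) = cj (s \<otimes> t) g"
  by (simp add: cj_def m_assoc inv_mult_group)

lemma cj_inv_cancel: "t \<in> carrier G \<Longrightarrow> g \<in> carrier G \<Longrightarrow> cj t (cj (inv t) g) = g"
  "t \<in> carrier G \<Longrightarrow> g \<in> carrier G \<Longrightarrow> cj (inv t) (cj t g) = g"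
  by (simp_all add: cj_cj) (simp_all add: cj_def)

lemma cj_eq_iff: "t \<in> carrier G \<Longrightarrow> g \<in> carrier G \<Longrightarrow> h \<in> carrier G \<Longrightarrow> cj t g = h \<longleftrightarrow> t \<otimes> g = h \<otimes> t"
  by (simp add: cj_def inv_solve_right')

lemma cancel_inv: "x \<in> carrier G \<Longrightarrow> y \<in> carrier G \<Longrightarrow> inv x \<otimes> (x \<otimes> y) = y"
  "x \<in> carrier G \<Longrightarrow> y \<in> carrier G \<Longrightarrow> x \<otimes> (inv x \<otimes> y) = y"
  by (simp_all flip: m_assoc)

lemma cj_inv_eq_iff:
  assumes "t \<in> carrier G" "g \<in> carrier G" "h \<in> carrier G"
  shows "cj (inv t) g = h \<longleftrightarrow> g \<otimes> t = t \<otimes> h"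
proof
  assume "cj (inv t) g = h"
  then have "t \<otimes> h = t \<otimes> (inv t \<otimes> (g \<otimes> t))" using assms by (auto simp: cj_def m_assoc)
  then show "g \<otimes> t = t \<otimes> h" using assms by (simp add: cancel_inv)
next
  assume *: "g \<otimes> t = t \<otimes> h"
  have "cj (inv t) g = inv t \<otimes> (g \<otimes> t)" using assms by (simp add: cj_def m_assoc)
  then show "cj (inv t) g = h" using assms by (simp add: * cancel_inv)
qed

lemma pow_comm: "x \<in> carrier G \<Longrightarrow> x [^] (i::int) \<otimes> x [^] (j::int) = x [^] j \<otimes> x [^] i"
  by (simp add: add.commute flip: int_pow_mult)

lemma pow_eq_one_dvd: "x \<in> carrier G \<Longrightarrow> x [^] (i::int) = \<one> \<Longrightarrow> i dvd j \<Longrightarrow> x [^] j = \<one>"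
  by (auto simp: dvd_def simp flip: int_pow_pow)

lemma pow_eqI: "x \<in> carrier G \<Longrightarrow> x [^] (k::int) = \<one> \<Longrightarrow> k dvd i - j \<Longrightarrow> x [^] i = x [^] j"
  using pow_eq_one_dvd[of x k "i - j"] by (simp add: int_pow_diff inv_solve_right')

lemma commute_pow:
  assumes "x \<in> carrier G" "y \<in> carrier G" "x \<otimes> y = y \<otimes> x"
  shows "x \<otimes> y [^] (i::int) = y [^] i \<otimes> x"
proof -
  have "cj x y = y" using assms by (simp add: cj_eq_iff)
  then have "cj x (y [^] i) = y [^] i" using assms by (simp add: cj_pow)
  then show ?thesis using assms by (simp add: cj_eq_iff)
qed

lemma commute_inv:
  assumes "x \<in> carrier G" "y \<in> carrier G" "x \<otimes> y = y \<otimes> x"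
  shows "x \<otimes> inv y = inv y \<otimes> x"
  using commute_pow[OF assms, of "- 1"] assms by (simp add: int_pow_neg)

lemma commute_mult:
  assumes "x \<in> carrier G" "y \<in> carrier G" "z \<in> carrier G" "x \<otimes> y = y \<otimes> x" "x \<otimes> z = z \<otimes> x"
  shows "x \<otimes> (y \<otimes> z) = (y \<otimes> z) \<otimes> x"
  using assms by (metis m_assoc)

lemma cj_pow_id:
  assumes "t \<in> carrier G" "g \<in> carrier G" "cj t g = g" shows "cj (t [^] (i::int)) g = g"
proof -
  have "g \<otimes> t = t \<otimes> g" using assms by (simp add: cj_eq_iff)
  then have "g \<otimes> t [^] i = t [^] i \<otimes> g" using assms by (intro commute_pow) auto
  then show ?thesis using assms by (simp add: cj_eq_iff)
qed

end

section \<open>Commutation rules in a group with the two Macdonald relations\<close>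

definition geo :: "int \<Rightarrow> nat \<Rightarrow> int" where "geo z n = (\<Sum>i<n. z ^ Suc i)"

lemma geo_0 [simp]: "geo z 0 = 0" and geo_Suc: "geo z (Suc n) = geo z n * z + z"
proof -
  show "geo z 0 = 0" by (simp add: geo_def)
  show "geo z (Suc n) = geo z n * z + z"
    unfolding geo_def sum.lessThan_Suc_shift by (simp add: sum_distrib_left sum_distrib_right mult.commute)
qed

lemma geo_mult: "geo z n * (z - 1) = z * (z ^ n - 1)"
  by (induction n) (simp_all add: geo_Suc algebra_simps)

locale macd = group G for G (structure) +
  fixes a b c :: 'a and \<alpha> \<beta> :: int
  assumes a_in [simp]: "a \<in> carrier G" and b_in [simp]: "b \<in> carrier G" and c_in [simp]: "c \<in> carrier G"
    and ab: "a \<otimes> b = b \<otimes> a \<otimes> c" and ac: "a \<otimes> c = c \<otimes> a [^] \<alpha>" and cb: "c \<otimes> b = b [^] \<beta> \<otimes> c"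
begin

text \<open>Exchanging the generators turns [a,b] into [b,a] = c^-1, so every fact about a has a
  mirror image about b.\<close>

lemma swap: "macd G b a (inv c) \<beta> \<alpha>"
proof unfold_locales
  show "b \<otimes> a = a \<otimes> b \<otimes> inv c" using ab by (simp add: m_assoc)
  have "cj c b = b [^] \<beta>" using cb by (simp add: cj_eq_iff)
  then have "cj (inv (inv c)) b = b [^] \<beta>" by simp
  then show "b \<otimes> inv c = inv c \<otimes> b [^] \<beta>" by (subst (asm) cj_inv_eq_iff) auto
  have "cj (inv c) a = a [^] \<alpha>" using ac by (simp add: cj_inv_eq_iff)
  then show "inv c \<otimes> a = a [^] \<alpha> \<otimes> inv c" by (simp add: cj_eq_iff)
qed auto

lemma cj_c_b: "cj (c [^] int n) (b [^] i) = b [^] (i * \<beta> ^ n)"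
proof (induction n arbitrary: i)
  case 0 then show ?case by (simp add: cj_def)
next
  case (Suc n)
  have 1: "cj c (b [^] i) = b [^] (i * \<beta>)" for i
  proof -
    have "cj c b = b [^] \<beta>" using cb by (simp add: cj_eq_iff)
    then show ?thesis by (simp add: cj_pow int_pow_pow mult.commute)
  qed
  have "c [^] int (Suc n) = c \<otimes> c [^] int n" using int_pow_mult[of c 1 "int n"] by simp
  then have "cj (c [^] int (Suc n)) (b [^] i) = cj c (cj (c [^] int n) (b [^] i))" by (simp add: cj_cj)
  also have "\<dots> = b [^] (i * \<beta> ^ n * \<beta>)" unfolding Suc 1 ..
  finally show ?case by (simp add: ac_simps)
qed

lemma c_b: "c [^] int n \<otimes> b [^] i = b [^] (i * \<beta> ^ n) \<otimes> c [^] int n"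
  using cj_c_b by (simp add: cj_eq_iff)

lemma cj_c_a: "cj (c [^] (- int n)) (a [^] i) = a [^] (i * \<alpha> ^ n)"
proof -
  interpret s: macd G b a "inv c" \<beta> \<alpha> by (rule swap)
  show ?thesis using s.cj_c_b[of n i] by (simp add: int_pow_inv int_pow_neg)
qed

lemma a_c: "a [^] i \<otimes> c [^] int n = c [^] int n \<otimes> a [^] (i * \<alpha> ^ n)"
  using cj_c_a[of n i] by (simp add: cj_inv_eq_iff int_pow_neg)

lemma pow_ac: "(a \<otimes> c) [^] int n = c [^] int n \<otimes> a [^] geo \<alpha> n"
proof (induction n)
  case (Suc n)
  have "(a \<otimes> c) [^] int (Suc n) = (a \<otimes> c) [^] int n \<otimes> (a \<otimes> c)"
    using int_pow_mult[of "a \<otimes> c" "int n" 1] by (simp add: add.commute)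
  also have "\<dots> = c [^] int n \<otimes> (a [^] (geo \<alpha> n + 1) \<otimes> c [^] int 1)"
    unfolding Suc by (simp add: int_pow_mult m_assoc)
  also have "\<dots> = c [^] int n \<otimes> (c [^] int 1 \<otimes> a [^] ((geo \<alpha> n + 1) * \<alpha> ^ 1))" unfolding a_c ..
  also have "\<dots> = (c [^] int n \<otimes> c [^] int 1) \<otimes> a [^] geo \<alpha> (Suc n)"
    by (simp add: m_assoc geo_Suc algebra_simps)
  also have "c [^] int n \<otimes> c [^] int 1 = c [^] int (Suc n)"
    by (simp only: int_pow_mult[symmetric] c_in) (simp add: add.commute)
  finally show ?case .
qed simp

lemma cj_b_a: "cj (inv b) (a [^] (i::int)) = (a \<otimes> c) [^] i"
proof -
  have "cj (inv b) a = a \<otimes> c" using ab by (simp add: cj_inv_eq_iff m_assoc)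
  then show ?thesis by (simp only: cj_pow inv_closed a_in b_in)
qed

lemma a_b: "a [^] int n \<otimes> b = b \<otimes> (c [^] int n \<otimes> a [^] geo \<alpha> n)"
  using cj_b_a[of "int n"] unfolding pow_ac by (simp add: cj_inv_eq_iff)

lemma cj_b_a_nat: "cj (inv b) (a [^] int n) = c [^] int n \<otimes> a [^] geo \<alpha> n"
  using cj_b_a[of "int n"] unfolding pow_ac .

lemma cj_a_b: "cj (inv a) (b [^] (i::int)) = (b \<otimes> inv c) [^] i"
  and pow_bc: "(b \<otimes> inv c) [^] int n = c [^] (- int n) \<otimes> b [^] geo \<beta> n"
  and cj_a_b_nat: "cj (inv a) (b [^] int n) = c [^] (- int n) \<otimes> b [^] geo \<beta> n"
proof -
  interpret s: macd G b a "inv c" \<beta> \<alpha> by (rule swap)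
  show "cj (inv a) (b [^] (i::int)) = (b \<otimes> inv c) [^] i" by (rule s.cj_b_a)
  show "(b \<otimes> inv c) [^] int n = c [^] (- int n) \<otimes> b [^] geo \<beta> n"
    using s.pow_ac by (simp add: int_pow_inv int_pow_neg)
  show "cj (inv a) (b [^] int n) = c [^] (- int n) \<otimes> b [^] geo \<beta> n"
    using s.cj_b_a_nat by (simp add: int_pow_inv int_pow_neg)
qed

lemma c_eq: "c = inv a \<otimes> inv b \<otimes> a \<otimes> b"
  using ab by (simp add: m_assoc cancel_inv)

lemma commute_c:
  assumes "z \<in> carrier G" "z \<otimes> a = a \<otimes> z" "z \<otimes> b = b \<otimes> z"
  shows "z \<otimes> c = c \<otimes> z"
  unfolding c_eq using assms by (intro commute_mult commute_inv) auto

end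

context group begin

lemma cj_commute:
  "t \<in> carrier G \<Longrightarrow> x \<in> carrier G \<Longrightarrow> cj t (x [^] (i::int)) \<otimes> cj t (x [^] (j::int)) = cj t (x [^] j) \<otimes> cj t (x [^] i)"
  using pow_comm[of x i j] by (simp flip: cj_mult)

lemma cj_inv: "t \<in> carrier G \<Longrightarrow> x \<in> carrier G \<Longrightarrow> inv (cj t x) = cj t (inv x)"
  by (simp add: cj_def inv_mult_group m_assoc)

end

context macd begin

text \<open>Conjugation by positive powers of c extracts roots of powers of a. The exponent is kept
  as a multiple of \<open>\<alpha>\<close>^n because \<open>\<alpha>\<close> is not yet known to be
  invertible modulo the order of a.\<close>

lemma cj_c_a_root: "cj (c [^] int n) (a [^] (i * \<alpha> ^ n)) = a [^] i"
  using cj_c_a[of n i] cj_inv_cancel(1)[of "c [^] int n" "a [^] i"] by (simp add: int_pow_neg)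

lemma cj_c_b_root: "cj (c [^] (- int n)) (b [^] (i * \<beta> ^ n)) = b [^] i"
  using cj_c_b[of n i] cj_inv_cancel(2)[of "c [^] int n" "b [^] i"] by (simp add: int_pow_neg)

lemma geo_factor: "geo z n = (\<Sum>i<n. z ^ i) * z ^ 1"
  by (simp add: geo_def sum_distrib_left mult.commute)

text \<open>Both sides come from conjugating a by b^-\<open>\<beta>\<close>: through
  b^\<open>\<beta>\<close> = c b c^-1 the result is (c a)^\<open>\<alpha>\<close>, and moving
  b^-\<open>\<beta>\<close> directly past a gives the right-hand side.\<close>

lemma base_relation: "(c \<otimes> a) [^] \<alpha> = a \<otimes> ((b \<otimes> inv c) [^] (- \<beta>) \<otimes> b [^] \<beta>)"
proof -
  have b\<beta>: "b [^] \<beta> = cj c b" using cj_c_b[of 1 1] by simp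
  have a\<alpha>: "cj (inv c) a = a [^] \<alpha>" using cj_c_a[of 1 1] by (simp add: int_pow_neg)
  have "cj (inv (b [^] \<beta>)) a = cj (cj c (inv b)) a" unfolding b\<beta> by (simp add: cj_inv)
  also have "\<dots> = cj c (cj (inv b) (cj (inv c) a))" by (simp add: cj_cj m_assoc) (simp add: cj_def m_assoc)
  also have "\<dots> = cj c ((a \<otimes> c) [^] \<alpha>)" unfolding a\<alpha> cj_b_a ..
  also have "\<dots> = (cj c (a \<otimes> c)) [^] \<alpha>" by (simp add: cj_pow)
  also have "cj c (a \<otimes> c) = c \<otimes> a" by (simp add: cj_def m_assoc)
  finally have 1: "(c \<otimes> a) [^] \<alpha> = inv (b [^] \<beta>) \<otimes> a \<otimes> b [^] \<beta>" by (simp add: cj_def)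
  have "cj (inv a) (b [^] (- \<beta>)) = (b \<otimes> inv c) [^] (- \<beta>)" by (rule cj_a_b)
  then have "b [^] (- \<beta>) \<otimes> a = a \<otimes> (b \<otimes> inv c) [^] (- \<beta>)" by (simp add: cj_inv_eq_iff)
  then show ?thesis unfolding 1 by (simp add: int_pow_neg m_assoc)
qed

lemma pow_ca:
  fixes t :: int
  assumes geo: "geo \<alpha> n = t * \<alpha> ^ 1"
  shows "(c \<otimes> a) [^] int n = c [^] int n \<otimes> a [^] t"
proof -
  have "c \<otimes> a = cj c (a \<otimes> c)" by (simp add: cj_def m_assoc)
  then have "(c \<otimes> a) [^] int n = cj c ((a \<otimes> c) [^] int n)" by (simp add: cj_pow)
  also have "\<dots> = cj c (c [^] int n) \<otimes> cj c (a [^] geo \<alpha> n)" unfolding pow_ac by (simp add: cj_mult)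
  also have "cj c (c [^] int n) = c [^] int n" by (simp add: cj_pow) (simp add: cj_def m_assoc)
  also have "cj c (a [^] geo \<alpha> n) = a [^] t" using cj_c_a_root[of 1 t] by (simp add: geo)
  finally show ?thesis .
qed

text \<open>The torsion argument needs only this shape of one side of \<open>base_relation\<close>;
  just the power of c must be explicit, to be compared with that of the other side.\<close>

lemma pow_ca_form: "\<exists>(i::nat) (j::int). (c \<otimes> a) [^] \<alpha> = cj (c [^] int i) (a [^] j) \<otimes> c [^] \<alpha>"
proof -
  obtain t where t: "(c \<otimes> a) [^] int (nat \<bar>\<alpha>\<bar>) = c [^] int (nat \<bar>\<alpha>\<bar>) \<otimes> a [^] (t::int)"
    using pow_ca[OF geo_factor] by blast
  show ?thesis
  proof (cases "\<alpha> \<ge> 0")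
    case True
    then have "(c \<otimes> a) [^] \<alpha> = cj (c [^] int (nat \<alpha>)) (a [^] t) \<otimes> c [^] \<alpha>"
      using t by (simp add: cj_def m_assoc)
    then show ?thesis by blast
  next
    case False
    then have "(c \<otimes> a) [^] \<alpha> = inv ((c \<otimes> a) [^] int (nat \<bar>\<alpha>\<bar>))" by (simp flip: int_pow_neg)
    also have "\<dots> = cj (c [^] int 0) (a [^] (- t)) \<otimes> c [^] \<alpha>"
      unfolding t using False by (simp add: cj_def inv_mult_group flip: int_pow_neg)
    finally show ?thesis by blast
  qed
qed

lemma pow_bc_pos:
  assumes n: "int n = \<beta>"
  shows "(b \<otimes> inv c) [^] (- \<beta>) \<otimes> b [^] \<beta> = b [^] (\<beta> * \<beta> ^ n - geo \<beta> n) \<otimes> c [^] \<beta>"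
proof -
  have "(b \<otimes> inv c) [^] (- \<beta>) = inv (c [^] (- int n) \<otimes> b [^] geo \<beta> n)"
    using pow_bc[of n] n by (simp add: int_pow_neg)
  also have "\<dots> = b [^] (- geo \<beta> n) \<otimes> c [^] int n"
    by (simp add: inv_mult_group int_pow_neg)
  finally have "(b \<otimes> inv c) [^] (- \<beta>) \<otimes> b [^] \<beta> = b [^] (- geo \<beta> n) \<otimes> (c [^] int n \<otimes> b [^] \<beta>)"
    by (simp add: m_assoc)
  also have "\<dots> = (b [^] (- geo \<beta> n) \<otimes> b [^] (\<beta> * \<beta> ^ n)) \<otimes> c [^] \<beta>" unfolding c_b by (simp add: m_assoc n)
  also have "b [^] (- geo \<beta> n) \<otimes> b [^] (\<beta> * \<beta> ^ n) = b [^] (\<beta> * \<beta> ^ n - geo \<beta> n)"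
    by (simp add: add.commute flip: int_pow_mult)
  finally show ?thesis .
qed

text \<open>That q is nonzero follows from (\<open>\<beta>\<close> - 1) q > 0. Oddness and
  \<open>\<beta> \<noteq> 1\<close> leave either \<open>\<beta> \<ge> 3\<close> or a negative
  \<open>\<beta>\<close> whose power with exponent -\<open>\<beta>\<close> is negative.\<close>

lemma pow_bc_form:
  assumes "odd \<beta>" "\<beta> \<noteq> 1"
  shows "\<exists>(i::nat) (q::int). q \<noteq> 0 \<and> (b \<otimes> inv c) [^] (- \<beta>) \<otimes> b [^] \<beta> = cj (c [^] (- int i)) (b [^] q) \<otimes> c [^] \<beta>"
proof (cases "\<beta> \<ge> 0")
  case True
  define n where "n = nat \<beta>"
  have n: "int n = \<beta>" using True by (simp add: n_def)
  have \<beta>: "\<beta> \<ge> 3" using True assms by presburger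
  define q where "q = \<beta> * \<beta> ^ n - geo \<beta> n"
  have "(\<beta> - 1) * q = (\<beta> - 1) * (\<beta> * \<beta> ^ n) - geo \<beta> n * (\<beta> - 1)" unfolding q_def by (simp add: algebra_simps)
  also have "\<dots> = \<beta> ^ n * (\<beta> * (\<beta> - 2)) + \<beta>" unfolding geo_mult by (simp add: algebra_simps)
  also have "\<dots> > 0" using \<beta> by (intro add_nonneg_pos mult_nonneg_nonneg) auto
  finally have q0: "q \<noteq> 0" by auto
  have "(b \<otimes> inv c) [^] (- \<beta>) \<otimes> b [^] \<beta> = cj (c [^] (- int 0)) (b [^] q) \<otimes> c [^] \<beta>"
    unfolding pow_bc_pos[OF n] q_def by (simp add: cj_def)
  then show ?thesis using q0 by blast
next
  case False
  define n where "n = nat (- \<beta>)"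
  have n: "- \<beta> = int n" using False by (simp add: n_def)
  define q where "q = geo \<beta> n + \<beta>"
  have "odd n" using assms(1) n by (metis even_minus even_of_nat)
  then have neg: "\<beta> ^ n < 0" using False by (simp add: power_less_zero_eq)
  have "(\<beta> - 1) * q = geo \<beta> n * (\<beta> - 1) + \<beta> * (\<beta> - 1)" unfolding q_def by (simp add: algebra_simps)
  also have "\<dots> = \<beta> * (\<beta> ^ n - 2 + \<beta>)" unfolding geo_mult by (simp add: algebra_simps)
  also have "\<dots> > 0"
  proof (rule mult_neg_neg)
    show "\<beta> ^ n - 2 + \<beta> < 0" using False neg by linarith
  qed (use False in simp)
  finally have q0: "q \<noteq> 0" by auto
  have "(b \<otimes> inv c) [^] (- \<beta>) \<otimes> b [^] \<beta> = c [^] (- int n) \<otimes> (b [^] geo \<beta> n \<otimes> b [^] \<beta>)"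
    unfolding n pow_bc by (simp add: m_assoc)
  also have "b [^] geo \<beta> n \<otimes> b [^] \<beta> = b [^] q" by (simp add: q_def int_pow_mult)
  also have "c [^] (- int n) \<otimes> b [^] q = cj (c [^] (- int n)) (b [^] q) \<otimes> c [^] (- int n)"
    by (simp add: cj_def m_assoc)
  also have "\<dots> = cj (c [^] (- int n)) (b [^] q) \<otimes> c [^] \<beta>"
    by (rule arg_cong[where f = "\<lambda>j::int. _ \<otimes> c [^] j"]) (use n in linarith)
  finally show ?thesis using q0 by blast
qed

text \<open>By \<open>base_relation\<close>, Y = X0 c^(\<open>\<beta>\<close> -
  \<open>\<alpha>\<close>), where Y and X0 are conjugates by powers of c of powers of a and of b. In
  z = (c Y c^-1) Y^-1 the power of c cancels, so z is again both such a conjugate of a power of a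
  and one of a power of b. Then z commutes with a and b, hence with c, and equals
  b^(q(\<open>\<beta>\<close> - 1)); commuting with c kills b^(q(\<open>\<beta>\<close> -
  1)^2).\<close>

lemma b_torsion:
  assumes "odd \<beta>" "\<beta> \<noteq> 1"
  shows "\<exists>n::int. n > 0 \<and> b [^] n = \<one>"
proof -
  obtain i :: nat and j :: int where ij: "(c \<otimes> a) [^] \<alpha> = cj (c [^] int i) (a [^] j) \<otimes> c [^] \<alpha>"
    using pow_ca_form by blast
  obtain i' :: nat and q :: int where q: "q \<noteq> 0"
    and iq: "(b \<otimes> inv c) [^] (- \<beta>) \<otimes> b [^] \<beta> = cj (c [^] (- int i')) (b [^] q) \<otimes> c [^] \<beta>"
    using pow_bc_form[OF assms] by blast
  define X0 where "X0 = cj (c [^] (- int i')) (b [^] q)"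
  have X0_in [simp]: "X0 \<in> carrier G" by (simp add: X0_def)
  define Y where "Y = cj (c [^] int i) (a [^] (j - \<alpha> ^ i))"
  have Y_in [simp]: "Y \<in> carrier G" by (simp add: Y_def)
  have eq: "cj (c [^] int i) (a [^] j) \<otimes> c [^] \<alpha> = a \<otimes> (X0 \<otimes> c [^] \<beta>)"
    using base_relation unfolding ij iq X0_def .
  have "inv a = cj (c [^] int i) (a [^] (- (\<alpha> ^ i)))"
    using cj_c_a_root[of i "- 1"] by (simp add: int_pow_neg)
  then have "Y = inv a \<otimes> cj (c [^] int i) (a [^] j)"
    unfolding Y_def by (simp add: add.commute flip: cj_mult int_pow_mult)
  then have "Y \<otimes> c [^] \<alpha> = inv a \<otimes> (cj (c [^] int i) (a [^] j) \<otimes> c [^] \<alpha>)" by (simp add: m_assoc)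
  also have "\<dots> = X0 \<otimes> c [^] \<beta>" unfolding eq by (simp add: cancel_inv)
  finally have "Y \<otimes> c [^] \<alpha> \<otimes> inv (c [^] \<alpha>) = X0 \<otimes> c [^] \<beta> \<otimes> inv (c [^] \<alpha>)" by simp
  then have Y: "Y = X0 \<otimes> c [^] (\<beta> - \<alpha>)" by (simp add: m_assoc int_pow_diff)
  define z where "z = cj c Y \<otimes> inv Y"
  have z_in [simp]: "z \<in> carrier G" by (simp add: z_def)
  have cc: "cj c (c [^] (k::int)) = c [^] k" for k by (simp add: cj_pow) (simp add: cj_def m_assoc)
  have "z = cj c X0 \<otimes> c [^] (\<beta> - \<alpha>) \<otimes> (inv (c [^] (\<beta> - \<alpha>)) \<otimes> inv X0)"
    unfolding z_def Y by (simp add: cj_mult cc inv_mult_group)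
  also have "\<dots> = cj c X0 \<otimes> inv X0" by (simp add: m_assoc cancel_inv)
  finally have z1: "z = cj c X0 \<otimes> inv X0" .
  have cswap: "c \<otimes> c [^] (k::int) = c [^] k \<otimes> c" for k using pow_comm[of c 1 k] by simp
  have "cj c X0 = cj (c [^] (- int i')) (cj c (b [^] q))" unfolding X0_def by (simp add: cj_cj cswap)
  also have "cj c (b [^] q) = b [^] (q * \<beta>)" using cj_c_b[of 1 q] by simp
  finally have z2: "z = cj (c [^] (- int i')) (b [^] (q * (\<beta> - 1)))"
    unfolding z1 X0_def by (simp add: cj_inv right_diff_distrib int_pow_diff flip: cj_mult)
  have "cj c Y = cj (c [^] int (Suc i)) (a [^] (j - \<alpha> ^ i))"
    unfolding Y_def using int_pow_mult[of c 1 "int i"] by (simp add: cj_cj)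
  moreover have "inv Y = cj (c [^] int (Suc i)) (a [^] (- (j - \<alpha> ^ i) * \<alpha>))"
  proof -
    have "cj (c [^] int (Suc i)) (a [^] (- (j - \<alpha> ^ i) * \<alpha>)) = cj (c [^] int i) (cj c (a [^] (- (j - \<alpha> ^ i) * \<alpha> ^ 1)))"
      using int_pow_mult[of c "int i" 1] by (simp add: cj_cj add.commute)
    also have "cj c (a [^] (- (j - \<alpha> ^ i) * \<alpha> ^ 1)) = a [^] (- (j - \<alpha> ^ i))"
      using cj_c_a_root[of 1 "- (j - \<alpha> ^ i)"] by simp
    also have "cj (c [^] int i) (a [^] (- (j - \<alpha> ^ i))) = inv Y"
      unfolding Y_def by (simp only: cj_inv int_pow_closed c_in a_in int_pow_neg)
    finally show ?thesis by (rule HOL.sym)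
  qed
  ultimately obtain p :: int where z3: "z = cj (c [^] int (Suc i)) (a [^] p)"
    unfolding z_def by (metis a_in c_in cj_mult int_pow_closed int_pow_mult)
  have za: "z \<otimes> a = a \<otimes> z"
  proof -
    \<comment> \<open>Written as a conjugate by the same power of c, a visibly commutes with
      z.\<close>
    have "a = cj (c [^] int (Suc i)) (a [^] (\<alpha> ^ Suc i))" using cj_c_a_root[of "Suc i" 1] by simp
    then show ?thesis unfolding z3 by (metis cj_commute a_in c_in int_pow_closed)
  qed
  have zb: "z \<otimes> b = b \<otimes> z"
  proof -
    have "b = cj (c [^] (- int i')) (b [^] (\<beta> ^ i'))" using cj_c_b_root[of i' 1] by simp
    then show ?thesis unfolding z2 by (metis cj_commute b_in c_in int_pow_closed)
  qed
  have zc: "z \<otimes> c = c \<otimes> z" by (rule commute_c[OF z_in za zb])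
  then have "cj (c [^] int i') z = z"
    using commute_pow[of z c "int i'"] by (simp add: cj_eq_iff)
  moreover have "cj (c [^] int i') z = b [^] (q * (\<beta> - 1))"
    unfolding z2 using cj_inv_cancel(1)[of "c [^] int i'"] by (simp add: int_pow_neg)
  ultimately have z4: "z = b [^] (q * (\<beta> - 1))" by simp
  have "cj c z = z" using zc by (simp add: cj_eq_iff)
  then have "b [^] (q * (\<beta> - 1) * \<beta>) = b [^] (q * (\<beta> - 1))"
    unfolding z4 using cj_c_b[of 1 "q * (\<beta> - 1)"] by simp
  then have "b [^] (q * (\<beta> - 1) * \<beta> - q * (\<beta> - 1)) = \<one>" by (simp add: int_pow_diff)
  then have "b [^] (q * (\<beta> - 1) ^ 2) = \<one>" by (simp add: power2_eq_square algebra_simps)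
  then have "b [^] \<bar>q * (\<beta> - 1) ^ 2\<bar> = \<one>"
    by (rule pow_eq_one_dvd[rotated]) auto
  then show ?thesis using q assms by (intro exI[of _ "\<bar>q * (\<beta> - 1) ^ 2\<bar>"]) auto
qed

lemma a_torsion:
  assumes "odd \<alpha>" "\<alpha> \<noteq> 1" shows "\<exists>n::int. n > 0 \<and> a [^] n = \<one>"
proof -
  interpret s: macd G b a "inv c" \<beta> \<alpha> by (rule swap)
  show ?thesis by (rule s.b_torsion[OF assms])
qed

lemma c_pow_a:
  assumes "a [^] int n = \<one>" shows "c [^] int n = a [^] (- geo \<alpha> n)"
proof -
  have "c [^] int n \<otimes> a [^] geo \<alpha> n = \<one>" using cj_b_a_nat[of n] assms by simp
  then show ?thesis by (simp add: int_pow_neg inv_equality)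
qed

text \<open>Conjugating a^n = 1 by b puts c^n into the cyclic group of a, where n-th powers are
  trivial.\<close>

lemma c_torsion:
  assumes "a [^] int n = \<one>" shows "c [^] (int n * int n) = \<one>"
proof -
  have "c [^] (int n * int n) = (c [^] int n) [^] int n" by (simp add: int_pow_pow)
  also have "\<dots> = (a [^] int n) [^] (- geo \<alpha> n)" unfolding c_pow_a[OF assms] by (simp add: int_pow_pow mult.commute)
  finally show ?thesis using assms by simp
qed

end

section \<open>Counting orbits, products of subgroups and cyclic subgroups\<close>

lemma card_image_cong:
  assumes "\<And>x y. x \<in> A \<Longrightarrow> y \<in> A \<Longrightarrow> f x = f y \<longleftrightarrow> g x = g y"
  shows "card (f ` A) = card (g ` A)"
proof (rule bij_betw_same_card)
  let ?h = "\<lambda>y. g (SOME x. x \<in> A \<and> f x = y)"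
  have h: "?h (f x) = g x" if "x \<in> A" for x
  proof -
    have "(SOME x'. x' \<in> A \<and> f x' = f x) \<in> A \<and> f (SOME x'. x' \<in> A \<and> f x' = f x) = f x"
      by (rule someI) (use that in blast)
    then show ?thesis using assms that by blast
  qed
  show "bij_betw ?h (f ` A) (g ` A)"
    unfolding bij_betw_def inj_on_def image_image using h assms by (auto simp: image_iff)
qed

context group begin

text \<open>A right action in disguise: the fibre of \<open>\<phi> \<one>\<close> is the stabiliser
  and the fibres are its right cosets.\<close>

lemma card_fibres_dvd_order:
  assumes fin: "finite (carrier G)"
    and \<phi>: "\<And>g g' h. g \<in> carrier G \<Longrightarrow> g' \<in> carrier G \<Longrightarrow> h \<in> carrier G \<Longrightarrow> \<phi> g = \<phi> g' \<Longrightarrow> \<phi> (g \<otimes> h) = \<phi> (g' \<otimes> h)"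
  shows "card (\<phi> ` carrier G) dvd order G"
proof -
  define H where "H = {g \<in> carrier G. \<phi> g = \<phi> \<one>}"
  have iff: "\<phi> g = \<phi> g' \<longleftrightarrow> g \<otimes> inv g' \<in> H" if "g \<in> carrier G" "g' \<in> carrier G" for g g'
  proof
    assume "\<phi> g = \<phi> g'"
    then have "\<phi> (g \<otimes> inv g') = \<phi> (g' \<otimes> inv g')" using that \<phi> by blast
    then show "g \<otimes> inv g' \<in> H" using that by (simp add: H_def)
  next
    assume "g \<otimes> inv g' \<in> H"
    then have "\<phi> (g \<otimes> inv g' \<otimes> g') = \<phi> (\<one> \<otimes> g')" using that \<phi> unfolding H_def by blast
    then show "\<phi> g = \<phi> g'" using that by (simp add: m_assoc)
  qed
  have "subgroup H G"
  proof (rule subgroupI)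
    show "H \<subseteq> carrier G" "H \<noteq> {}" by (auto simp: H_def)
    show "inv g \<in> H" if "g \<in> H" for g
      using that iff[of \<one> g] by (simp add: H_def)
    show "g \<otimes> h \<in> H" if "g \<in> H" "h \<in> H" for g h
      using that \<phi>[of g \<one> h] by (simp add: H_def)
  qed
  then have "card (rcosets H) * card H = order G" by (rule lagrange)
  moreover have "card (rcosets H) = card (\<phi> ` carrier G)"
  proof -
    have "rcosets H = (\<lambda>g. H #> g) ` carrier G" by (auto simp: RCOSETS_def)
    moreover have "card ((\<lambda>g. H #> g) ` carrier G) = card (\<phi> ` carrier G)"
    proof (rule card_image_cong)
      fix g g' assume g: "g \<in> carrier G" "g' \<in> carrier G"
      have "H #> g = H #> g' \<longleftrightarrow> g \<in> H #> g'"
        using \<open>subgroup H G\<close> g by (metis repr_independence rcos_self)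
      also have "\<dots> \<longleftrightarrow> g \<otimes> inv g' \<in> H"
        using subgroup.rcos_module[OF \<open>subgroup H G\<close> group_axioms g(2,1)] .
      finally show "H #> g = H #> g' \<longleftrightarrow> \<phi> g = \<phi> g'" using iff[OF g] by simp
    qed
    ultimately show ?thesis by simp
  qed
  ultimately show ?thesis by (metis dvd_triv_left)
qed

text \<open>Every fibre of H \<times> K \<rightarrow> HK has as many elements as H \<inter> K, also
  when HK is not a subgroup. Divisibility rather than an inequality is needed, to transport oddness
  and being a power of 2.\<close>

lemma card_set_mult_dvd:
  assumes H: "subgroup H G" and K: "subgroup K G" and fin: "finite H" "finite K"
  shows "card (H <#> K) dvd card H * card K"
proof -
  let ?f = "\<lambda>(h, k). h \<otimes> k"
  note Hc = subgroup.mem_carrier[OF H] and Kc = subgroup.mem_carrier[OF K]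
  have img: "H <#> K = ?f ` (H \<times> K)" by (auto simp: set_mult_def)
  have fib: "card {p \<in> H \<times> K. ?f p = g} = card (H \<inter> K)" if gHK: "g \<in> H <#> K" for g
  proof -
    obtain h k where hk: "h \<in> H" "k \<in> K" "g = h \<otimes> k" using gHK unfolding set_mult_def by blast
    have "bij_betw (\<lambda>t. (h \<otimes> t, inv t \<otimes> k)) (H \<inter> K) {p \<in> H \<times> K. ?f p = g}"
    proof (rule bij_betw_imageI)
      show "inj_on (\<lambda>t. (h \<otimes> t, inv t \<otimes> k)) (H \<inter> K)"
        by (rule inj_onI) (use Hc[OF hk(1)] Hc in auto)
      show "(\<lambda>t. (h \<otimes> t, inv t \<otimes> k)) ` (H \<inter> K) = {p \<in> H \<times> K. ?f p = g}"
      proof (intro equalityI subsetI)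
        fix p assume "p \<in> (\<lambda>t. (h \<otimes> t, inv t \<otimes> k)) ` (H \<inter> K)"
        then obtain t where t: "t \<in> H" "t \<in> K" "p = (h \<otimes> t, inv t \<otimes> k)" by auto
        have "h \<otimes> t \<in> H" by (rule subgroup.m_closed[OF H hk(1) t(1)])
        moreover have "inv t \<otimes> k \<in> K"
          by (rule subgroup.m_closed[OF K subgroup.m_inv_closed[OF K t(2)] hk(2)])
        moreover have "h \<otimes> t \<otimes> (inv t \<otimes> k) = g"
          using hk(3) Hc[OF hk(1)] Hc[OF t(1)] Kc[OF hk(2)] by (simp add: m_assoc cancel_inv)
        ultimately show "p \<in> {p \<in> H \<times> K. ?f p = g}" unfolding t by simp
      next
        fix p assume "p \<in> {p \<in> H \<times> K. ?f p = g}"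
        moreover obtain h' k' where p1: "p = (h', k')" by (cases p)
        ultimately have p: "p = (h', k')" "h' \<in> H" "k' \<in> K" "h' \<otimes> k' = h \<otimes> k"
          unfolding hk(3) by simp_all
        define t where "t = inv h \<otimes> h'"
        have tH: "t \<in> H" 
          unfolding t_def by (intro subgroup.m_closed[OF H] subgroup.m_inv_closed[OF H] p hk)
        have "t = inv h \<otimes> (h' \<otimes> k' \<otimes> inv k')" 
          unfolding t_def using Hc[OF p(2)] Kc[OF p(3)] by (simp add: m_assoc)
        also have "\<dots> = k \<otimes> inv k'" 
          unfolding p(4) using Kc[OF p(3)] Hc[OF hk(1)] Kc[OF hk(2)] by (simp add: m_assoc cancel_inv)
        finally have t: "t = k \<otimes> inv k'" .
        have "t \<in> K" 
          unfolding t by (intro subgroup.m_closed[OF K] subgroup.m_inv_closed[OF K] p hk)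
        moreover have "h' = h \<otimes> t" 
          unfolding t_def using Hc[OF p(2)] Hc[OF hk(1)] by (simp add: cancel_inv)
        moreover have "k' = inv t \<otimes> k" 
          unfolding t using Kc[OF p(3)] Kc[OF hk(2)] by (simp add: inv_mult_group m_assoc)
        ultimately show "p \<in> (\<lambda>t. (h \<otimes> t, inv t \<otimes> k)) ` (H \<inter> K)" using tH p by blast
      qed
    qed
    then show ?thesis by (rule bij_betw_same_card[symmetric])
  qed
  have "card H * card K = card (H \<times> K)" by (simp add: card_cartesian_product)
  also have "\<dots> = (\<Sum>g\<in>H <#> K. card {p \<in> H \<times> K. ?f p = g})"
    unfolding img using sum.image_gen[of "H \<times> K" "\<lambda>_. 1::nat" ?f] fin by (simp only: card_eq_sum finite_cartesian_product)
  also have "\<dots> = (\<Sum>g\<in>H <#> K. card (H \<inter> K))" by (rule sum.cong[OF HOL.refl fib])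
  also have "\<dots> = card (H <#> K) * card (H \<inter> K)" by (simp only: sum_constant of_nat_id)
  finally show ?thesis by (rule dvdI)
qed

lemma card_cyclic: "x \<in> carrier G \<Longrightarrow> card {x [^] k | k::int. True} = ord x"
  and subgroup_cyclic: "x \<in> carrier G \<Longrightarrow> subgroup {x [^] k | k::int. True} G"
  using generate_pow[of x] generate_pow_card[of x] generate_is_subgroup[of "{x}"] by simp_all

lemma finite_cyclic:
  assumes "x \<in> carrier G" "x [^] n = \<one>" "n > (0::int)" shows "finite {x [^] k | k::int. True}"
proof (rule finite_subset)
  show "{x [^] k | k::int. True} \<subseteq> (\<lambda>k. x [^] k) ` {0..<n}"
  proof
    fix y assume "y \<in> {x [^] k | k::int. True}"
    then obtain k :: int where k: "y = x [^] k" by blast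
    have "x [^] k = x [^] (k mod n)" by (rule pow_eqI[OF assms(1,2)]) (simp add: dvd_minus_mod)
    then show "y \<in> (\<lambda>k. x [^] k) ` {0..<n}" using k assms(3) by auto
  qed
qed simp

end

lemma geo_add: "geo z (m + n) = geo z m + z ^ m * geo z n"
  by (induction n) (simp_all add: geo_def power_add algebra_simps)

text \<open>Doubling n multiplies both \<open>geo z n\<close> and z^n - 1 by the even number 1 +
  z^n.\<close>

lemma odd_power_cong:
  assumes "odd (z::int)" "2 ^ K dvd n"
  shows "2 ^ K dvd geo z n" "2 ^ K dvd z ^ n - 1"
proof -
  have base: "2 ^ K dvd geo z (2 ^ K) \<and> 2 ^ K dvd z ^ (2 ^ K) - 1"
  proof (induction K)
    case 0 then show ?case by simp
  next
    case (Suc K)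
    have "geo z (2 ^ Suc K) = geo z (2 ^ K) * (1 + z ^ (2 ^ K))"
      using geo_add[of z "2 ^ K" "2 ^ K"] by (simp add: mult_2 algebra_simps)
    moreover have "z ^ (2 ^ Suc K) - 1 = (z ^ (2 ^ K) - 1) * (1 + z ^ (2 ^ K))"
      by (simp add: mult_2 power_add algebra_simps)
    moreover have "even (1 + z ^ (2 ^ K))" using assms(1) by simp
    ultimately show ?case using Suc by (metis mult_dvd_mono power_Suc2)
  qed
  obtain t where t: "n = 2 ^ K * t" using assms(2) by blast
  have "2 ^ K dvd geo z (2 ^ K * t)"
    by (induction t) (use base in \<open>simp_all add: geo_add\<close>)
  then show "2 ^ K dvd geo z n" by (simp add: t)
  have "z ^ (2 ^ K) - 1 dvd (z ^ (2 ^ K)) ^ t - 1 ^ t" by (metis dvd_triv_left power_diff_sumr2)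
  then show "2 ^ K dvd z ^ n - 1" using base unfolding t power_mult by (metis dvd_trans power_one)
qed

section \<open>Finiteness and a normal subgroup of odd order\<close>

locale macd_fin = macd +
  fixes e :: int
  assumes e_pos: "e > 0" and a_e: "a [^] e = \<one>" and b_e: "b [^] e = \<one>" and c_e: "c [^] e = \<one>"
    and gen: "carrier G = generate G {a, b}"
begin

lemma swap_fin: "macd_fin G b a (inv c) \<beta> \<alpha> e"
proof -
  interpret s: macd G b a "inv c" \<beta> \<alpha> by (rule swap)
  have "inv c [^] e = \<one>" using int_pow_inv[OF c_in, of e] c_e by simp
  then show ?thesis using e_pos a_e b_e gen
    by unfold_locales (simp_all add: insert_commute)
qed

text \<open>For d = 1 this is the whole group; for d the 2-part of the group order it is the normal
  subgroup of odd order to be divided out.\<close>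

definition BCA :: "nat \<Rightarrow> 'a set" where
  "BCA d = {b [^] (int d * i) \<otimes> c [^] (int d * j) \<otimes> a [^] (int d * k) | i j k. True}"

text \<open>Collects what the commutation rules need so that reordering b, c, a keeps all exponents
  divisible by d.\<close>

definition good :: "nat \<Rightarrow> bool" where
  "good d \<longleftrightarrow> (\<forall>n. d dvd n \<longrightarrow> int d dvd geo \<alpha> n \<and> int d dvd geo \<beta> n \<and> int d dvd \<alpha> ^ n - 1 \<and> int d dvd \<beta> ^ n - 1)"

text \<open>The rules involving \<open>geo\<close> require natural exponents; reducing the cofactor
  modulo e preserves divisibility by d.\<close>

lemma nat_rep:
  assumes "x \<in> carrier G" "x [^] e = \<one>" "int d dvd i"
  obtains n where "d dvd n" "x [^] i = x [^] int n"
proof -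
  obtain k where k: "i = int d * k" using assms(3) by blast
  define n where "n = d * nat (k mod e)"
  have "i - int n = int d * (k - k mod e)" unfolding n_def k using e_pos by (simp add: algebra_simps)
  then have "e dvd i - int n" by (simp add: dvd_minus_mod)
  then have "x [^] i = x [^] int n" using assms pow_eqI by blast
  then show ?thesis using that[of n] by (simp add: n_def)
qed

lemma BCA_I:
  assumes "int d dvd i" "int d dvd j" "int d dvd k"
  shows "b [^] i \<otimes> c [^] j \<otimes> a [^] k \<in> BCA d"
  using assms unfolding BCA_def by (auto elim!: dvdE)

lemma BCA_carrier: "x \<in> BCA d \<Longrightarrow> x \<in> carrier G" unfolding BCA_def by auto

text \<open>The induction moves one b at a time, so r must be arbitrary; only the congruence of i
  with r modulo d is tracked.\<close>

lemma ab_pow: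
  assumes "good d" "d dvd n"
  shows "\<exists>i j k. int d dvd i - int r \<and> int d dvd j \<and> int d dvd k \<and>
      a [^] int n \<otimes> b [^] int r = b [^] i \<otimes> c [^] j \<otimes> a [^] k"
  using assms(2)
proof (induction r arbitrary: n)
  case 0
  have "a [^] int n \<otimes> b [^] int 0 = b [^] (0::int) \<otimes> c [^] (0::int) \<otimes> a [^] int n" by simp
  moreover have "int d dvd 0 - int 0" "int d dvd 0" "int d dvd int n" using 0 by simp_all
  ultimately show ?case by blast
next
  case (Suc r)
  have "int d dvd geo \<alpha> n" using assms(1) Suc.prems unfolding good_def by blast
  then obtain n' where n': "d dvd n'" "a [^] geo \<alpha> n = a [^] int n'" by (rule nat_rep[OF a_in a_e])
  obtain i j k where ijk: "int d dvd i - int r" "int d dvd j" "int d dvd k"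
      "a [^] int n' \<otimes> b [^] int r = b [^] i \<otimes> c [^] j \<otimes> a [^] k"
    using Suc.IH[OF n'(1)] by blast
  have bS: "b [^] int (Suc r) = b \<otimes> b [^] int r" using int_pow_mult[of b 1 "int r"] by simp
  have "a [^] int n \<otimes> b [^] int (Suc r) = (a [^] int n \<otimes> b) \<otimes> b [^] int r" unfolding bS by (simp add: m_assoc)
  also have "\<dots> = b \<otimes> (c [^] int n \<otimes> (a [^] int n' \<otimes> b [^] int r))"
    unfolding a_b n'(2) by (simp add: m_assoc)
  also have "\<dots> = b \<otimes> ((c [^] int n \<otimes> b [^] i) \<otimes> (c [^] j \<otimes> a [^] k))" unfolding ijk(4) by (simp add: m_assoc)
  also have "\<dots> = (b \<otimes> b [^] (i * \<beta> ^ n)) \<otimes> (c [^] int n \<otimes> c [^] j) \<otimes> a [^] k" unfolding c_b by (simp add: m_assoc)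
  also have "b \<otimes> b [^] (i * \<beta> ^ n) = b [^] (1 + i * \<beta> ^ n)" by (simp add: int_pow_mult)
  also have "c [^] int n \<otimes> c [^] j = c [^] (int n + j)" by (simp add: int_pow_mult)
  finally have eq: "a [^] int n \<otimes> b [^] int (Suc r) = b [^] (1 + i * \<beta> ^ n) \<otimes> c [^] (int n + j) \<otimes> a [^] k" .
  have "int d dvd \<beta> ^ n - 1" using assms(1) Suc.prems unfolding good_def by blast
  then have "int d dvd i * (\<beta> ^ n - 1) + (i - int r)" using ijk(1) by simp
  moreover have "i * (\<beta> ^ n - 1) + (i - int r) = 1 + i * \<beta> ^ n - int (Suc r)" by (simp add: algebra_simps)
  ultimately have "int d dvd 1 + i * \<beta> ^ n - int (Suc r)" by simp
  moreover have "int d dvd int n + j" using ijk(2) Suc.prems by simp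
  ultimately show ?case using eq ijk(3) by blast
qed

lemma BCA_mult:
  assumes "good d" "x \<in> BCA d" "y \<in> BCA d" shows "x \<otimes> y \<in> BCA d"
proof -
  have mult_b: "x \<otimes> b [^] i \<in> BCA d" if x: "x \<in> BCA d" and i: "int d dvd i" for x i
  proof -
    obtain i1 j1 k1 where x1: "x = b [^] (int d * i1) \<otimes> c [^] (int d * j1) \<otimes> a [^] (int d * k1)"
      using x unfolding BCA_def by blast
    obtain j2 where j2: "d dvd j2" "c [^] (int d * j1) = c [^] int j2" using nat_rep[OF c_in c_e, of d "int d * j1"] by auto
    obtain k2 where k2: "d dvd k2" "a [^] (int d * k1) = a [^] int k2" using nat_rep[OF a_in a_e, of d "int d * k1"] by auto
    obtain r where r: "d dvd r" "b [^] i = b [^] int r" using nat_rep[OF b_in b_e i] by auto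
    obtain i3 j3 k3 where ijk: "int d dvd i3 - int r" "int d dvd j3" "int d dvd k3"
      "a [^] int k2 \<otimes> b [^] int r = b [^] i3 \<otimes> c [^] j3 \<otimes> a [^] k3"
      using ab_pow[OF assms(1) k2(1)] by blast
    have i3: "int d dvd i3" 
      using dvd_add[OF ijk(1), of "int r"] r(1) by simp
    have "x \<otimes> b [^] i = b [^] (int d * i1) \<otimes> (c [^] int j2 \<otimes> (a [^] int k2 \<otimes> b [^] int r))"
      unfolding x1 j2 k2 r by (simp add: m_assoc)
    also have "\<dots> = b [^] (int d * i1) \<otimes> ((c [^] int j2 \<otimes> b [^] i3) \<otimes> (c [^] j3 \<otimes> a [^] k3))"
      unfolding ijk(4) by (simp add: m_assoc)
    also have "\<dots> = (b [^] (int d * i1) \<otimes> b [^] (i3 * \<beta> ^ j2)) \<otimes> (c [^] int j2 \<otimes> c [^] j3) \<otimes> a [^] k3"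
      unfolding c_b by (simp add: m_assoc)
    also have "\<dots> = b [^] (int d * i1 + i3 * \<beta> ^ j2) \<otimes> c [^] (int j2 + j3) \<otimes> a [^] k3"
      by (simp add: int_pow_mult)
    also have "\<dots> \<in> BCA d" by (rule BCA_I) (use i3 j2 ijk in auto)
    finally show ?thesis .
  qed
  have mult_c: "x \<otimes> c [^] i \<in> BCA d" if x: "x \<in> BCA d" and i: "int d dvd i" for x i
  proof -
    obtain i1 j1 k1 where x1: "x = b [^] (int d * i1) \<otimes> c [^] (int d * j1) \<otimes> a [^] (int d * k1)"
      using x unfolding BCA_def by blast
    obtain r where r: "d dvd r" "c [^] i = c [^] int r" using nat_rep[OF c_in c_e i] by auto
    have "x \<otimes> c [^] i = b [^] (int d * i1) \<otimes> (c [^] (int d * j1) \<otimes> (a [^] (int d * k1) \<otimes> c [^] int r))"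
      unfolding x1 r by (simp add: m_assoc)
    also have "\<dots> = b [^] (int d * i1) \<otimes> (c [^] (int d * j1) \<otimes> c [^] int r) \<otimes> a [^] (int d * k1 * \<alpha> ^ r)"
      unfolding a_c by (simp add: m_assoc)
    also have "\<dots> = b [^] (int d * i1) \<otimes> c [^] (int d * j1 + int r) \<otimes> a [^] (int d * k1 * \<alpha> ^ r)"
      by (simp add: int_pow_mult)
    also have "\<dots> \<in> BCA d" by (rule BCA_I) (use r in auto)
    finally show ?thesis .
  qed
  have mult_a: "x \<otimes> a [^] i \<in> BCA d" if x: "x \<in> BCA d" and i: "int d dvd i" for x i
  proof -
    obtain i1 j1 k1 where x1: "x = b [^] (int d * i1) \<otimes> c [^] (int d * j1) \<otimes> a [^] (int d * k1)"
      using x unfolding BCA_def by blast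
    have "x \<otimes> a [^] i = b [^] (int d * i1) \<otimes> c [^] (int d * j1) \<otimes> a [^] (int d * k1 + i)"
      unfolding x1 by (simp add: m_assoc int_pow_mult)
    also have "\<dots> \<in> BCA d" by (rule BCA_I) (use i in auto)
    finally show ?thesis .
  qed
  obtain i j k where y: "y = b [^] (int d * i) \<otimes> c [^] (int d * j) \<otimes> a [^] (int d * k)"
    using assms(3) unfolding BCA_def by blast
  have "x \<otimes> y = x \<otimes> b [^] (int d * i) \<otimes> c [^] (int d * j) \<otimes> a [^] (int d * k)"
    unfolding y using BCA_carrier[OF assms(2)] by (simp add: m_assoc)
  then show ?thesis using mult_a mult_b mult_c assms(2) by simp
qed

lemma BCA_gens: assumes "int d dvd i" shows "a [^] i \<in> BCA d" "b [^] i \<in> BCA d" "c [^] i \<in> BCA d"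
  using BCA_I[of d 0 0 i] BCA_I[of d i 0 0] BCA_I[of d 0 i 0] assms by simp_all

lemma BCA_inv: assumes "good d" "x \<in> BCA d" shows "inv x \<in> BCA d"
proof -
  obtain i j k where x: "x = b [^] (int d * i) \<otimes> c [^] (int d * j) \<otimes> a [^] (int d * k)"
    using assms(2) unfolding BCA_def by blast
  have "inv x = a [^] (int d * (- k)) \<otimes> (c [^] (int d * (- j)) \<otimes> b [^] (int d * (- i)))"
    unfolding x by (simp add: inv_mult_group int_pow_neg)
  then show ?thesis using BCA_mult[OF assms(1)] BCA_gens by (metis dvd_triv_left)
qed

lemma BCA_subgroup: "good d \<Longrightarrow> subgroup (BCA d) G"
  using BCA_gens(1)[of d 0] BCA_mult BCA_inv BCA_carrier by (intro subgroupI) auto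

lemma good_1: "good 1" by (simp add: good_def)

lemma carrier_eq: "carrier G = BCA 1"
proof
  have "{a, b} \<subseteq> BCA 1" using BCA_gens(1,2)[of 1 1] by simp
  then show "carrier G \<subseteq> BCA 1" unfolding gen by (rule generate_subgroup_incl[OF _ BCA_subgroup[OF good_1]])
qed (use BCA_carrier in blast)

lemma finite_BCA: "finite (BCA d)"
proof -
  have "BCA d \<subseteq> (\<lambda>(x, y, z). x \<otimes> y \<otimes> z) ` ({b [^] k | k::int. True} \<times> {c [^] k | k::int. True} \<times> {a [^] k | k::int. True})"
    unfolding BCA_def by (force simp: image_iff)
  then show ?thesis
    by (rule finite_subset) (intro finite_imageI finite_cartesian_product finite_cyclic[OF _ _ e_pos] a_e b_e c_e a_in b_in c_in)
qed

lemma finite_carrier: "finite (carrier G)" unfolding carrier_eq by (rule finite_BCA)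

lemma BCA_normal:
  assumes "good d" shows "BCA d \<lhd> G"
proof -
  define S where "S = {g \<in> carrier G. \<forall>y\<in>BCA d. cj g y \<in> BCA d}"
  have S_mult: "g \<otimes> h \<in> S" if "g \<in> S" "h \<in> S" for g h
    using that BCA_carrier unfolding S_def by (auto simp: cj_cj[symmetric])
  have S_pow: "g [^] n \<in> S" if "g \<in> S" for g and n :: nat
  proof (induction n)
    case 0 show ?case using BCA_carrier by (auto simp: S_def cj_def)
  next
    case (Suc n) then show ?case using S_mult that by simp
  qed
  have dd: "int d dvd int d * i" for i by simp
  have a: "inv a \<in> S"
  proof -
    have "cj (inv a) y \<in> BCA d" if yB: "y \<in> BCA d" for y
    proof -
      obtain i j k where y: "y = b [^] (int d * i) \<otimes> c [^] (int d * j) \<otimes> a [^] (int d * k)"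
        using yB unfolding BCA_def by blast
      obtain i2 where i2: "d dvd i2" "b [^] (int d * i) = b [^] int i2" by (rule nat_rep[OF b_in b_e dd])
      obtain j2 where j2: "d dvd j2" "c [^] (int d * j) = c [^] int j2" by (rule nat_rep[OF c_in c_e dd])
      have 1: "cj (inv a) (b [^] int i2) \<in> BCA d"
        unfolding cj_a_b_nat using assms i2 by (intro BCA_mult BCA_gens) (auto simp: good_def)
      have "cj (inv a) (c [^] int j2) = inv a \<otimes> c [^] int j2 \<otimes> a" by (simp add: cj_def)
      also have "inv a \<otimes> c [^] int j2 = c [^] int j2 \<otimes> a [^] (- (\<alpha> ^ j2))" using a_c[of "- 1" j2] by (simp add: int_pow_neg)
      also have "c [^] int j2 \<otimes> a [^] (- (\<alpha> ^ j2)) \<otimes> a = c [^] int j2 \<otimes> a [^] (1 - \<alpha> ^ j2)"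
        using int_pow_mult[of a "- (\<alpha> ^ j2)" 1] by (simp add: m_assoc)
      finally have "cj (inv a) (c [^] int j2) = c [^] int j2 \<otimes> a [^] (1 - \<alpha> ^ j2)" .
      moreover have "int d dvd 1 - \<alpha> ^ j2" using assms j2 unfolding good_def by (metis dvd_minus_iff minus_diff_eq)
      ultimately have 2: "cj (inv a) (c [^] int j2) \<in> BCA d"
        using assms j2 by (auto intro!: BCA_mult BCA_gens)
      have "cj (inv a) (a [^] (int d * k)) = a [^] (int d * k)"
        by (subst cj_inv_eq_iff) (use pow_comm[of a 1 "int d * k"] in auto)
      then have 3: "cj (inv a) (a [^] (int d * k)) \<in> BCA d" using BCA_gens by simp
      show ?thesis unfolding y i2(2) j2(2) using 1 2 3 BCA_mult[OF assms] by (simp add: cj_mult)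
    qed
    then show ?thesis by (simp add: S_def)
  qed
  have b: "inv b \<in> S"
  proof -
    have "cj (inv b) y \<in> BCA d" if yB: "y \<in> BCA d" for y
    proof -
      obtain i j k where y: "y = b [^] (int d * i) \<otimes> c [^] (int d * j) \<otimes> a [^] (int d * k)"
        using yB unfolding BCA_def by blast
      obtain k2 where k2: "d dvd k2" "a [^] (int d * k) = a [^] int k2" by (rule nat_rep[OF a_in a_e dd])
      obtain j2 where j2: "d dvd j2" "c [^] (int d * j) = c [^] int j2" by (rule nat_rep[OF c_in c_e dd])
      have 1: "cj (inv b) (a [^] int k2) \<in> BCA d"
        unfolding cj_b_a_nat using assms k2 by (intro BCA_mult BCA_gens) (auto simp: good_def)
      have "cj (inv b) (c [^] int j2) = inv b \<otimes> (c [^] int j2 \<otimes> b [^] (1::int))" by (simp add: cj_def m_assoc)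
      also have "\<dots> = b [^] (- 1 + \<beta> ^ j2) \<otimes> c [^] int j2"
        unfolding c_b int_pow_mult[OF b_in] by (simp add: m_assoc int_pow_neg)
      finally have "cj (inv b) (c [^] int j2) = b [^] (\<beta> ^ j2 - 1) \<otimes> c [^] int j2" by simp
      then have 2: "cj (inv b) (c [^] int j2) \<in> BCA d"
        using assms j2 by (auto intro!: BCA_mult BCA_gens simp: good_def)
      have "cj (inv b) (b [^] (int d * i)) = b [^] (int d * i)"
        by (subst cj_inv_eq_iff) (use pow_comm[of b 1 "int d * i"] in auto)
      then have 3: "cj (inv b) (b [^] (int d * i)) \<in> BCA d" using BCA_gens by simp
      show ?thesis unfolding y k2(2) j2(2) using 1 2 3 BCA_mult[OF assms] by (simp add: cj_mult)
    qed
    then show ?thesis by (simp add: S_def)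
  qed
  \<comment> \<open>In a finite group inverses are nonnegative powers, so closure under products
    suffices. Hence only the inverses of the generators had to be treated, for which the conjugation
    formulas are available.\<close>
  have inv_S: "inv g \<in> S" if "g \<in> S" for g
  proof -
    have g: "g \<in> carrier G" using that by (simp add: S_def)
    have o: "ord g > 0" using finite_carrier g ord_ge_1 by (metis less_le_trans zero_less_one)
    then have "inv g = g [^] (ord g - 1)"
      using g by (metis Suc_diff_1 inv_equality nat_pow_Suc nat_pow_closed pow_ord_eq_1)
    then show ?thesis using S_pow[OF that] by simp
  qed
  have "subgroup S G"
  proof (rule subgroupI)
    show "S \<subseteq> carrier G" by (auto simp: S_def)
    show "S \<noteq> {}" using a by blast
  qed (fact inv_S S_mult)+
  moreover have "{a, b} \<subseteq> S" using inv_S[OF a] inv_S[OF b] by simp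
  ultimately have "carrier G \<subseteq> S" unfolding gen by (intro generate_subgroup_incl)
  then show ?thesis
    unfolding normal_inv_iff using BCA_subgroup[OF assms] by (auto simp: S_def cj_def)
qed

text \<open>The powers of c normalise the cyclic group of b^d, so the b and c parts form a subgroup;
  the product with the a part need not be one.\<close>

lemma card_BCA_dvd:
  assumes "good d"
  shows "card (BCA d) dvd ord (b [^] int d) * ord (c [^] int d) * ord (a [^] int d)"
proof -
  let ?B = "{(b [^] int d) [^] k | k::int. True}"
  let ?C = "{(c [^] int d) [^] k | k::int. True}"
  let ?A = "{(a [^] int d) [^] k | k::int. True}"
  have fin: "finite ?A" "finite ?B" "finite ?C"
  proof -
    have "finite {(x [^] int d) [^] k | k::int. True}" if x: "x \<in> carrier G" "x [^] e = \<one>" for x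
    proof (rule finite_cyclic[OF _ _ e_pos])
      have "(x [^] int d) [^] e = (x [^] e) [^] int d" using x(1) by (simp add: int_pow_pow mult.commute)
      then show "(x [^] int d) [^] e = \<one>" using x by simp
    qed (use x in simp)
    then show "finite ?A" "finite ?B" "finite ?C" using a_e b_e c_e by simp_all
  qed
  have BC: "?B <#> ?C = {b [^] (int d * i) \<otimes> c [^] (int d * j) | i j. True}"
    unfolding set_mult_def by (auto simp: int_pow_pow)
  have BC_sub: "subgroup (?B <#> ?C) G"
  proof (rule subgroupI)
    have swap: "\<exists>i'. c [^] (int d * j) \<otimes> b [^] (int d * i) = b [^] (int d * i') \<otimes> c [^] (int d * j)" for i j
    proof -
      obtain j2 where j2: "d dvd j2" "c [^] (int d * j) = c [^] int j2"
        using nat_rep[OF c_in c_e, of d "int d * j"] by auto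
      show ?thesis unfolding j2 c_b by (intro exI[of _ "i * \<beta> ^ j2"]) (simp add: mult.assoc)
    qed
    show "?B <#> ?C \<subseteq> carrier G" "?B <#> ?C \<noteq> {}" unfolding BC by auto
    fix x assume "x \<in> ?B <#> ?C"
    then obtain i j where x: "x = b [^] (int d * i) \<otimes> c [^] (int d * j)" unfolding BC by blast
    have "inv x = c [^] (int d * (- j)) \<otimes> b [^] (int d * (- i))" unfolding x by (simp add: inv_mult_group int_pow_neg)
    then show "inv x \<in> ?B <#> ?C" unfolding BC using swap[of "- j" "- i"] by (metis (mono_tags, lifting) mem_Collect_eq)
    fix y assume "y \<in> ?B <#> ?C"
    then obtain i2 j2 where y: "y = b [^] (int d * i2) \<otimes> c [^] (int d * j2)" unfolding BC by blast
    obtain i3 where i3: "c [^] (int d * j) \<otimes> b [^] (int d * i2) = b [^] (int d * i3) \<otimes> c [^] (int d * j)"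
      using swap by blast
    have "x \<otimes> y = b [^] (int d * i) \<otimes> (c [^] (int d * j) \<otimes> b [^] (int d * i2)) \<otimes> c [^] (int d * j2)"
      unfolding x y by (simp add: m_assoc)
    also have "\<dots> = b [^] (int d * (i + i3)) \<otimes> c [^] (int d * (j + j2))"
      unfolding i3 by (simp add: m_assoc int_pow_mult distrib_left)
    finally show "x \<otimes> y \<in> ?B <#> ?C" unfolding BC by blast
  qed
  have BC_fin: "finite (?B <#> ?C)"
    unfolding set_mult_def using fin by auto
  have A_sub: "subgroup ?A G" and B_sub: "subgroup ?B G" and C_sub: "subgroup ?C G"
    by (intro subgroup_cyclic int_pow_closed a_in b_in c_in)+
  have eq: "BCA d = (?B <#> ?C) <#> ?A"
    unfolding BC unfolding BCA_def set_mult_def by (auto simp: int_pow_pow)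
  have "card (BCA d) dvd card (?B <#> ?C) * card ?A"
    unfolding eq by (rule card_set_mult_dvd[OF BC_sub A_sub BC_fin fin(1)])
  also have "\<dots> dvd card ?B * card ?C * card ?A"
    by (rule mult_dvd_mono[OF card_set_mult_dvd[OF B_sub C_sub fin(2,3)] dvd_refl])
  finally show ?thesis by (simp only: card_cyclic int_pow_closed a_in b_in c_in)
qed

lemma good_power2: "odd \<alpha> \<Longrightarrow> odd \<beta> \<Longrightarrow> good (2 ^ K)"
  unfolding good_def using odd_power_cong by (metis of_nat_numeral of_nat_power)

end

section \<open>Second-order expansions of powers and geometric sums\<close>

lemma power_expand: "(z - 1) ^ 3 dvd z ^ n - (1 + int n * (z - 1) + tri (int n - 1) * (z - 1) ^ 2)"
proof (induction n)
  case 0 then show ?case by (simp add: tri_def)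
next
  case (Suc n)
  obtain q where q: "z ^ n - (1 + int n * (z - 1) + tri (int n - 1) * (z - 1) ^ 2) = (z - 1) ^ 3 * q"
    using Suc by blast
  then have zn: "z ^ n = 1 + int n * (z - 1) + tri (int n - 1) * (z - 1) ^ 2 + (z - 1) ^ 3 * q" by simp
  have "tri (int n) = tri (int n - 1) + int n"
    using tri_add[of "int n - 1" 1] by (simp add: tri_def)
  then have "z ^ Suc n - (1 + int (Suc n) * (z - 1) + tri (int (Suc n) - 1) * (z - 1) ^ 2)
      = z * z ^ n - (1 + (int n + 1) * (z - 1) + (tri (int n - 1) + int n) * (z - 1) ^ 2)" by simp
  also have "\<dots> = (z - 1) ^ 3 * (z * q + tri (int n - 1))" unfolding zn by Groebner_Basis.algebra
  finally show ?case by simp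
qed

lemma geo_expand: "(z - 1) ^ 3 dvd geo z n - (int n + (z - 1) * tri (int n) + (z - 1) ^ 2 * tet (int n))"
proof (induction n)
  case 0 then show ?case by (simp add: tri_def tet_def)
next
  case (Suc n)
  obtain q where q: "geo z n - (int n + (z - 1) * tri (int n) + (z - 1) ^ 2 * tet (int n)) = (z - 1) ^ 3 * q"
    using Suc by blast
  then have g: "geo z n = int n + (z - 1) * tri (int n) + (z - 1) ^ 2 * tet (int n) + (z - 1) ^ 3 * q" by simp
  have t: "tri (int (Suc n)) = tri (int n) + int n + 1" "tet (int (Suc n)) = tet (int n) + tri (int n)"
    using tri_add[of "int n" 1] tet_Suc[of "int n"] by (simp_all add: tri_def[of 1] add.commute)
  have "geo z (Suc n) - (int (Suc n) + (z - 1) * tri (int (Suc n)) + (z - 1) ^ 2 * tet (int (Suc n)))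
     = (z - 1) ^ 3 * (z * q + tet (int n))"
    unfolding geo_Suc g t unfolding of_nat_Suc by Groebner_Basis.algebra
  then show ?case by simp
qed

lemma three_cancel_R: "2 ^ i * (2 ^ r) ^ j dvd (3::int) * z \<Longrightarrow> 2 ^ i * (2 ^ r) ^ j dvd z"
  using three_cancel[of "i + r * j" z] by (simp add: power_add power_mult)

lemma half_eq: "2 * (x::int) = 2 * y \<Longrightarrow> x = y" by simp

text \<open>This is the exponent of b in \<open>pow_bc_pos\<close>. With Y = z - 1 the terms of
  order below 2 cancel and the leading term is Y^2/2 = 2R^4v^2.\<close>

lemma hval:
  fixes R v z :: int
  assumes R: "R = 2 ^ r" and z: "z = 1 + 2 * R ^ 2 * v" and n: "int n = z"
  shows "8 * R ^ 6 dvd z * z ^ n - geo z n - 2 * R ^ 4 * v ^ 2"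
proof -
  define Y where "Y = 2 * R ^ 2 * v"
  have zY: "z = 1 + Y" "z - 1 = Y" unfolding z Y_def by simp_all
  obtain p where p: "z ^ n - (1 + z * Y + tri Y * Y ^ 2) = Y ^ 3 * p"
    using power_expand[of z n] unfolding n zY(2) by (rule dvdE)
  obtain q where q: "geo z n - (z + Y * tri z + Y ^ 2 * tet z) = Y ^ 3 * q"
    using geo_expand[of z n] unfolding n zY(2) by (rule dvdE)
  have p': "z ^ n = 1 + z * Y + tri Y * Y ^ 2 + Y ^ 3 * p" using p by simp
  have q': "geo z n = z + Y * tri z + Y ^ 2 * tet z + Y ^ 3 * q" using q by simp
  have t: "2 * tri Y = Y * (Y + 1)" "2 * tri z = (Y + 1) * (Y + 2)" "6 * tet z = Y * (Y + 1) * (Y + 2)"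
    unfolding two_tri six_tet zY(1) by (simp_all add: algebra_simps)
  define H where "H = z * z ^ n - geo z n - 2 * R ^ 4 * v ^ 2"
  have "2 * (3 * H) =
     6 * z * (1 + z * Y) + 3 * z * Y ^ 2 * (2 * tri Y) + 6 * z * Y ^ 3 * p - 6 * z - 3 * Y * (2 * tri z) - Y ^ 2 * (6 * tet z)
     - 6 * Y ^ 3 * q - 12 * R ^ 4 * v ^ 2"
    unfolding H_def p' q' by Groebner_Basis.algebra
  also have "\<dots> = 2 * (8 * R ^ 6 * (v ^ 3 * (2 + 3 * R ^ 2 * v + 4 * R ^ 4 * v ^ 2 + 3 * z * p - 3 * q) ))"
    unfolding t unfolding zY(1) Y_def by Groebner_Basis.algebra
  finally have "3 * H = 8 * R ^ 6 * (v ^ 3 * (2 + 3 * R ^ 2 * v + 4 * R ^ 4 * v ^ 2 + 3 * z * p - 3 * q))"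
    by (rule half_eq)
  then have "8 * R ^ 6 dvd 3 * H" by (rule dvdI)
  then have "8 * R ^ 6 dvd H" using three_cancel_R[of 3 r 6 H] unfolding R by simp
  then show ?thesis unfolding H_def .
qed

lemma odd_power_expand:
  fixes R v z :: int
  assumes z: "z = 1 + 2 * R ^ 2 * v"
  shows "8 * R ^ 6 dvd z ^ n - (1 + int n * (2 * R ^ 2 * v) + tri (int n - 1) * (4 * R ^ 4 * v ^ 2))"
    "8 * R ^ 6 dvd geo z n - (int n + (2 * R ^ 2 * v) * tri (int n) + (4 * R ^ 4 * v ^ 2) * tet (int n))"
proof -
  have "8 * R ^ 6 dvd (z - 1) ^ 3" by (rule dvdI[of _ _ "v ^ 3"]) (simp only: z, Groebner_Basis.algebra)
  moreover have "z - 1 = 2 * R ^ 2 * v" "(z - 1) ^ 2 = 4 * R ^ 4 * v ^ 2" unfolding z by (simp, Groebner_Basis.algebra)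
  ultimately show "8 * R ^ 6 dvd z ^ n - (1 + int n * (2 * R ^ 2 * v) + tri (int n - 1) * (4 * R ^ 4 * v ^ 2))"
    "8 * R ^ 6 dvd geo z n - (int n + (2 * R ^ 2 * v) * tri (int n) + (4 * R ^ 4 * v ^ 2) * tet (int n))"
    using power_expand[of z n] geo_expand[of z n] by (metis dvd_trans)+
qed

lemma (in group) odd_root:
  assumes g: "g \<in> carrier G" "g [^] ((2::int) ^ K) = \<one>" and t: "odd (t::int)"
  obtains t' where "\<And>i. g [^] (i * t * t') = g [^] (i::int)"
proof -
  have "coprime t (2 ^ K)" using t by simp
  then obtain t' q where "t * t' + 2 ^ K * q = 1" using bezout_int[of t "2 ^ K"] by (metis coprime_iff_gcd_eq_1 mult.commute)
  then have tt: "t * t' = 1 - 2 ^ K * q" by simp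
  have "g [^] (i * t * t') = g [^] i" for i
  proof (rule pow_eqI[OF g])
    have "i * t * t' - i = i * (t * t') - i" by (simp only: mult.assoc)
    also have "\<dots> = 2 ^ K * (- q * i)" unfolding tt by Groebner_Basis.algebra
    finally show "2 ^ K dvd i * t * t' - i" by simp
  qed
  then show ?thesis using that by blast
qed

lemma (in group) odd_cancel:
  assumes "g \<in> carrier G" "g [^] ((2::int) ^ K) = \<one>" "odd (t::int)" "g [^] (i * t) = \<one>"
  shows "g [^] (i::int) = \<one>"
proof -
  obtain t' where t': "\<And>i::int. g [^] (i * t * t') = g [^] i" using odd_root[OF assms(1-3)] by blast
  have "g [^] i = (g [^] (i * t)) [^] t'" unfolding t'[symmetric, of i] using assms(1) by (simp add: int_pow_pow)
  then show ?thesis using assms by simp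
qed

section \<open>The quotient of two-power exponent\<close>

text \<open>Positivity lets \<open>\<alpha>\<close> and \<open>\<beta>\<close> serve as the natural
  exponents in \<open>pow_ca\<close> and \<open>pow_bc_pos\<close>. The bound on L makes 2^L a
  multiple of 8R^6, so exponents may be replaced by natural representatives without disturbing the
  expansions.\<close>

locale two_mac = macd_fin G a b c \<alpha> \<beta> "2 ^ L" for G (structure) and a b c \<alpha> \<beta> and L :: nat +
  fixes r :: nat and R u u' k :: int
  assumes r: "r \<ge> 2" and odd_u: "odd u" and odd_k: "odd k" and R_def: "R = 2 ^ r" and u'_def: "u' = u - R * k"
    and \<alpha>_def: "\<alpha> = 1 + 2 * R ^ 2 * u" and \<beta>_def: "\<beta> = 1 + 2 * R ^ 2 * u'"
    and \<alpha>_pos: "\<alpha> > 0" and \<beta>_pos: "\<beta> > 0" and L: "L \<ge> 8 * r + 8"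
begin

lemma R4: "4 dvd R" and R_even: "even R" and R_pos: "R > 0"
proof -
  have "(2::int) ^ 2 dvd 2 ^ r" using r le_imp_power_dvd by blast
  then show "4 dvd R" by (simp add: R_def)
  then show "even R" by presburger
  show "R > 0" by (simp add: R_def)
qed

lemma odd_u': "odd u'" using odd_u R_even by (simp add: u'_def)

text \<open>From u = u' - R(-k): exchanging the generators changes the sign of k.\<close>

lemma swap_two: "two_mac G b a (inv c) \<beta> \<alpha> L r R u' u (- k)"
proof -
  interpret s: macd_fin G b a "inv c" \<beta> \<alpha> "2 ^ L" by (rule swap_fin)
  show ?thesis
    using r odd_u' odd_k R_def u'_def \<alpha>_def \<beta>_def \<alpha>_pos \<beta>_pos L by unfold_locales simp_all
qed

lemma pow2_dvd: assumes "i + r * j \<le> L" shows "2 ^ i * R ^ j dvd 2 ^ L"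
  unfolding R_def power_mult[symmetric] power_add[symmetric] using assms by (rule le_imp_power_dvd)

lemma R6_dvd_L: "8 * R ^ 6 dvd 2 ^ L"
  using pow2_dvd[of 3 6] L by simp

lemma unit_solve:
  fixes t p :: int assumes "odd t" obtains w where "2 ^ L dvd w * t + p"
proof -
  have "coprime t (2 ^ L)" using assms by simp
  then obtain t' q where "t * t' + 2 ^ L * q = 1" using bezout_int[of t "2 ^ L"] by (metis coprime_iff_gcd_eq_1 mult.commute)
  then have tt: "t' * t = 1 - 2 ^ L * q" by (simp add: mult.commute)
  have "(- p * t') * t + p = - p * (t' * t) + p" by (simp only: mult.assoc)
  also have "\<dots> = 2 ^ L * (p * q)" unfolding tt by Groebner_Basis.algebra
  finally show ?thesis using that[of "- p * t'"] by simp
qed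

text \<open>This is \<open>base_relation\<close> with its exponents evaluated to leading order; c
  gets the exponent \<open>\<beta>\<close> - \<open>\<alpha>\<close> = -2R^3k.\<close>

lemma relation1:
  "\<exists>w1 h1. a [^] (- 2 * R ^ 4 * u ^ 2 + 8 * R ^ 6 * w1) = b [^] (2 * R ^ 4 * u' ^ 2 + 8 * R ^ 6 * h1) \<otimes> c [^] (- 2 * R ^ 3 * k)"
proof -
  define n where "n = nat \<alpha>"
  define n' where "n' = nat \<beta>"
  have n: "int n = \<alpha>" "int n' = \<beta>" using \<alpha>_pos \<beta>_pos by (simp_all add: n_def n'_def)
  define t where "t = (\<Sum>i<n. \<alpha> ^ i)"
  have geo: "geo \<alpha> n = t * \<alpha> ^ 1" unfolding t_def by (rule geo_factor)
  have odd\<alpha>: "odd \<alpha>" by (simp add: \<alpha>_def)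
  \<comment> \<open>Chosen so that c^\<open>\<alpha>\<close> a^(t - \<open>\<alpha>\<close>^n) = a^w
    c^\<open>\<alpha>\<close>; then c^\<open>\<alpha>\<close> can be cancelled on the right.\<close>
  obtain w where w: "2 ^ L dvd w * \<alpha> ^ n + (\<alpha> ^ n - t)" using unit_solve odd\<alpha> by (metis even_power)
  define h where "h = \<beta> * \<beta> ^ n' - geo \<beta> n'"
  have "c [^] \<alpha> \<otimes> a [^] t = a \<otimes> (b [^] h \<otimes> c [^] \<beta>)"
    using base_relation unfolding pow_bc_pos[OF n(2)] h_def using pow_ca[OF geo] by (simp add: n)
  then have "b [^] h \<otimes> c [^] \<beta> = inv a \<otimes> (c [^] \<alpha> \<otimes> a [^] t)" by (simp add: cancel_inv)
  also have "\<dots> = (a [^] (- 1 :: int) \<otimes> c [^] int n) \<otimes> a [^] t" by (simp add: int_pow_neg m_assoc n)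
  also have "\<dots> = c [^] \<alpha> \<otimes> (a [^] (- (\<alpha> ^ n)) \<otimes> a [^] t)" unfolding a_c by (simp add: m_assoc n)
  also have "a [^] (- (\<alpha> ^ n)) \<otimes> a [^] t = a [^] (- (\<alpha> ^ n) + t)" by (simp only: int_pow_mult a_in)
  also have "\<dots> = a [^] (w * \<alpha> ^ n)"
  proof (rule pow_eqI[OF a_in a_e])
    have "- (\<alpha> ^ n) + t - w * \<alpha> ^ n = - (w * \<alpha> ^ n + (\<alpha> ^ n - t))" by simp
    then show "2 ^ L dvd - (\<alpha> ^ n) + t - w * \<alpha> ^ n" using w by (simp only: dvd_minus_iff)
  qed
  also have "c [^] \<alpha> \<otimes> a [^] (w * \<alpha> ^ n) = a [^] w \<otimes> c [^] \<alpha>" using a_c[of w n] by (simp add: n)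
  finally have eq0: "b [^] h \<otimes> c [^] \<beta> \<otimes> inv (c [^] \<alpha>) = a [^] w \<otimes> c [^] \<alpha> \<otimes> inv (c [^] \<alpha>)" by simp
  have "\<beta> - \<alpha> = - 2 * R ^ 3 * k" unfolding \<alpha>_def \<beta>_def u'_def by Groebner_Basis.algebra
  then have eq: "a [^] w = b [^] h \<otimes> c [^] (- 2 * R ^ 3 * k)"
    using eq0 by (simp add: m_assoc int_pow_diff[symmetric])
  obtain h1 where "h - 2 * R ^ 4 * u' ^ 2 = 8 * R ^ 6 * h1"
    using hval[OF R_def \<beta>_def n(2)] unfolding h_def by blast
  then have h: "h = 2 * R ^ 4 * u' ^ 2 + 8 * R ^ 6 * h1" by simp
  obtain h2 where "\<alpha> * \<alpha> ^ n - geo \<alpha> n - 2 * R ^ 4 * u ^ 2 = 8 * R ^ 6 * h2"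
    using hval[OF R_def \<alpha>_def n(1)] by blast
  then have h2: "\<alpha> * (\<alpha> ^ n - t) = 2 * R ^ 4 * u ^ 2 + 8 * R ^ 6 * h2" unfolding geo by (simp add: algebra_simps)
  obtain q where q: "w * \<alpha> ^ n + (\<alpha> ^ n - t) = 2 ^ L * q" using w by blast
  obtain l8 where l8: "2 ^ L = 8 * R ^ 6 * l8" using R6_dvd_L by blast
  have "\<alpha> * (w * \<alpha> ^ n + (\<alpha> ^ n - t)) = w * (\<alpha> * \<alpha> ^ n) + \<alpha> * (\<alpha> ^ n - t)" by Groebner_Basis.algebra
  then have "w * (\<alpha> * \<alpha> ^ n) = 8 * R ^ 6 * (l8 * q * \<alpha> - h2) - 2 * R ^ 4 * u ^ 2"
    unfolding q h2 l8 by (simp add: algebra_simps)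
  then have wa: "w * \<alpha> ^ Suc n = 8 * R ^ 6 * (l8 * q * \<alpha> - h2) - 2 * R ^ 4 * u ^ 2" by simp
  \<comment> \<open>As n + 1 is even, \<open>\<alpha>\<close>^(n+1) is 1 modulo 4R^2 and not merely
    2R^2. With 2R^4 dividing w, removing this factor costs a multiple of 8R^6.\<close>
  have "odd n" using odd\<alpha> n by (metis even_of_nat)
  then obtain j where j: "Suc n = 2 * j" by (metis dvdE even_Suc)
  have "\<alpha> ^ 2 - 1 dvd (\<alpha> ^ 2) ^ j - 1 ^ j" by (metis dvd_triv_left power_diff_sumr2)
  then have "\<alpha> ^ 2 - 1 dvd \<alpha> ^ Suc n - 1" unfolding j power_mult by simp
  moreover have "4 * R ^ 2 dvd \<alpha> ^ 2 - 1"
    by (rule dvdI[of _ _ "u * (1 + R ^ 2 * u)"]) (simp only: \<alpha>_def, Groebner_Basis.algebra)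
  ultimately obtain v where "\<alpha> ^ Suc n - 1 = 4 * R ^ 2 * v" by (metis dvdE dvd_trans)
  then have v: "\<alpha> ^ Suc n = 1 + 4 * R ^ 2 * v" by simp
  have "2 * R ^ 4 dvd w * \<alpha> ^ Suc n"
    unfolding wa by (rule dvdI[of _ _ "4 * R ^ 2 * (l8 * q * \<alpha> - h2) - u ^ 2"]) Groebner_Basis.algebra
  moreover have "coprime (2 * R ^ 4) (\<alpha> ^ Suc n)" unfolding R_def using odd\<alpha> by simp
  ultimately have "2 * R ^ 4 dvd w" using coprime_dvd_mult_left_iff by blast
  then obtain w' where w': "w = 2 * R ^ 4 * w'" by blast
  have "w = w * \<alpha> ^ Suc n - w * (4 * R ^ 2 * v)" unfolding v by Groebner_Basis.algebra
  also have "\<dots> = - 2 * R ^ 4 * u ^ 2 + 8 * R ^ 6 * (l8 * q * \<alpha> - h2 - w' * v)"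
    unfolding wa unfolding w' by Groebner_Basis.algebra
  finally show ?thesis using eq h by metis
qed

lemma nat_rep_L: obtains n where "2 ^ L dvd int n - i"
proof -
  have "int (nat (i mod 2 ^ L)) = i mod 2 ^ L" by simp
  then have "2 ^ L dvd int (nat (i mod 2 ^ L)) - i" by (metis dvd_minus_mod dvd_minus_iff minus_diff_eq)
  then show ?thesis using that by blast
qed

lemma a_eq: "2 ^ L dvd i - j \<Longrightarrow> a [^] i = a [^] (j::int)" by (rule pow_eqI[OF a_in a_e])
lemma c_eq_L: "2 ^ L dvd i - j \<Longrightarrow> c [^] i = c [^] (j::int)" by (rule pow_eqI[OF c_in c_e])

text \<open>Conjugating \<open>relation1\<close> by c leaves the power of c fixed, which makes
  b^(h(\<open>\<beta>\<close> - 1)) a power of a and hence central. Commuting with c kills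
  b^(h(\<open>\<beta>\<close> - 1)^2), whose exponent is 8R^8 times an odd number.\<close>

lemma b_R8: "b [^] (8 * R ^ 8) = \<one>"
proof -
  obtain w1 h1 where rel: "a [^] (- 2 * R ^ 4 * u ^ 2 + 8 * R ^ 6 * w1)
      = b [^] (2 * R ^ 4 * u' ^ 2 + 8 * R ^ 6 * h1) \<otimes> c [^] (- 2 * R ^ 3 * k)" using relation1 by blast
  define w where "w = - 2 * R ^ 4 * u ^ 2 + 8 * R ^ 6 * w1"
  define h where "h = 2 * R ^ 4 * u' ^ 2 + 8 * R ^ 6 * h1"
  define d where "d = - 2 * R ^ 3 * k"
  have rel: "a [^] w = b [^] h \<otimes> c [^] d" using rel unfolding w_def h_def d_def .
  have "odd \<alpha>" by (simp add: \<alpha>_def)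
  then obtain v where v: "2 ^ L dvd v * \<alpha> + - w" using unit_solve by blast
  have av: "a [^] w = a [^] (v * \<alpha> ^ 1)" by (rule a_eq[symmetric]) (use v in simp)
  have "a [^] v = cj c (a [^] w)" unfolding av using cj_c_a_root[of 1 v] by simp
  also have "\<dots> = cj c (b [^] h) \<otimes> cj c (c [^] d)" unfolding rel by (simp add: cj_mult)
  also have "cj c (c [^] d) = c [^] d" by (simp add: cj_pow) (simp add: cj_def m_assoc)
  also have "cj c (b [^] h) = b [^] (h * (\<beta> - 1) + h)" using cj_c_b[of 1 h] by (simp add: algebra_simps)
  also have "\<dots> = b [^] (h * (\<beta> - 1)) \<otimes> b [^] h" by (simp only: int_pow_mult b_in)
  finally have "a [^] v = b [^] (h * (\<beta> - 1)) \<otimes> a [^] w" unfolding rel by (simp add: m_assoc)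
  then have "a [^] v \<otimes> inv (a [^] w) = b [^] (h * (\<beta> - 1))" by (simp add: m_assoc)
  then have z: "b [^] (h * (\<beta> - 1)) = a [^] (v - w)" by (simp add: int_pow_diff)
  let ?z = "b [^] (h * (\<beta> - 1))"
  have "?z \<otimes> a = a \<otimes> ?z" unfolding z using pow_comm[of a "v - w" 1] by simp
  moreover have "?z \<otimes> b = b \<otimes> ?z" using pow_comm[of b "h * (\<beta> - 1)" 1] by simp
  ultimately have "?z \<otimes> c = c \<otimes> ?z" by (intro commute_c) simp_all
  then have "cj c ?z = ?z" by (simp add: cj_eq_iff)
  then have "b [^] (h * (\<beta> - 1) * \<beta>) = ?z" using cj_c_b[of 1 "h * (\<beta> - 1)"] by simp
  then have "b [^] (h * (\<beta> - 1) * \<beta> - h * (\<beta> - 1)) = \<one>" by (simp add: int_pow_diff)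
  also have "h * (\<beta> - 1) * \<beta> - h * (\<beta> - 1) = 8 * R ^ 8 * ((u' ^ 2 + 4 * R ^ 2 * h1) * u' ^ 2)"
    unfolding h_def \<beta>_def by Groebner_Basis.algebra
  finally show ?thesis
    by (rule odd_cancel[OF b_in b_e, rotated]) (simp add: odd_u')
qed

lemma a_R8: "a [^] (8 * R ^ 8) = \<one>"
proof -
  interpret s: two_mac G b a "inv c" \<beta> \<alpha> L r R u' u "- k" by (rule swap_two)
  show ?thesis by (rule s.b_R8)
qed

text \<open>The given relation is conjugated by b: b^h is fixed, while a^W and c^D become explicit
  products.\<close>

lemma relation3:
  assumes W: "2 ^ L dvd int W - w" and D: "2 ^ L dvd int D - d"
    and rel: "a [^] w = b [^] (h::int) \<otimes> c [^] d"
  shows "c [^] int W \<otimes> a [^] (geo \<alpha> W - int W) = b [^] (\<beta> ^ D - 1)"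
proof -
  have aW: "a [^] int W = b [^] h \<otimes> c [^] int D"
    using rel a_eq[OF W] c_eq_L[OF D] by simp
  have bh: "cj (inv b) (b [^] h) = b [^] h"
    by (subst cj_inv_eq_iff) (use pow_comm[of b h 1] in simp_all)
  have "cj (inv b) (c [^] int D) = inv b \<otimes> (c [^] int D \<otimes> b [^] (1::int))" by (simp add: cj_def m_assoc)
  also have "\<dots> = b [^] (- 1 + \<beta> ^ D) \<otimes> c [^] int D"
    unfolding c_b int_pow_mult[OF b_in] by (simp add: m_assoc int_pow_neg)
  finally have cD: "cj (inv b) (c [^] int D) = b [^] (\<beta> ^ D - 1) \<otimes> c [^] int D" by simp
  have "c [^] int W \<otimes> a [^] geo \<alpha> W = cj (inv b) (b [^] h \<otimes> c [^] int D)"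
    using cj_b_a_nat[of W] unfolding aW by simp
  also have "\<dots> = (b [^] h \<otimes> b [^] (\<beta> ^ D - 1)) \<otimes> c [^] int D"
    by (simp only: cj_mult bh cD inv_closed b_in c_in int_pow_closed m_assoc m_closed)
  also have "\<dots> = b [^] (\<beta> ^ D - 1) \<otimes> a [^] int W"
    unfolding pow_comm[OF b_in, of h] aW by (simp add: m_assoc)
  finally have "c [^] int W \<otimes> a [^] geo \<alpha> W \<otimes> inv (a [^] int W) = b [^] (\<beta> ^ D - 1) \<otimes> a [^] int W \<otimes> inv (a [^] int W)" by simp
  then show ?thesis by (simp add: m_assoc int_pow_diff)
qed

text \<open>The first two equations are \<open>relation1\<close> and its conjugate by b. The third
  comes from the k-th power of the second, with c eliminated by the power -R w' of the first.
  Splitting these powers needs commuting factors, which \<open>a_R8\<close> and \<open>b_R8\<close>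
  provide.\<close>

lemma relations:
  obtains w' h' B \<epsilon> where
    "2 * R ^ 2 dvd w' + u ^ 2" "4 * R ^ 2 dvd h' - u' ^ 2" "4 * R ^ 6 dvd B + 4 * R ^ 5 * k * u'" "4 * R ^ 6 dvd \<epsilon> - 2 * R ^ 6"
    "a [^] (2 * R ^ 4 * w') = b [^] (2 * R ^ 4 * h') \<otimes> c [^] (- 2 * R ^ 3 * k)"
    "c [^] (2 * R ^ 4 * w') \<otimes> a [^] \<epsilon> = b [^] B"
    "b [^] (k * B - 2 * R ^ 5 * h' * w') = a [^] (k * \<epsilon> - 2 * R ^ 5 * w' ^ 2)"
proof -
  obtain w1 h1 where rel0: "a [^] (- 2 * R ^ 4 * u ^ 2 + 8 * R ^ 6 * w1)
      = b [^] (2 * R ^ 4 * u' ^ 2 + 8 * R ^ 6 * h1) \<otimes> c [^] (- 2 * R ^ 3 * k)" using relation1 by blast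
  define w' where "w' = - (u ^ 2) + 4 * R ^ 2 * w1"
  define h' where "h' = u' ^ 2 + 4 * R ^ 2 * h1"
  have ww: "- 2 * R ^ 4 * u ^ 2 + 8 * R ^ 6 * w1 = 2 * R ^ 4 * w'" unfolding w'_def by Groebner_Basis.algebra
  have hh: "2 * R ^ 4 * u' ^ 2 + 8 * R ^ 6 * h1 = 2 * R ^ 4 * h'" unfolding h'_def by Groebner_Basis.algebra
  define d where "d = - 2 * R ^ 3 * k"
  have rel: "a [^] (2 * R ^ 4 * w') = b [^] (2 * R ^ 4 * h') \<otimes> c [^] d"
    using rel0 unfolding ww hh d_def .
  obtain W where W: "2 ^ L dvd int W - 2 * R ^ 4 * w'" by (rule nat_rep_L)
  obtain D where D: "2 ^ L dvd int D - d" by (rule nat_rep_L)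
  define \<epsilon> where "\<epsilon> = geo \<alpha> W - int W"
  define B where "B = \<beta> ^ D - 1"
  have rel3: "c [^] int W \<otimes> a [^] \<epsilon> = b [^] B" unfolding \<epsilon>_def B_def by (rule relation3[OF W D rel])
  have cW: "c [^] int W = c [^] (2 * R ^ 4 * w')" by (rule c_eq_L[OF W])
  obtain W1 where W0: "int W - 2 * R ^ 4 * w' = 8 * R ^ 6 * W1" using dvd_trans[OF R6_dvd_L W] by (rule dvdE)
  have "2 * R ^ 4 * (w' + 4 * R ^ 2 * W1) = 2 * R ^ 4 * w' + 8 * R ^ 6 * W1" by Groebner_Basis.algebra
  then have W1: "int W = 2 * R ^ 4 * (w' + 4 * R ^ 2 * W1)" using W0 by (simp only: diff_eq_eq add.commute)
  define W2 where "W2 = w' + 4 * R ^ 2 * W1"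
  have W2: "int W = 2 * R ^ 4 * W2" using W1 unfolding W2_def .
  have oddw: "odd w'" using odd_u by (simp add: w'_def)
  have oddW2: "odd W2" using oddw by (simp add: W2_def)
  have triW: "tri (int W) = R ^ 4 * W2 * (int W + 1)"
  proof (rule half_eq)
    show "2 * tri (int W) = 2 * (R ^ 4 * W2 * (int W + 1))" unfolding two_tri unfolding W2 by Groebner_Basis.algebra
  qed
  obtain q1 where q1: "geo \<alpha> W - (int W + 2 * R ^ 2 * u * tri (int W) + 4 * R ^ 4 * u ^ 2 * tet (int W)) = 8 * R ^ 6 * q1"
    using odd_power_expand(2)[OF \<alpha>_def, of W] by (rule dvdE)
  have "3 * tet (int W) = R ^ 4 * (W2 * ((int W - 1) * (int W + 1)))"
  proof (rule half_eq)
    have "2 * (3 * tet (int W)) = 6 * tet (int W)" by simp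
    also have "\<dots> = int W * ((int W - 1) * (int W + 1))" unfolding six_tet by Groebner_Basis.algebra
    also have "\<dots> = 2 * (R ^ 4 * (W2 * ((int W - 1) * (int W + 1))))" by (subst (1) W2) Groebner_Basis.algebra
    finally show "2 * (3 * tet (int W)) = 2 * (R ^ 4 * (W2 * ((int W - 1) * (int W + 1))))" .
  qed
  then have "R ^ 4 dvd 3 * tet (int W)" by (rule dvdI)
  then have "R ^ 4 dvd tet (int W)"
    using three_cancel_R[of 0 r 4 "tet (int W)"] unfolding R_def power_0 mult_1_left by blast
  then obtain q2 where q2: "tet (int W) = R ^ 4 * q2" by (rule dvdE)
  have "even (u * W2 * (int W + 1) - 1)" using odd_u oddW2 W2 by simp
  then obtain q3 where "u * W2 * (int W + 1) - 1 = 2 * q3" by (rule dvdE)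
  then have q3: "u * W2 * (int W + 1) = 1 + 2 * q3" by simp
  have "\<epsilon> - 2 * R ^ 6 = 2 * R ^ 2 * u * tri (int W) + 4 * R ^ 4 * u ^ 2 * tet (int W) + 8 * R ^ 6 * q1 - 2 * R ^ 6"
    using q1 unfolding \<epsilon>_def by simp
  also have "\<dots> = 2 * R ^ 6 * (u * W2 * (int W + 1)) + 4 * R ^ 8 * u ^ 2 * q2 + 8 * R ^ 6 * q1 - 2 * R ^ 6"
    unfolding triW q2 by Groebner_Basis.algebra
  also have "\<dots> = 4 * R ^ 6 * (q3 + R ^ 2 * u ^ 2 * q2 + 2 * q1)" unfolding q3 by Groebner_Basis.algebra
  finally have \<epsilon>1: "4 * R ^ 6 dvd \<epsilon> - 2 * R ^ 6" by (rule dvdI)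
  obtain D1 where D0: "int D - d = 8 * R ^ 6 * D1" using dvd_trans[OF R6_dvd_L D] by (rule dvdE)
  have "2 * R ^ 3 * (- k + 4 * R ^ 3 * D1) = d + 8 * R ^ 6 * D1" unfolding d_def by Groebner_Basis.algebra
  then have D1: "int D = 2 * R ^ 3 * (- k + 4 * R ^ 3 * D1)" using D0 by (simp only: diff_eq_eq add.commute)
  define D2 where "D2 = - k + 4 * R ^ 3 * D1"
  have D2: "int D = 2 * R ^ 3 * D2" using D1 unfolding D2_def .
  obtain p1 where p1: "\<beta> ^ D - (1 + int D * (2 * R ^ 2 * u') + tri (int D - 1) * (4 * R ^ 4 * u' ^ 2)) = 8 * R ^ 6 * p1"
    using odd_power_expand(1)[OF \<beta>_def, of D] by (rule dvdE)
  have triD: "tri (int D - 1) = R ^ 3 * D2 * (int D - 1)"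
  proof (rule half_eq)
    show "2 * tri (int D - 1) = 2 * (R ^ 3 * D2 * (int D - 1))" unfolding two_tri unfolding D2 by Groebner_Basis.algebra
  qed
  have "B + 4 * R ^ 5 * k * u' = int D * (2 * R ^ 2 * u') + tri (int D - 1) * (4 * R ^ 4 * u' ^ 2) + 8 * R ^ 6 * p1 + 4 * R ^ 5 * k * u'"
    using p1 unfolding B_def by simp
  also have "\<dots> = 4 * R ^ 6 * (4 * R ^ 2 * D1 * u' + R * D2 * (int D - 1) * u' ^ 2 + 2 * p1)"
    unfolding triD unfolding D2 D2_def by Groebner_Basis.algebra
  finally have B1: "4 * R ^ 6 dvd B + 4 * R ^ 5 * k * u'" by (rule dvdI)
  obtain B2 where B0: "B + 4 * R ^ 5 * k * u' = 4 * R ^ 6 * B2" using B1 by (rule dvdE)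
  have "4 * R ^ 5 * (R * B2 - k * u') = 4 * R ^ 6 * B2 - 4 * R ^ 5 * k * u'" by Groebner_Basis.algebra
  then have B2: "B = 4 * R ^ 5 * (R * B2 - k * u')" unfolding B0[symmetric] by simp
  obtain \<epsilon>2 where "\<epsilon> - 2 * R ^ 6 = 4 * R ^ 6 * \<epsilon>2" using \<epsilon>1 by (rule dvdE)
  then have \<epsilon>2: "\<epsilon> = 2 * R ^ 6 * (1 + 2 * \<epsilon>2)" by (simp add: distrib_left)
  have bc: "c [^] int D \<otimes> b [^] (2 * R ^ 4 * h') = b [^] (2 * R ^ 4 * h') \<otimes> c [^] int D"
  proof -
    have "b [^] (2 * R ^ 4 * h' * \<beta> ^ D) = b [^] (2 * R ^ 4 * h')"
    proof (rule pow_eqI[OF b_in b_R8])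
      have "2 * R ^ 4 * h' * \<beta> ^ D - 2 * R ^ 4 * h' = 2 * R ^ 4 * h' * B" unfolding B_def by Groebner_Basis.algebra
      also have "\<dots> = 8 * R ^ 8 * (R * h' * (R * B2 - k * u'))" unfolding B2 by Groebner_Basis.algebra
      finally show "8 * R ^ 8 dvd 2 * R ^ 4 * h' * \<beta> ^ D - 2 * R ^ 4 * h'" by (rule dvdI)
    qed
    then show ?thesis unfolding c_b by simp
  qed
  let ?H = "b [^] (2 * R ^ 4 * h')" and ?A = "a [^] (2 * R ^ 4 * w')"
  have cD: "c [^] int D = c [^] d" by (rule c_eq_L[OF D])
  have bc': "?H \<otimes> c [^] d = c [^] d \<otimes> ?H" using bc unfolding cD by simp
  have cd: "c [^] d = inv ?H \<otimes> ?A" unfolding rel by (simp add: cancel_inv)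
  have HA: "inv ?H \<otimes> ?A = ?A \<otimes> inv ?H"
  proof -
    have "?H \<otimes> ?A = ?A \<otimes> ?H" unfolding rel by (rule commute_mult[OF _ _ _ HOL.refl bc']) simp_all
    then have "?A \<otimes> inv ?H = inv ?H \<otimes> ?A" by (intro commute_inv) simp_all
    then show ?thesis by simp
  qed
  have ck: "c [^] (2 * R ^ 4 * w' * k) = b [^] (2 * R ^ 5 * h' * w') \<otimes> a [^] (- 2 * R ^ 5 * w' ^ 2)"
  proof -
    have "2 * R ^ 4 * w' * k = d * (- R * w')" unfolding d_def by Groebner_Basis.algebra
    then have "c [^] (2 * R ^ 4 * w' * k) = (c [^] d) [^] (- R * w')" by (simp only: int_pow_pow c_in)
    also have "\<dots> = (inv ?H) [^] (- R * w') \<otimes> ?A [^] (- R * w')"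
      unfolding cd by (rule int_pow_mult_distrib[OF HA]) simp_all
    also have "(inv ?H) [^] (- R * w') = b [^] (2 * R ^ 5 * h' * w')"
    proof -
      have "(inv ?H) [^] (- R * w') = (b [^] (- (2 * R ^ 4 * h'))) [^] (- R * w')" by (simp only: int_pow_neg b_in)
      also have "\<dots> = b [^] (- (2 * R ^ 4 * h') * (- R * w'))" by (simp only: int_pow_pow b_in)
      also have "- (2 * R ^ 4 * h') * (- R * w') = 2 * R ^ 5 * h' * w'" by Groebner_Basis.algebra
      finally show ?thesis .
    qed
    also have "?A [^] (- R * w') = a [^] (- 2 * R ^ 5 * w' ^ 2)"
    proof -
      have "?A [^] (- R * w') = a [^] (2 * R ^ 4 * w' * (- R * w'))" by (simp only: int_pow_pow a_in)
      also have "2 * R ^ 4 * w' * (- R * w') = - 2 * R ^ 5 * w' ^ 2" by Groebner_Basis.algebra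
      finally show ?thesis .
    qed
    finally show ?thesis .
  qed
  have ca: "c [^] int W \<otimes> a [^] \<epsilon> = a [^] \<epsilon> \<otimes> c [^] int W"
  proof -
    obtain p2 where p2: "\<alpha> ^ W - (1 + int W * (2 * R ^ 2 * u) + tri (int W - 1) * (4 * R ^ 4 * u ^ 2)) = 8 * R ^ 6 * p2"
      using odd_power_expand(1)[OF \<alpha>_def, of W] by (rule dvdE)
    then have p2': "\<alpha> ^ W = 1 + int W * (2 * R ^ 2 * u) + tri (int W - 1) * (4 * R ^ 4 * u ^ 2) + 8 * R ^ 6 * p2" by simp
    have "a [^] (\<epsilon> * \<alpha> ^ W) = a [^] \<epsilon>"
    proof (rule pow_eqI[OF a_in a_R8])
      have "\<epsilon> * \<alpha> ^ W - \<epsilon> = 8 * R ^ 8 * ((1 + 2 * \<epsilon>2) * (R ^ 4 * W2 * u + R ^ 2 * tri (int W - 1) * u ^ 2 + 2 * R ^ 4 * p2))"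
        unfolding p2' \<epsilon>2 unfolding W2 by Groebner_Basis.algebra
      then show "8 * R ^ 8 dvd \<epsilon> * \<alpha> ^ W - \<epsilon>" by (rule dvdI)
    qed
    then show ?thesis unfolding a_c by simp
  qed
  have "b [^] (k * B) = (b [^] B) [^] k" by (simp only: int_pow_pow b_in mult.commute)
  also have "\<dots> = (c [^] int W) [^] k \<otimes> (a [^] \<epsilon>) [^] k"
    unfolding rel3[symmetric] by (rule int_pow_mult_distrib[OF ca]) simp_all
  also have "\<dots> = c [^] (2 * R ^ 4 * w' * k) \<otimes> a [^] (\<epsilon> * k)" unfolding cW by (simp only: int_pow_pow c_in a_in)
  also have "\<dots> = b [^] (2 * R ^ 5 * h' * w') \<otimes> (a [^] (- 2 * R ^ 5 * w' ^ 2) \<otimes> a [^] (\<epsilon> * k))"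
    unfolding ck by (simp add: m_assoc)
  also have "a [^] (- 2 * R ^ 5 * w' ^ 2) \<otimes> a [^] (\<epsilon> * k) = a [^] (- 2 * R ^ 5 * w' ^ 2 + \<epsilon> * k)"
    by (simp only: int_pow_mult a_in)
  also have "- 2 * R ^ 5 * w' ^ 2 + \<epsilon> * k = k * \<epsilon> - 2 * R ^ 5 * w' ^ 2" by Groebner_Basis.algebra
  finally have fin: "inv (b [^] (2 * R ^ 5 * h' * w')) \<otimes> b [^] (k * B) = a [^] (k * \<epsilon> - 2 * R ^ 5 * w' ^ 2)"
    by (simp add: cancel_inv)
  have fin': "b [^] (k * B - 2 * R ^ 5 * h' * w') = a [^] (k * \<epsilon> - 2 * R ^ 5 * w' ^ 2)"
    unfolding fin[symmetric] using int_pow_mult[OF b_in, of "- (2 * R ^ 5 * h' * w')" "k * B"]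
    by (simp add: int_pow_neg add.commute)
  have "w' + u ^ 2 = 2 * R ^ 2 * (2 * w1)" "h' - u' ^ 2 = 4 * R ^ 2 * h1" unfolding w'_def h'_def by simp_all
  then have "2 * R ^ 2 dvd w' + u ^ 2" "4 * R ^ 2 dvd h' - u' ^ 2" by (simp_all only: dvd_triv_left)
  moreover have "c [^] (2 * R ^ 4 * w') \<otimes> a [^] \<epsilon> = b [^] B" using rel3 unfolding cW .
  ultimately show ?thesis using that[OF _ _ B1 \<epsilon>1 rel[unfolded d_def] _ fin'] by blast
qed

text \<open>In the third of the \<open>relations\<close>, k B is an even multiple of 2R^5 while h'
  w' is odd. So the exponent of b is 2R^5 times an odd number, which can be inverted.\<close>

lemma b_in_a: "\<exists>j. b [^] (2 * R ^ 5) = a [^] (2 * R ^ 5 * j)"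
proof -
  obtain w' h' B \<epsilon> where w: "2 * R ^ 2 dvd w' + u ^ 2" and h: "4 * R ^ 2 dvd h' - u' ^ 2"
    and B: "4 * R ^ 6 dvd B + 4 * R ^ 5 * k * u'" and \<epsilon>: "4 * R ^ 6 dvd \<epsilon> - 2 * R ^ 6"
    and eq: "b [^] (k * B - 2 * R ^ 5 * h' * w') = a [^] (k * \<epsilon> - 2 * R ^ 5 * w' ^ 2)"
    using relations by metis
  obtain B1 where B1: "B + 4 * R ^ 5 * k * u' = 4 * R ^ 6 * B1" using B by (rule dvdE)
  obtain \<epsilon>1 where \<epsilon>1: "\<epsilon> - 2 * R ^ 6 = 4 * R ^ 6 * \<epsilon>1" using \<epsilon> by (rule dvdE)
  have B2: "B = 4 * R ^ 6 * B1 - 4 * R ^ 5 * k * u'" using B1 by simp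
  have \<epsilon>2: "\<epsilon> = 4 * R ^ 6 * \<epsilon>1 + 2 * R ^ 6" using \<epsilon>1 by simp
  have oddw: "odd w'"
  proof -
    have "even (w' + u ^ 2)" using w by (metis dvd_mult_left)
    then show ?thesis using odd_u by simp
  qed
  have oddh: "odd h'"
  proof -
    have "even (h' - u' ^ 2)" using h by (metis dvd_mult_left even_numeral dvd_trans)
    then show ?thesis using odd_u' by simp
  qed
  define t where "t = 2 * k * (R * B1 - k * u') - h' * w'"
  have "odd t" unfolding t_def using oddw oddh by simp
  have "k * B - 2 * R ^ 5 * h' * w' = 2 * R ^ 5 * t" unfolding B2 t_def by Groebner_Basis.algebra
  moreover have "k * \<epsilon> - 2 * R ^ 5 * w' ^ 2 = 2 * R ^ 5 * (k * R * (1 + 2 * \<epsilon>1) - w' ^ 2)"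
    unfolding \<epsilon>2 by Groebner_Basis.algebra
  ultimately have eq': "b [^] (2 * R ^ 5 * t) = a [^] (2 * R ^ 5 * (k * R * (1 + 2 * \<epsilon>1) - w' ^ 2))" using eq by simp
  obtain t' where t': "\<And>i. b [^] (i * t * t') = b [^] (i::int)" using odd_root[OF b_in b_e \<open>odd t\<close>] by blast
  have "b [^] (2 * R ^ 5) = (b [^] (2 * R ^ 5 * t)) [^] t'" unfolding t'[symmetric, of "2 * R ^ 5"] by (simp only: int_pow_pow b_in)
  also have "\<dots> = a [^] (2 * R ^ 5 * ((k * R * (1 + 2 * \<epsilon>1) - w' ^ 2) * t'))"
    unfolding eq' by (simp only: int_pow_pow a_in mult.assoc)
  finally show ?thesis by blast
qed

lemma b_central: "b [^] (2 * R ^ 5 * i) \<otimes> a = a \<otimes> b [^] (2 * R ^ 5 * i)" "b [^] (2 * R ^ 5 * i) \<otimes> b = b \<otimes> b [^] (2 * R ^ 5 * i)"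
proof -
  obtain j where j: "b [^] (2 * R ^ 5) = a [^] (2 * R ^ 5 * j)" using b_in_a by blast
  have "b [^] (2 * R ^ 5 * i) = (b [^] (2 * R ^ 5)) [^] i" by (simp only: int_pow_pow b_in)
  then have "b [^] (2 * R ^ 5 * i) = a [^] (2 * R ^ 5 * j * i)" unfolding j by (simp only: int_pow_pow a_in)
  then show "b [^] (2 * R ^ 5 * i) \<otimes> a = a \<otimes> b [^] (2 * R ^ 5 * i)"
    using pow_comm[OF a_in, of "2 * R ^ 5 * j * i" 1] by simp
  show "b [^] (2 * R ^ 5 * i) \<otimes> b = b \<otimes> b [^] (2 * R ^ 5 * i)"
    using pow_comm[OF b_in, of "2 * R ^ 5 * i" 1] by simp
qed

lemma a_central: "a [^] (2 * R ^ 5 * i) \<otimes> a = a \<otimes> a [^] (2 * R ^ 5 * i)" "a [^] (2 * R ^ 5 * i) \<otimes> b = b \<otimes> a [^] (2 * R ^ 5 * i)"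
proof -
  interpret s: two_mac G b a "inv c" \<beta> \<alpha> L r R u' u "- k" by (rule swap_two)
  show "a [^] (2 * R ^ 5 * i) \<otimes> a = a \<otimes> a [^] (2 * R ^ 5 * i)" "a [^] (2 * R ^ 5 * i) \<otimes> b = b \<otimes> a [^] (2 * R ^ 5 * i)"
    by (rule s.b_central)+
qed

text \<open>The relation c^(2R^4w') = b^B a^(-\<open>\<epsilon>\<close>) has B and
  \<open>\<epsilon>\<close> divisible by 2R^5, so its right side is central; w' is odd and can be
  removed.\<close>

lemma c_central: "c [^] (2 * R ^ 4 * i) \<otimes> a = a \<otimes> c [^] (2 * R ^ 4 * i)" "c [^] (2 * R ^ 4 * i) \<otimes> b = b \<otimes> c [^] (2 * R ^ 4 * i)"
proof -
  obtain w' h' B \<epsilon> where w: "2 * R ^ 2 dvd w' + u ^ 2"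
    and B: "4 * R ^ 6 dvd B + 4 * R ^ 5 * k * u'" and \<epsilon>: "4 * R ^ 6 dvd \<epsilon> - 2 * R ^ 6"
    and eq: "c [^] (2 * R ^ 4 * w') \<otimes> a [^] \<epsilon> = b [^] B"
    using relations by metis
  obtain B1 where B1: "B + 4 * R ^ 5 * k * u' = 4 * R ^ 6 * B1" using B by (rule dvdE)
  obtain \<epsilon>1 where \<epsilon>1: "\<epsilon> - 2 * R ^ 6 = 4 * R ^ 6 * \<epsilon>1" using \<epsilon> by (rule dvdE)
  have "B = 4 * R ^ 6 * B1 - 4 * R ^ 5 * k * u'" using B1 by simp
  also have "\<dots> = 2 * R ^ 5 * (2 * R * B1 - 2 * k * u')" by Groebner_Basis.algebra
  finally have B2: "B = 2 * R ^ 5 * (2 * R * B1 - 2 * k * u')" .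
  have "- \<epsilon> = - (4 * R ^ 6 * \<epsilon>1 + 2 * R ^ 6)" using \<epsilon>1 by simp
  also have "\<dots> = 2 * R ^ 5 * (- 2 * R * \<epsilon>1 - R)" by Groebner_Basis.algebra
  finally have \<epsilon>2: "- \<epsilon> = 2 * R ^ 5 * (- 2 * R * \<epsilon>1 - R)" .
  have "even (w' + u ^ 2)" using w by (metis dvd_mult_left)
  then have "odd w'" using odd_u by simp
  then obtain t' where t': "\<And>i. c [^] (i * w' * t') = c [^] (i::int)" using odd_root[OF c_in c_e] by blast
  have "c [^] (2 * R ^ 4 * w') \<otimes> a [^] \<epsilon> \<otimes> inv (a [^] \<epsilon>) = b [^] B \<otimes> inv (a [^] \<epsilon>)" unfolding eq ..
  then have cw: "c [^] (2 * R ^ 4 * w') = b [^] B \<otimes> a [^] (- \<epsilon>)" by (simp add: m_assoc int_pow_neg)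
  have ci: "c [^] (2 * R ^ 4 * i) = (b [^] B \<otimes> a [^] (- \<epsilon>)) [^] (t' * i)"
  proof -
    have "c [^] (2 * R ^ 4 * i) = c [^] (2 * R ^ 4 * i * w' * t')" by (rule t'[symmetric])
    also have "2 * R ^ 4 * i * w' * t' = 2 * R ^ 4 * w' * (t' * i)" by Groebner_Basis.algebra
    also have "c [^] \<dots> = (c [^] (2 * R ^ 4 * w')) [^] (t' * i)" by (simp only: int_pow_pow c_in)
    finally show ?thesis unfolding cw .
  qed
  let ?g = "b [^] B \<otimes> a [^] (- \<epsilon>)"
  have "a \<otimes> ?g = ?g \<otimes> a"
    by (rule commute_mult) (simp_all only: B2 \<epsilon>2 a_central b_central a_in b_in int_pow_closed)
  then have "a \<otimes> ?g [^] (t' * i) = ?g [^] (t' * i) \<otimes> a" by (intro commute_pow) simp_all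
  then show "c [^] (2 * R ^ 4 * i) \<otimes> a = a \<otimes> c [^] (2 * R ^ 4 * i)" unfolding ci by simp
  have "b \<otimes> ?g = ?g \<otimes> b"
    by (rule commute_mult) (simp_all only: B2 \<epsilon>2 a_central b_central a_in b_in int_pow_closed)
  then have "b \<otimes> ?g [^] (t' * i) = ?g [^] (t' * i) \<otimes> b" by (intro commute_pow) simp_all
  then show "c [^] (2 * R ^ 4 * i) \<otimes> b = b \<otimes> c [^] (2 * R ^ 4 * i)" unfolding ci by simp
qed

text \<open>With n = 2R^4, c^n commutes with a, so a^(\<open>\<alpha>\<close>^n - 1) = 1; and
  \<open>\<alpha>\<close>^n - 1 is 4R^6 times an odd number.\<close>

lemma a_R6: "a [^] (4 * R ^ 6) = \<one>"
proof -
  define n where "n = nat (2 * R ^ 4)"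
  have n: "int n = 2 * R ^ 4" using R_pos by (simp add: n_def)
  have "c [^] int n \<otimes> a = a \<otimes> c [^] int n" unfolding n using c_central(1)[of 1] by simp
  then have "a [^] (1::int) \<otimes> c [^] int n = c [^] int n \<otimes> a [^] (1::int)" by simp
  then have "c [^] int n \<otimes> a [^] (\<alpha> ^ n) = c [^] int n \<otimes> a [^] (1::int)" unfolding a_c by simp
  then have "a [^] (\<alpha> ^ n) = a [^] (1::int)" by (simp only: l_cancel a_in c_in int_pow_closed)
  then have e: "a [^] (\<alpha> ^ n - 1) = \<one>" by (simp add: int_pow_diff)
  obtain p where "\<alpha> ^ n - (1 + int n * (2 * R ^ 2 * u) + tri (int n - 1) * (4 * R ^ 4 * u ^ 2)) = 8 * R ^ 6 * p"
    using odd_power_expand(1)[OF \<alpha>_def, of n] by (rule dvdE)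
  then have p: "\<alpha> ^ n - 1 = int n * (2 * R ^ 2 * u) + tri (int n - 1) * (4 * R ^ 4 * u ^ 2) + 8 * R ^ 6 * p" by simp
  have tri: "tri (int n - 1) = R ^ 4 * (int n - 1)"
  proof (rule half_eq)
    show "2 * tri (int n - 1) = 2 * (R ^ 4 * (int n - 1))" unfolding two_tri unfolding n by Groebner_Basis.algebra
  qed
  have "\<alpha> ^ n - 1 = 4 * R ^ 6 * (u + R ^ 2 * (int n - 1) * u ^ 2 + 2 * p)"
    unfolding p tri unfolding n by Groebner_Basis.algebra
  then have e1: "a [^] (4 * R ^ 6 * (u + R ^ 2 * (int n - 1) * u ^ 2 + 2 * p)) = \<one>" using e by (simp only:)
  have o1: "odd (u + R ^ 2 * (int n - 1) * u ^ 2 + 2 * p)" using odd_u R_even by simp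
  show ?thesis by (rule odd_cancel[OF a_in a_e o1 e1])
qed

lemma b_R6: "b [^] (4 * R ^ 6) = \<one>"
proof -
  interpret s: two_mac G b a "inv c" \<beta> \<alpha> L r R u' u "- k" by (rule swap_two)
  show ?thesis by (rule s.a_R6)
qed

lemma relation1': "a [^] (- 2 * R ^ 4 * u ^ 2) = b [^] (2 * R ^ 4 * u' ^ 2) \<otimes> c [^] (- 2 * R ^ 3 * k)"
proof -
  obtain w1 h1 where rel: "a [^] (- 2 * R ^ 4 * u ^ 2 + 8 * R ^ 6 * w1)
      = b [^] (2 * R ^ 4 * u' ^ 2 + 8 * R ^ 6 * h1) \<otimes> c [^] (- 2 * R ^ 3 * k)" using relation1 by blast
  have d8: "4 * R ^ 6 dvd (t + 8 * R ^ 6 * s) - t" for t s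
    by (rule dvdI[of _ _ "2 * s"]) simp
  show ?thesis using rel unfolding pow_eqI[OF a_in a_R6 d8] pow_eqI[OF b_in b_R6 d8] .
qed

text \<open>The third of the \<open>relations\<close>, with exponents reduced modulo the newly found
  period 4R^6. The term R on the right is the surviving half-modulus 2R^6.\<close>

lemma star: "b [^] (2 * R ^ 5 * (u ^ 4 - 2 * k ^ 2 * u)) = a [^] (2 * R ^ 5 * (R - u ^ 4))"
proof -
  obtain w' h' B \<epsilon> where w: "2 * R ^ 2 dvd w' + u ^ 2" and h: "4 * R ^ 2 dvd h' - u' ^ 2"
    and B: "4 * R ^ 6 dvd B + 4 * R ^ 5 * k * u'" and \<epsilon>: "4 * R ^ 6 dvd \<epsilon> - 2 * R ^ 6"
    and eq: "b [^] (k * B - 2 * R ^ 5 * h' * w') = a [^] (k * \<epsilon> - 2 * R ^ 5 * w' ^ 2)"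
    using relations by metis
  obtain B1 where B1: "B + 4 * R ^ 5 * k * u' = 4 * R ^ 6 * B1" using B by (rule dvdE)
  obtain \<epsilon>1 where \<epsilon>1: "\<epsilon> - 2 * R ^ 6 = 4 * R ^ 6 * \<epsilon>1" using \<epsilon> by (rule dvdE)
  obtain w1 where w1: "w' + u ^ 2 = 2 * R ^ 2 * w1" using w by (rule dvdE)
  obtain h1 where h1: "h' - u' ^ 2 = 4 * R ^ 2 * h1" using h by (rule dvdE)
  have B2: "B = 4 * R ^ 6 * B1 - 4 * R ^ 5 * k * u'" using B1 by simp
  have \<epsilon>2: "\<epsilon> = 4 * R ^ 6 * \<epsilon>1 + 2 * R ^ 6" using \<epsilon>1 by simp
  have w2: "w' = 2 * R ^ 2 * w1 - u ^ 2" using w1 by simp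
  have h2: "h' = 4 * R ^ 2 * h1 + (u - R * k) ^ 2" using h1 unfolding u'_def by simp
  have "even (k - 1)" using odd_k by simp
  then obtain k1 where "k - 1 = 2 * k1" by (rule dvdE)
  then have k1: "k = 1 + 2 * k1" by simp
  obtain r2 where r2: "R = 2 * r2" using R_even by blast
  have "b [^] (k * B - 2 * R ^ 5 * h' * w') = b [^] (2 * R ^ 5 * (u ^ 4 - 2 * k ^ 2 * u))"
  proof (rule pow_eqI[OF b_in b_R6])
    have "k * B - 2 * R ^ 5 * h' * w' - 2 * R ^ 5 * (u ^ 4 - 2 * k ^ 2 * u)
       = 4 * R ^ 6 * (k * B1 + k ^ 3 - R * h' * w1 + 2 * R * h1 * u ^ 2 - k * u ^ 3) + 2 * R ^ 7 * k ^ 2 * u ^ 2"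
      unfolding B2 u'_def w2 unfolding h2 by Groebner_Basis.algebra
    also have "2 * R ^ 7 * k ^ 2 * u ^ 2 = 4 * R ^ 6 * (r2 * k ^ 2 * u ^ 2) + (R - 2 * r2) * (2 * R ^ 6 * k ^ 2 * u ^ 2)"
      by Groebner_Basis.algebra
    finally have "k * B - 2 * R ^ 5 * h' * w' - 2 * R ^ 5 * (u ^ 4 - 2 * k ^ 2 * u)
       = 4 * R ^ 6 * (k * B1 + k ^ 3 - R * h' * w1 + 2 * R * h1 * u ^ 2 - k * u ^ 3) + 4 * R ^ 6 * (r2 * k ^ 2 * u ^ 2)"
      using r2 by simp
    then show "4 * R ^ 6 dvd k * B - 2 * R ^ 5 * h' * w' - 2 * R ^ 5 * (u ^ 4 - 2 * k ^ 2 * u)"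
      by (simp only: dvd_add dvd_triv_left)
  qed
  moreover have "a [^] (k * \<epsilon> - 2 * R ^ 5 * w' ^ 2) = a [^] (2 * R ^ 5 * (R - u ^ 4))"
  proof (rule pow_eqI[OF a_in a_R6])
    have "k * \<epsilon> - 2 * R ^ 5 * w' ^ 2 - 2 * R ^ 5 * (R - u ^ 4) = 4 * R ^ 6 * ((1 + 2 * k1) * \<epsilon>1 + k1 - 2 * R ^ 3 * w1 ^ 2 + 2 * R * w1 * u ^ 2)"
      unfolding \<epsilon>2 w2 k1 by Groebner_Basis.algebra
    then show "4 * R ^ 6 dvd k * \<epsilon> - 2 * R ^ 5 * w' ^ 2 - 2 * R ^ 5 * (R - u ^ 4)" by (rule dvdI)
  qed
  ultimately show ?thesis using eq by simp
qed

text \<open>The mirror image of \<open>star\<close>; returning from u' to u changes the exponents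
  only by multiples of 4R^6.\<close>

lemma star': "a [^] (2 * R ^ 5 * (u ^ 4 - 2 * k ^ 2 * u)) = b [^] (2 * R ^ 5 * (R - u ^ 4))"
proof -
  interpret s: two_mac G b a "inv c" \<beta> \<alpha> L r R u' u "- k" by (rule swap_two)
  have "a [^] (2 * R ^ 5 * (u' ^ 4 - 2 * (- k) ^ 2 * u')) = b [^] (2 * R ^ 5 * (R - u' ^ 4))" by (rule s.star)
  moreover have "a [^] (2 * R ^ 5 * (u' ^ 4 - 2 * (- k) ^ 2 * u')) = a [^] (2 * R ^ 5 * (u ^ 4 - 2 * k ^ 2 * u))"
  proof (rule pow_eqI[OF a_in a_R6])
    obtain r2 where r2: "R = 2 * r2" using R_even by blast
    have "2 * R ^ 5 * (u' ^ 4 - 2 * (- k) ^ 2 * u') - 2 * R ^ 5 * (u ^ 4 - 2 * k ^ 2 * u)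
      = 4 * R ^ 6 * (- 2 * k * u ^ 3 + 3 * R * k ^ 2 * u ^ 2 - 2 * R ^ 2 * k ^ 3 * u + k ^ 3 + R ^ 2 * r2 * k ^ 4) + (R - 2 * r2) * (2 * R ^ 8 * k ^ 4)"
      unfolding u'_def by Groebner_Basis.algebra
    then show "4 * R ^ 6 dvd 2 * R ^ 5 * (u' ^ 4 - 2 * (- k) ^ 2 * u') - 2 * R ^ 5 * (u ^ 4 - 2 * k ^ 2 * u)"
      using r2 by (simp only: diff_self mult_zero_left add_0_right dvd_triv_left)
  qed
  moreover have "b [^] (2 * R ^ 5 * (R - u' ^ 4)) = b [^] (2 * R ^ 5 * (R - u ^ 4))"
  proof (rule pow_eqI[OF b_in b_R6])
    obtain r2 where r2: "R = 2 * r2" using R_even by blast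
    have "2 * R ^ 5 * (R - u' ^ 4) - 2 * R ^ 5 * (R - u ^ 4)
      = 4 * R ^ 6 * (2 * k * u ^ 3 - 3 * R * k ^ 2 * u ^ 2 + 2 * R ^ 2 * k ^ 3 * u - R ^ 2 * r2 * k ^ 4) - (R - 2 * r2) * (2 * R ^ 8 * k ^ 4)"
      unfolding u'_def by Groebner_Basis.algebra
    then show "4 * R ^ 6 dvd 2 * R ^ 5 * (R - u' ^ 4) - 2 * R ^ 5 * (R - u ^ 4)"
      using r2 by (simp only: diff_self mult_zero_left diff_0_right dvd_triv_left)
  qed
  ultimately show ?thesis by simp
qed

text \<open>Applying \<open>star'\<close> and then \<open>star\<close> gives o^2 = p^2 as exponents
  on a^(2R^5). Modulo 4R^6 the difference is 8R^5(k^2 - u^3) times the odd number k^2u^2.\<close>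

lemma a_s: "a [^] (8 * R ^ 5 * (k ^ 2 - u ^ 3)) = \<one>"
proof -
  let ?o = "u ^ 4 - 2 * k ^ 2 * u" let ?p = "R - u ^ 4"
  have "a [^] (2 * R ^ 5 * ?o * ?o) = (a [^] (2 * R ^ 5 * ?o)) [^] ?o" by (simp only: int_pow_pow a_in)
  also have "\<dots> = (b [^] (2 * R ^ 5 * ?p)) [^] ?o" unfolding star' ..
  also have "\<dots> = (b [^] (2 * R ^ 5 * ?o)) [^] ?p" by (simp only: int_pow_pow b_in mult.assoc mult.commute[of ?p])
  also have "\<dots> = a [^] (2 * R ^ 5 * ?p * ?p)" unfolding star by (simp only: int_pow_pow a_in)
  finally have eq: "a [^] (2 * R ^ 5 * ?o * ?o) = a [^] (2 * R ^ 5 * ?p * ?p)" .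
  have e0: "a [^] (2 * R ^ 5 * ?o * ?o - 2 * R ^ 5 * ?p * ?p) = \<one>"
    unfolding int_pow_diff[OF a_in] eq by (rule r_inv) simp
  have e1: "a [^] (2 * R ^ 5 * ?o * ?o - 2 * R ^ 5 * ?p * ?p) = a [^] (8 * R ^ 5 * (k ^ 2 - u ^ 3) * (k ^ 2 * u ^ 2))"
  proof (rule pow_eqI[OF a_in a_R6])
    obtain r2 where r2: "R = 2 * r2" using R_even by blast
    have "2 * R ^ 5 * ?o * ?o - 2 * R ^ 5 * ?p * ?p - 8 * R ^ 5 * (k ^ 2 - u ^ 3) * (k ^ 2 * u ^ 2)
       = 4 * R ^ 6 * (u ^ 4 - r2) - (R - 2 * r2) * (2 * R ^ 6)" by Groebner_Basis.algebra
    then show "4 * R ^ 6 dvd 2 * R ^ 5 * ?o * ?o - 2 * R ^ 5 * ?p * ?p - 8 * R ^ 5 * (k ^ 2 - u ^ 3) * (k ^ 2 * u ^ 2)"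
      using r2 by (simp only: diff_self mult_zero_left diff_0_right dvd_triv_left)
  qed
  have o1: "odd (k ^ 2 * u ^ 2)" using odd_k odd_u by simp
  show ?thesis by (rule odd_cancel[OF a_in a_e o1 HOL.trans[OF e1[symmetric] e0]])
qed

lemma b_s: "b [^] (8 * R ^ 5 * (k ^ 2 - u' ^ 3)) = \<one>"
proof -
  interpret s: two_mac G b a "inv c" \<beta> \<alpha> L r R u' u "- k" by (rule swap_two)
  show ?thesis using s.a_s by simp
qed

lemma b_s': "b [^] (8 * R ^ 5 * (k ^ 2 - u ^ 3)) = \<one>"
proof -
  have "b [^] (8 * R ^ 5 * (k ^ 2 - u ^ 3)) = b [^] (8 * R ^ 5 * (k ^ 2 - u' ^ 3))"
  proof (rule pow_eqI[OF b_in b_R6])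
    have "8 * R ^ 5 * (k ^ 2 - u ^ 3) - 8 * R ^ 5 * (k ^ 2 - u' ^ 3) = 4 * R ^ 6 * (- 6 * k * u ^ 2 + 6 * R * k ^ 2 * u - 2 * R ^ 2 * k ^ 3)"
      unfolding u'_def by Groebner_Basis.algebra
    then show "4 * R ^ 6 dvd 8 * R ^ 5 * (k ^ 2 - u ^ 3) - 8 * R ^ 5 * (k ^ 2 - u' ^ 3)" by (rule dvdI)
  qed
  then show ?thesis using b_s by simp
qed

end

section \<open>Counting normal forms, and comparing powers of c with powers of a\<close>

lemma card_le_of_cover:
  fixes f :: "int \<Rightarrow> int \<Rightarrow> 'a \<Rightarrow> 'b"
  assumes "finite A" "S \<subseteq> (\<lambda>(i, j, x). f i j x) ` ({0..<m} \<times> {0..<n} \<times> A)"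
  shows "card S \<le> nat m * (nat n * card A)"
proof -
  have fin: "finite ({0..<m} \<times> {0..<n} \<times> A)" using assms(1) by simp
  have "card S \<le> card ((\<lambda>(i, j, x). f i j x) ` ({0..<m} \<times> {0..<n} \<times> A))"
    using assms(2) fin by (intro card_mono finite_imageI)
  also have "\<dots> \<le> card ({0..<m} \<times> {0..<n} \<times> A)" by (rule card_image_le[OF fin])
  finally show ?thesis by (simp add: card_cartesian_product)
qed

context two_mac begin

lemma b4_c: "b [^] (2 * R ^ 4 * i) \<otimes> c = c \<otimes> b [^] (2 * R ^ 4 * i)"
proof -
  have "b [^] (2 * R ^ 4 * i * \<beta> ^ 1) = b [^] (2 * R ^ 4 * i)"
  proof (rule pow_eqI[OF b_in b_R6])
    have "2 * R ^ 4 * i * \<beta> ^ 1 - 2 * R ^ 4 * i = 4 * R ^ 6 * (i * u')" unfolding \<beta>_def by Groebner_Basis.algebra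
    then show "4 * R ^ 6 dvd 2 * R ^ 4 * i * \<beta> ^ 1 - 2 * R ^ 4 * i" by (rule dvdI)
  qed
  then show ?thesis using c_b[of 1 "2 * R ^ 4 * i"] by simp
qed

text \<open>This is \<open>relation1'\<close> solved for c^(2R^3k). Since b^(2R^4) commutes with c,
  the two factors on the right commute and t-th powers split.\<close>

lemma c_R3_mult:
  "c [^] (2 * R ^ 3 * k * t) = b [^] (2 * R ^ 4 * u' ^ 2 * t) \<otimes> a [^] (2 * R ^ 4 * u ^ 2 * t)"
proof -
  let ?B = "b [^] (2 * R ^ 4 * u' ^ 2)" and ?A = "a [^] (2 * R ^ 4 * u ^ 2)" and ?C = "c [^] (2 * R ^ 3 * k)"
  have "inv ?A = ?B \<otimes> inv ?C" using relation1' by (simp add: int_pow_neg)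
  then have "inv ?A \<otimes> ?C = ?B" by (simp add: m_assoc)
  moreover have "?A \<otimes> (inv ?A \<otimes> ?C) = ?C" by (simp add: cancel_inv)
  ultimately have CA: "?C = ?A \<otimes> ?B" by (simp only:)
  have BC: "?B \<otimes> ?C = ?C \<otimes> ?B" by (rule commute_pow[OF _ _ b4_c]) simp_all
  have "?B \<otimes> ?A = ?A \<otimes> ?B"
  proof -
    have "?A \<otimes> ?B \<otimes> ?B = ?B \<otimes> ?A \<otimes> ?B" using BC unfolding CA by (simp add: m_assoc)
    then show ?thesis by (simp only: right_cancel m_closed a_in b_in int_pow_closed)
  qed
  then have C: "?C = ?B \<otimes> ?A" and BA: "?B \<otimes> ?A = ?A \<otimes> ?B" using CA by simp_all
  have "c [^] (2 * R ^ 3 * k * t) = ?C [^] t" by (simp only: int_pow_pow c_in)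
  also have "\<dots> = ?B [^] t \<otimes> ?A [^] t" unfolding C by (rule int_pow_mult_distrib[OF BA]) simp_all
  finally show ?thesis by (simp only: int_pow_pow a_in b_in)
qed

text \<open>In b^i c^j a^t, c^(2R^3) is a power of b^(2R^4), which commutes with c, times a power of
  a; and b^(2R^5) is a central power of a. So j is reduced modulo 2R^3 and i modulo 2R^5. The box
  differs from that of the model but has the same size 4R^8.\<close>

lemma card_le: "card (carrier G) \<le> nat (2 * R ^ 5) * (nat (2 * R ^ 3) * ord a)"
proof -
  let ?A = "{a [^] k | k::int. True}"
  have finA: "finite ?A" by (rule finite_cyclic[OF a_in a_e e_pos])
  obtain k' where k': "\<And>i. c [^] (i * k * k') = c [^] (i::int)" using odd_root[OF c_in c_e odd_k] by blast
  obtain q where q: "b [^] (2 * R ^ 5) = a [^] (2 * R ^ 5 * q)" using b_in_a by blast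
  have "carrier G \<subseteq> (\<lambda>(i, j, x). b [^] i \<otimes> c [^] j \<otimes> x) ` ({0..<2 * R ^ 5} \<times> {0..<2 * R ^ 3} \<times> ?A)"
  proof
    fix g assume "g \<in> carrier G"
    then obtain i j t :: int where g: "g = b [^] i \<otimes> c [^] j \<otimes> a [^] t"
      unfolding carrier_eq BCA_def by auto
    define j1 where "j1 = j div (2 * R ^ 3)"
    define j0 where "j0 = j mod (2 * R ^ 3)"
    have j: "j = j0 + 2 * R ^ 3 * j1" by (simp add: j0_def j1_def)
    have kj: "2 * R ^ 3 * k * (k' * j1) = 2 * R ^ 3 * j1 * k * k'" by Groebner_Basis.algebra
    have cj1: "c [^] (2 * R ^ 3 * j1) = c [^] (2 * R ^ 3 * k * (k' * j1))" unfolding kj by (rule k'[symmetric])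
    define p where "p = u' ^ 2 * (k' * j1)"
    define p' where "p' = 2 * R ^ 4 * u ^ 2 * (k' * j1)"
    have cj1': "c [^] (2 * R ^ 3 * j1) = b [^] (2 * R ^ 4 * p) \<otimes> a [^] p'"
      unfolding cj1 c_R3_mult p_def p'_def by (simp only: mult.assoc)
    have cb0: "c [^] j0 \<otimes> b [^] (2 * R ^ 4 * p) = b [^] (2 * R ^ 4 * p) \<otimes> c [^] j0"
      using commute_pow[OF _ c_in b4_c[of p], of j0] by simp
    define i1 where "i1 = (i + 2 * R ^ 4 * p) div (2 * R ^ 5)"
    define i0 where "i0 = (i + 2 * R ^ 4 * p) mod (2 * R ^ 5)"
    have i: "i + 2 * R ^ 4 * p = i0 + 2 * R ^ 5 * i1" by (simp add: i0_def i1_def)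
    have bi1: "b [^] (2 * R ^ 5 * i1) = a [^] (2 * R ^ 5 * q * i1)"
    proof -
      have "b [^] (2 * R ^ 5 * i1) = (b [^] (2 * R ^ 5)) [^] i1" by (simp only: int_pow_pow b_in)
      then show ?thesis unfolding q by (simp only: int_pow_pow a_in)
    qed
    have "b [^] (2 * R ^ 5 * i1) \<otimes> c = c \<otimes> b [^] (2 * R ^ 5 * i1)" by (rule commute_c[OF _ b_central]) simp
    then have bc1: "b [^] (2 * R ^ 5 * i1) \<otimes> c [^] j0 = c [^] j0 \<otimes> b [^] (2 * R ^ 5 * i1)" by (intro commute_pow) simp_all
    have "g = b [^] i \<otimes> (c [^] j0 \<otimes> c [^] (2 * R ^ 3 * j1)) \<otimes> a [^] t" unfolding g j by (simp add: int_pow_mult)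
    also have "\<dots> = b [^] i \<otimes> ((c [^] j0 \<otimes> b [^] (2 * R ^ 4 * p)) \<otimes> a [^] p') \<otimes> a [^] t" unfolding cj1' by (simp add: m_assoc)
    also have "\<dots> = (b [^] i \<otimes> b [^] (2 * R ^ 4 * p)) \<otimes> c [^] j0 \<otimes> (a [^] p' \<otimes> a [^] t)" unfolding cb0 by (simp add: m_assoc)
    also have "b [^] i \<otimes> b [^] (2 * R ^ 4 * p) = b [^] i0 \<otimes> b [^] (2 * R ^ 5 * i1)"
      using i by (simp flip: int_pow_mult)
    also have "b [^] i0 \<otimes> b [^] (2 * R ^ 5 * i1) \<otimes> c [^] j0 \<otimes> (a [^] p' \<otimes> a [^] t)
        = b [^] i0 \<otimes> (b [^] (2 * R ^ 5 * i1) \<otimes> c [^] j0) \<otimes> (a [^] p' \<otimes> a [^] t)" by (simp add: m_assoc)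
    also have "\<dots> = b [^] i0 \<otimes> c [^] j0 \<otimes> (a [^] (2 * R ^ 5 * q * i1) \<otimes> (a [^] p' \<otimes> a [^] t))"
      unfolding bc1 unfolding bi1 by (simp add: m_assoc)
    also have "a [^] (2 * R ^ 5 * q * i1) \<otimes> (a [^] p' \<otimes> a [^] t) = a [^] (2 * R ^ 5 * q * i1 + (p' + t))"
      by (simp only: int_pow_mult a_in)
    finally have gg: "g = b [^] i0 \<otimes> c [^] j0 \<otimes> a [^] (2 * R ^ 5 * q * i1 + (p' + t))" .
    have "i0 \<in> {0..<2 * R ^ 5}" "j0 \<in> {0..<2 * R ^ 3}" using R_pos by (simp_all add: i0_def j0_def)
    moreover have "a [^] (2 * R ^ 5 * q * i1 + (p' + t)) \<in> ?A" by blast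
    ultimately have "(i0, j0, a [^] (2 * R ^ 5 * q * i1 + (p' + t))) \<in> {0..<2 * R ^ 5} \<times> {0..<2 * R ^ 3} \<times> ?A" by simp
    then show "g \<in> (\<lambda>(i, j, x). b [^] i \<otimes> c [^] j \<otimes> x) ` ({0..<2 * R ^ 5} \<times> {0..<2 * R ^ 3} \<times> ?A)"
      unfolding gg by (rule image_eqI[rotated]) simp
  qed
  from card_le_of_cover[OF finA this] show ?thesis by (simp only: card_cyclic a_in)
qed

text \<open>In \<open>c_R3_mult\<close> the power of b is eliminated by \<open>star\<close>. The
  terms of order 2R^5 in the exponent of a combine to 4R^5 times an odd number, where 4 dividing R
  is used.\<close>

lemma c_pow_a_pow: "\<exists>p q. odd p \<and> odd q \<and> (\<forall>t. c [^] (2 * R ^ 4 * t * p) = a [^] (4 * R ^ 5 * t * q))"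
proof -
  let ?o = "u ^ 4 - 2 * k ^ 2 * u"
  obtain r2 where r2: "R = 4 * r2" using R4 by blast
  define q where "q = k ^ 2 * u ^ 3 + (u ^ 4 - R) * (R * k ^ 2 - 2 * k * u) * 2 * r2 - 2 * r2 * u ^ 2"
  have oq: "odd q" unfolding q_def using odd_k odd_u by simp
  have op: "odd (k * ?o)" using odd_k odd_u by simp
  have "c [^] (2 * R ^ 4 * t * (k * ?o)) = a [^] (4 * R ^ 5 * t * (- q))" for t
  proof -
    have "2 * R ^ 4 * t * (k * ?o) = 2 * R ^ 3 * k * (R * t * ?o)" by Groebner_Basis.algebra
    then have "c [^] (2 * R ^ 4 * t * (k * ?o)) = b [^] (2 * R ^ 4 * u' ^ 2 * (R * t * ?o)) \<otimes> a [^] (2 * R ^ 4 * u ^ 2 * (R * t * ?o))"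
      by (simp only: c_R3_mult)
    also have "2 * R ^ 4 * u' ^ 2 * (R * t * ?o) = 2 * R ^ 5 * ?o * (u' ^ 2 * t)" by Groebner_Basis.algebra
    also have "b [^] (2 * R ^ 5 * ?o * (u' ^ 2 * t)) = (b [^] (2 * R ^ 5 * ?o)) [^] (u' ^ 2 * t)" by (simp only: int_pow_pow b_in)
    also have "\<dots> = a [^] (2 * R ^ 5 * (R - u ^ 4) * (u' ^ 2 * t))" unfolding star by (simp only: int_pow_pow a_in)
    also have "a [^] (2 * R ^ 5 * (R - u ^ 4) * (u' ^ 2 * t)) \<otimes> a [^] (2 * R ^ 4 * u ^ 2 * (R * t * ?o))
       = a [^] (2 * R ^ 5 * (R - u ^ 4) * (u' ^ 2 * t) + 2 * R ^ 4 * u ^ 2 * (R * t * ?o))" by (simp only: int_pow_mult a_in)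
    finally have 1: "c [^] (2 * R ^ 4 * t * (k * ?o))
       = a [^] (2 * R ^ 5 * (R - u ^ 4) * (u' ^ 2 * t) + 2 * R ^ 4 * u ^ 2 * (R * t * ?o))" .
    have "2 * R ^ 5 * (R - u ^ 4) * (u' ^ 2 * t) + 2 * R ^ 4 * u ^ 2 * (R * t * ?o) = 4 * R ^ 5 * t * (- q)
      + (R - 4 * r2) * (2 * R ^ 5 * t * (u ^ 2 - (u ^ 4 - R) * (R * k ^ 2 - 2 * k * u)))"
      unfolding q_def u'_def by Groebner_Basis.algebra
    then have "2 * R ^ 5 * (R - u ^ 4) * (u' ^ 2 * t) + 2 * R ^ 4 * u ^ 2 * (R * t * ?o) = 4 * R ^ 5 * t * (- q)"
      using r2 by simp
    then show ?thesis using 1 by (simp only:)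
  qed
  then show ?thesis using op oq by (intro exI[of _ "k * ?o"] exI[of _ "- q"]) simp
qed

lemma c_pow_one_iff: "c [^] (2 * R ^ 4 * t) = \<one> \<longleftrightarrow> a [^] (4 * R ^ 5 * t) = \<one>"
proof -
  obtain p q where pq: "odd p" "odd q" "\<And>t. c [^] (2 * R ^ 4 * t * p) = a [^] (4 * R ^ 5 * t * q)"
    using c_pow_a_pow by blast
  show ?thesis
  proof
    assume "c [^] (2 * R ^ 4 * t) = \<one>"
    then have "c [^] (2 * R ^ 4 * t * p) = \<one>" by (rule pow_eq_one_dvd[OF c_in]) simp
    then have "a [^] (4 * R ^ 5 * t * q) = \<one>" unfolding pq(3) .
    then show "a [^] (4 * R ^ 5 * t) = \<one>" by (rule odd_cancel[OF a_in a_e pq(2)])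
  next
    assume "a [^] (4 * R ^ 5 * t) = \<one>"
    then have "a [^] (4 * R ^ 5 * t * q) = \<one>" by (rule pow_eq_one_dvd[OF a_in]) simp
    then have "c [^] (2 * R ^ 4 * t * p) = \<one>" unfolding pq(3) .
    then show "c [^] (2 * R ^ 4 * t) = \<one>" by (rule odd_cancel[OF c_in c_e pq(1)])
  qed
qed

end

section \<open>The nilpotency class\<close>

context group begin

definition comm :: "'a \<Rightarrow> 'a \<Rightarrow> 'a" where "comm x y = inv x \<otimes> inv y \<otimes> x \<otimes> y"

text \<open>For normal N, the preimage of the centre of G/N.\<close>

definition cen :: "'a set \<Rightarrow> 'a set" where
  "cen N = {g \<in> carrier G. \<forall>t\<in>carrier G. comm g t \<in> N}"

lemma comm_closed [simp]: "x \<in> carrier G \<Longrightarrow> y \<in> carrier G \<Longrightarrow> comm x y \<in> carrier G"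
  by (simp add: comm_def)

lemma comm_mult_left:
  "g \<in> carrier G \<Longrightarrow> h \<in> carrier G \<Longrightarrow> t \<in> carrier G \<Longrightarrow> comm (g \<otimes> h) t = cj (inv h) (comm g t) \<otimes> comm h t"
  by (simp add: comm_def cj_def inv_mult_group m_assoc cancel_inv)

lemma comm_mult_right:
  "g \<in> carrier G \<Longrightarrow> h \<in> carrier G \<Longrightarrow> t \<in> carrier G \<Longrightarrow> comm g (t \<otimes> h) = comm g h \<otimes> cj (inv h) (comm g t)"
  by (simp add: comm_def cj_def inv_mult_group m_assoc cancel_inv)

lemma comm_inv_left: "g \<in> carrier G \<Longrightarrow> t \<in> carrier G \<Longrightarrow> comm (inv g) t = cj g (inv (comm g t))"
  by (simp add: comm_def cj_def inv_mult_group m_assoc cancel_inv)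

lemma comm_inv_right: "g \<in> carrier G \<Longrightarrow> t \<in> carrier G \<Longrightarrow> comm g (inv t) = cj t (inv (comm g t))"
  by (simp add: comm_def cj_def inv_mult_group m_assoc cancel_inv)

lemma comm_conj: "g \<in> carrier G \<Longrightarrow> s \<in> carrier G \<Longrightarrow> cj s g = g \<otimes> comm g (inv s)"
  by (simp add: comm_def cj_def m_assoc cancel_inv)

lemma normal_cj: "N \<lhd> G \<Longrightarrow> t \<in> carrier G \<Longrightarrow> n \<in> N \<Longrightarrow> cj t n \<in> N"
  unfolding cj_def by (rule normal.inv_op_closed2)

lemma comm_normal:
  assumes N: "N \<lhd> G" and g: "g \<in> N" "t \<in> carrier G" shows "comm g t \<in> N"
proof -
  have s: "subgroup N G" using N by (rule normal_imp_subgroup)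
  have gc: "g \<in> carrier G" using subgroup.mem_carrier[OF s g(1)] .
  have "comm g t = inv g \<otimes> cj (inv t) g" using gc g(2) by (simp add: comm_def cj_def m_assoc)
  moreover have "cj (inv t) g \<in> N" using normal_cj[OF N _ g(1)] g(2) by simp
  ultimately show ?thesis using subgroup.m_closed[OF s subgroup.m_inv_closed[OF s g(1)]] by simp
qed

lemma cen_normal:
  assumes N: "N \<lhd> G" shows "cen N \<lhd> G"
proof -
  have s: "subgroup N G" using N by (rule normal_imp_subgroup)
  note m = subgroup.m_closed[OF s] and i = subgroup.m_inv_closed[OF s] and cjN = normal_cj[OF N]
  have mult: "g \<otimes> h \<in> cen N" if "g \<in> cen N" "h \<in> cen N" for g h
    using that unfolding cen_def by (auto simp: comm_mult_left intro!: m cjN)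
  have sub: "subgroup (cen N) G"
  proof (rule subgroupI)
    show "cen N \<subseteq> carrier G" by (auto simp: cen_def)
    have "\<one> \<in> cen N" using subgroup.one_closed[OF s] by (simp add: cen_def comm_def)
    then show "cen N \<noteq> {}" by blast
    show "inv g \<in> cen N" if "g \<in> cen N" for g
      using that unfolding cen_def by (auto simp: comm_inv_left intro!: cjN i)
  qed (rule mult)
  have "cj t g \<in> cen N" if gt: "g \<in> cen N" "t \<in> carrier G" for g t
  proof -
    have gc: "g \<in> carrier G" using gt by (simp add: cen_def)
    have "comm g (inv t) \<in> N" using gt by (simp add: cen_def)
    then have "comm g (inv t) \<in> cen N" using comm_normal[OF N] subgroup.mem_carrier[OF s] by (simp add: cen_def)
    then show ?thesis using mult[OF gt(1)] comm_conj[OF gc gt(2)] by simp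
  qed
  then show ?thesis unfolding normal_inv_iff using sub by (simp add: cj_def)
qed

lemma subset_cen:
  assumes N: "N \<lhd> G" shows "N \<subseteq> cen N"
proof
  fix x assume x: "x \<in> N"
  have "x \<in> carrier G" by (rule subgroup.mem_carrier[OF normal_imp_subgroup[OF N] x])
  then show "x \<in> cen N" unfolding cen_def using comm_normal[OF N x] by simp
qed

text \<open>Generators suffice as test elements: for fixed g the t with [g,t] in N form a
  subgroup.\<close>

lemma cen_I:
  assumes N: "N \<lhd> G" and gen: "carrier G = generate G S" "S \<subseteq> carrier G"
    and g: "g \<in> carrier G" and S: "\<And>t. t \<in> S \<Longrightarrow> comm g t \<in> N"
  shows "g \<in> cen N"
proof -
  have s: "subgroup N G" using N by (rule normal_imp_subgroup)
  note m = subgroup.m_closed[OF s] and i = subgroup.m_inv_closed[OF s] and cjN = normal_cj[OF N]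
  define T where "T = {t \<in> carrier G. comm g t \<in> N}"
  have "subgroup T G"
  proof (rule subgroupI)
    show "T \<subseteq> carrier G" by (auto simp: T_def)
    have "\<one> \<in> T" using subgroup.one_closed[OF s] g by (simp add: T_def comm_def)
    then show "T \<noteq> {}" by blast
    show "inv t \<in> T" if "t \<in> T" for t
      using that g unfolding T_def by (auto simp: comm_inv_right intro!: cjN i)
    show "x \<otimes> y \<in> T" if "x \<in> T" "y \<in> T" for x y
      using that g unfolding T_def by (auto simp: comm_mult_right intro!: m cjN)
  qed
  moreover have "S \<subseteq> T" using gen(2) S by (auto simp: T_def)
  ultimately have "carrier G \<subseteq> T" unfolding gen(1) by (intro generate_subgroup_incl)
  then show ?thesis using g by (auto simp: cen_def T_def)
qed

lemma lower_central_Suc: "lower_central G (Suc i) = generate G {comm x y | x y. x \<in> lower_central G i \<and> y \<in> carrier G}"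
  by (simp add: comm_def)

lemma lower_central_subset:
  assumes "\<And>i. i \<le> n \<Longrightarrow> U i \<lhd> G" "\<And>i. i < n \<Longrightarrow> U (Suc i) \<subseteq> cen (U i)" "U n = carrier G"
  shows "i \<le> n \<Longrightarrow> lower_central G i \<subseteq> U (n - i)"
proof (induction i)
  case 0 then show ?case using assms(3) by simp
next
  case (Suc i)
  then have IH: "lower_central G i \<subseteq> U (n - i)" by simp
  have ni: "n - i = Suc (n - Suc i)" "n - Suc i < n" using Suc.prems by simp_all
  have sub: "U (n - i) \<subseteq> cen (U (n - Suc i))" unfolding ni(1) by (rule assms(2)[OF ni(2)])
  have "{comm x y | x y. x \<in> lower_central G i \<and> y \<in> carrier G} \<subseteq> U (n - Suc i)"
    using IH sub by (auto simp: cen_def)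
  then show ?case unfolding lower_central_Suc
    using generate_subgroup_incl[OF _ normal_imp_subgroup[OF assms(1)[of "n - Suc i"]]] by simp
qed

lemma lower_central_one:
  assumes "lower_central G i = {\<one>}" shows "lower_central G (i + j) = {\<one>}"
proof (induction j)
  case 0 then show ?case using assms by simp
next
  case (Suc j)
  have "{comm x y | x y. x \<in> {\<one>} \<and> y \<in> carrier G} \<subseteq> {\<one>}" by (auto simp: comm_def)
  then have "generate G {comm x y | x y. x \<in> {\<one>} \<and> y \<in> carrier G} \<subseteq> {\<one>}"
    by (rule generate_subgroup_incl[OF _ triv_subgroup])
  moreover have "lower_central G (i + Suc j) = generate G {comm x y | x y. x \<in> {\<one>} \<and> y \<in> carrier G}"
    using Suc lower_central_Suc[of "i + j"] by simp
  ultimately show ?case using generate.one[of G] by blast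
qed

lemma nilpotency_class_eqI:
  assumes "lower_central G (Suc n) = {\<one>}" "lower_central G n \<noteq> {\<one>}"
  shows "nilpotency_class G = Suc n"
  unfolding nilpotency_class_def
proof (rule Least_equality)
  show "lower_central G (Suc n) = {\<one>}" by (rule assms(1))
  fix i assume i: "lower_central G i = {\<one>}"
  show "Suc n \<le> i"
  proof (rule ccontr)
    assume "\<not> Suc n \<le> i"
    then show False using lower_central_one[OF i, of "n - i"] assms(2) by simp
  qed
qed

end

context two_mac begin

lemma comm_a_b: "comm (a [^] int n) b = a [^] (- int n) \<otimes> c [^] int n \<otimes> a [^] geo \<alpha> n"
proof -
  have "comm (a [^] int n) b = inv (a [^] int n) \<otimes> cj (inv b) (a [^] int n)" by (simp add: comm_def cj_def m_assoc)
  then show ?thesis unfolding cj_b_a_nat by (simp add: int_pow_neg m_assoc)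
qed

lemma comm_c_a: "comm (c [^] int n) a = a [^] (1 - \<alpha> ^ n)"
proof -
  have "comm (c [^] int n) a = inv (c [^] int n) \<otimes> (a [^] (- 1 :: int) \<otimes> c [^] int n) \<otimes> a" by (simp add: comm_def int_pow_neg m_assoc)
  also have "\<dots> = a [^] (- (\<alpha> ^ n)) \<otimes> a" unfolding a_c by (simp add: cancel_inv m_assoc)
  also have "\<dots> = a [^] (- (\<alpha> ^ n) + 1)" by (simp only: int_pow_mult int_pow_1 a_in)
  finally show ?thesis by simp
qed

lemma comm_self: "x \<in> carrier G \<Longrightarrow> comm (x [^] (i::int)) x = \<one>"
  using pow_comm[of x "- i" "- 1"] by (simp add: comm_def int_pow_neg m_assoc)

lemma comm_rev: "x \<in> carrier G \<Longrightarrow> y \<in> carrier G \<Longrightarrow> comm y x = inv (comm x y)"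
  by (simp add: comm_def inv_mult_group m_assoc)

lemma power_diff_multiple:
  assumes z: "z = 1 + 2 * R ^ 2 * v" and n: "int n = 2 * R ^ 2 * j"
  shows "4 * R ^ 4 dvd z ^ n - 1"
proof -
  obtain p where "z ^ n - (1 + int n * (2 * R ^ 2 * v) + tri (int n - 1) * (4 * R ^ 4 * v ^ 2)) = 8 * R ^ 6 * p"
    using odd_power_expand(1)[OF z, of n] by (rule dvdE)
  then have p: "z ^ n - 1 = int n * (2 * R ^ 2 * v) + tri (int n - 1) * (4 * R ^ 4 * v ^ 2) + 8 * R ^ 6 * p" by simp
  have "z ^ n - 1 = 4 * R ^ 4 * (j * v + tri (int n - 1) * v ^ 2 + 2 * R ^ 2 * p)"
    unfolding p by (subst n) Groebner_Basis.algebra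
  then show ?thesis by (rule dvdI)
qed

text \<open>This difference is the exponent of a in [a^n, b]. The cases serve n = 2R^2 and n = 2R^4
  in the central series, and an even multiple of 2R^4 for the lower bound on the class.\<close>

lemma geo_diff_multiple:
  assumes z: "z = 1 + 2 * R ^ 2 * v" and n: "int n = 2 * R ^ i * j"
  shows "2 * R ^ 2 * R ^ min i 2 dvd geo z n - int n"
    and "i = 4 \<Longrightarrow> 2 * R ^ 5 dvd geo z n - int n"
    and "i = 4 \<Longrightarrow> even j \<Longrightarrow> 4 * R ^ 6 dvd geo z n - int n"
proof -
  obtain p where "geo z n - (int n + 2 * R ^ 2 * v * tri (int n) + 4 * R ^ 4 * v ^ 2 * tet (int n)) = 8 * R ^ 6 * p"
    using odd_power_expand(2)[OF z, of n] by (rule dvdE)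
  then have p: "geo z n - int n = 2 * R ^ 2 * v * tri (int n) + 4 * R ^ 4 * v ^ 2 * tet (int n) + 8 * R ^ 6 * p" by simp
  have tri: "tri (int n) = R ^ i * (j * (int n + 1))"
  proof (rule half_eq)
    show "2 * tri (int n) = 2 * (R ^ i * (j * (int n + 1)))" unfolding two_tri by (subst n) Groebner_Basis.algebra
  qed
  obtain i' where i': "i = min i 2 + i'" by (metis le_add_diff_inverse min.cobounded1)
  have "R ^ min i 2 dvd R ^ 2" by (rule le_imp_power_dvd) simp
  then obtain q where q: "R ^ 2 = R ^ min i 2 * q" by (rule dvdE)
  have "R ^ i = R ^ min i 2 * R ^ i'" using i' by (metis power_add)
  moreover have "4 * R ^ 4 * v ^ 2 * tet (int n) + 8 * R ^ 6 * p = 2 * R ^ 2 * R ^ 2 * (2 * v ^ 2 * tet (int n) + 4 * R ^ 2 * p)"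
    by Groebner_Basis.algebra
  ultimately have "geo z n - int n = 2 * R ^ 2 * R ^ min i 2 * (R ^ i' * v * (j * (int n + 1)) + q * (2 * v ^ 2 * tet (int n) + 4 * R ^ 2 * p))"
    unfolding p tri q by (simp add: algebra_simps)
  then show "2 * R ^ 2 * R ^ min i 2 dvd geo z n - int n" by (rule dvdI)
  assume i4: "i = 4"
  have n4: "int n = 2 * R ^ 4 * j" using n unfolding i4 .
  have "3 * tet (int n) = R ^ 4 * (j * ((int n - 1) * (int n + 1)))"
  proof (rule half_eq)
    have "2 * (3 * tet (int n)) = 6 * tet (int n)" by simp
    also have "\<dots> = int n * ((int n - 1) * (int n + 1))" unfolding six_tet by Groebner_Basis.algebra
    also have "\<dots> = 2 * (R ^ 4 * (j * ((int n - 1) * (int n + 1))))" by (subst (1) n4) Groebner_Basis.algebra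
    finally show "2 * (3 * tet (int n)) = 2 * (R ^ 4 * (j * ((int n - 1) * (int n + 1))))" .
  qed
  then have "R ^ 4 dvd 3 * tet (int n)" by (rule dvdI)
  then have "R ^ 4 dvd tet (int n)"
    using three_cancel_R[of 0 r 4 "tet (int n)"] unfolding R_def power_0 mult_1_left by blast
  then obtain t where t: "tet (int n) = R ^ 4 * t" by (rule dvdE)
  have e: "geo z n - int n = 2 * R ^ 6 * (v * j * (int n + 1)) + 4 * R ^ 6 * (R ^ 2 * v ^ 2 * t + 2 * p)"
    unfolding p tri t i4 by Groebner_Basis.algebra
  have "geo z n - int n = 2 * R ^ 5 * (R * (v * j * (int n + 1)) + 2 * R * (R ^ 2 * v ^ 2 * t + 2 * p))"
    unfolding e by Groebner_Basis.algebra
  then show "2 * R ^ 5 dvd geo z n - int n" by (rule dvdI)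
  assume "even j"
  then obtain j2 where j2: "j = 2 * j2" by (rule dvdE)
  have "geo z n - int n = 4 * R ^ 6 * (v * j2 * (int n + 1) + R ^ 2 * v ^ 2 * t + 2 * p)"
    unfolding e by (subst j2) Groebner_Basis.algebra
  then show "4 * R ^ 6 dvd geo z n - int n" by (rule dvdI)
qed

end

section \<open>The upper central series\<close>

context group begin

definition ucs :: "nat \<Rightarrow> 'a set" where "ucs i = (cen ^^ i) {\<one>}"

lemma ucs_Suc: "ucs (Suc i) = cen (ucs i)" by (simp add: ucs_def)

lemma ucs_normal: "ucs i \<lhd> G"
  by (induction i) (simp_all add: ucs_Suc cen_normal, simp add: ucs_def one_is_normal)

lemma ucs_subgroup: "subgroup (ucs i) G" by (rule normal_imp_subgroup[OF ucs_normal])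

lemmas ucs_mult = subgroup.m_closed[OF ucs_subgroup]
  and ucs_inv = subgroup.m_inv_closed[OF ucs_subgroup]
  and ucs_cj = normal_cj[OF ucs_normal]

lemma ucs_mono: "x \<in> ucs i \<Longrightarrow> x \<in> ucs (Suc i)"
  unfolding ucs_Suc using subset_cen[OF ucs_normal] by blast

lemma ucs_pow: "x \<in> ucs i \<Longrightarrow> x [^] (j::int) \<in> ucs i"
  by (rule subgroup_int_pow_closed[OF ucs_subgroup])

lemma comm_eq_one: "g \<in> carrier G \<Longrightarrow> t \<in> carrier G \<Longrightarrow> g \<otimes> t = t \<otimes> g \<Longrightarrow> comm g t = \<one>"
proof -
  assume g: "g \<in> carrier G" "t \<in> carrier G" "g \<otimes> t = t \<otimes> g"
  have "comm g t = inv g \<otimes> (inv t \<otimes> (g \<otimes> t))" using g by (simp add: comm_def m_assoc)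
  also have "\<dots> = \<one>" unfolding g(3) using g(1,2) by (simp add: cancel_inv)
  finally show ?thesis .
qed

end

context two_mac begin

lemma ucs_SucI: "g \<in> carrier G \<Longrightarrow> comm g a \<in> ucs i \<Longrightarrow> comm g b \<in> ucs i \<Longrightarrow> g \<in> ucs (Suc i)"
  unfolding ucs_Suc by (rule cen_I[OF ucs_normal gen]) auto

lemma ucs_one: "\<one> \<in> ucs i" by (rule subgroup.one_closed[OF ucs_subgroup])

lemma ucs_1I: "g \<in> carrier G \<Longrightarrow> g \<otimes> a = a \<otimes> g \<Longrightarrow> g \<otimes> b = b \<otimes> g \<Longrightarrow> g \<in> ucs (Suc 0)"
  by (rule ucs_SucI) (simp_all add: comm_eq_one ucs_one)

text \<open>First rung of a ladder: a^(2R^5) and c^(2R^4); a^(2R^4); c^(2R^2); a^(2R^2); c; a and b.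
  Each rung lies one term of the upper central series higher.\<close>

lemma ucs1: "a [^] (2 * R ^ 5 * i) \<in> ucs (Suc 0)" "c [^] (2 * R ^ 4 * i) \<in> ucs (Suc 0)"
  by (rule ucs_1I[OF _ a_central], simp) (rule ucs_1I[OF _ c_central], simp)

text \<open>Splits the commutator into a conjugate of c^n and a small power of a, each to be placed
  one term lower in the series.\<close>

lemma comm_a_b': "comm (a [^] int n) b = cj (a [^] (- int n)) (c [^] int n) \<otimes> a [^] (geo \<alpha> n - int n)"
proof -
  have "geo \<alpha> n = int n + (geo \<alpha> n - int n)" by simp
  then have "a [^] geo \<alpha> n = a [^] int n \<otimes> a [^] (geo \<alpha> n - int n)" by (metis int_pow_mult a_in)
  then show ?thesis unfolding comm_a_b by (simp add: cj_def m_assoc int_pow_neg)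
qed

lemma ucs2_gen: "a [^] (2 * R ^ 4) \<in> ucs (Suc (Suc 0))"
proof -
  define n where "n = nat (2 * R ^ 4)"
  have n: "int n = 2 * R ^ 4 * 1" using R_pos by (simp add: n_def)
  have cn: "c [^] int n \<in> ucs (Suc 0)" unfolding n by (rule ucs1)
  obtain g where g: "geo \<alpha> n - int n = 2 * R ^ 5 * g"
    using geo_diff_multiple(2)[OF \<alpha>_def n HOL.refl] by (rule dvdE)
  have "comm (a [^] int n) b = cj (a [^] (- int n)) (c [^] int n) \<otimes> a [^] (geo \<alpha> n - int n)"
    by (rule comm_a_b')
  also have "\<dots> \<in> ucs (Suc 0)" unfolding g by (intro ucs_mult ucs_cj cn ucs1) simp
  finally have "comm (a [^] int n) b \<in> ucs (Suc 0)" .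
  then have "a [^] int n \<in> ucs (Suc (Suc 0))" by (rule ucs_SucI[rotated 2]) (simp_all only: comm_self ucs_one a_in int_pow_closed)
  then show ?thesis using n by simp
qed

lemma ucs2: "a [^] (2 * R ^ 4 * i) \<in> ucs (Suc (Suc 0))"
  using ucs_pow[OF ucs2_gen, of i] by (simp only: int_pow_pow a_in)

lemma ucs2_b: "b [^] (2 * R ^ 4 * i) \<in> ucs (Suc (Suc 0))"
proof -
  interpret s: two_mac G b a "inv c" \<beta> \<alpha> L r R u' u "- k" by (rule swap_two)
  show ?thesis by (rule s.ucs2)
qed

lemma comm_c_b: "comm (c [^] int n) b = cj (c [^] (- int n)) (b [^] (\<beta> ^ n - 1))"
proof -
  have "comm (c [^] int n) b = inv (c [^] int n) \<otimes> inv b \<otimes> (c [^] int n \<otimes> b [^] (1::int))" by (simp add: comm_def m_assoc)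
  also have "\<dots> = inv (c [^] int n) \<otimes> (b [^] (- 1 :: int) \<otimes> b [^] (\<beta> ^ n)) \<otimes> c [^] int n"
    unfolding c_b by (simp add: m_assoc int_pow_neg)
  also have "b [^] (- 1 :: int) \<otimes> b [^] (\<beta> ^ n) = b [^] (- 1 + \<beta> ^ n)" by (simp only: int_pow_mult b_in)
  also have "- 1 + \<beta> ^ n = \<beta> ^ n - 1" by simp
  finally show ?thesis by (simp add: cj_def int_pow_neg)
qed

lemma ucs3: "c [^] (2 * R ^ 2) \<in> ucs (Suc (Suc (Suc 0)))"
proof -
  define n where "n = nat (2 * R ^ 2)"
  have n: "int n = 2 * R ^ 2 * 1" using R_pos by (simp add: n_def)
  obtain p where p: "\<alpha> ^ n - 1 = 4 * R ^ 4 * p" using power_diff_multiple[OF \<alpha>_def n] by (rule dvdE)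
  obtain q where q: "\<beta> ^ n - 1 = 4 * R ^ 4 * q" using power_diff_multiple[OF \<beta>_def n] by (rule dvdE)
  have "1 - \<alpha> ^ n = 2 * R ^ 4 * (- 2 * p)" using p by simp
  then have ca: "comm (c [^] int n) a \<in> ucs (Suc (Suc 0))" unfolding comm_c_a by (simp only: ucs2)
  have "\<beta> ^ n - 1 = 2 * R ^ 4 * (2 * q)" using q by simp
  then have cb: "comm (c [^] int n) b \<in> ucs (Suc (Suc 0))" unfolding comm_c_b by (simp only:) (intro ucs_cj ucs2_b, simp)
  have "c [^] int n \<in> ucs (Suc (Suc (Suc 0)))" by (rule ucs_SucI[OF _ ca cb]) simp
  then show ?thesis using n by simp
qed

lemma ucs4_gen: "a [^] (2 * R ^ 2) \<in> ucs (Suc (Suc (Suc (Suc 0))))"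
proof -
  define n where "n = nat (2 * R ^ 2)"
  have n: "int n = 2 * R ^ 2 * 1" using R_pos by (simp add: n_def)
  have cn: "c [^] int n \<in> ucs (Suc (Suc (Suc 0)))" unfolding n using ucs3 by simp
  have "2 * R ^ 2 * R ^ min 2 2 dvd geo \<alpha> n - int n" by (rule geo_diff_multiple(1)[OF \<alpha>_def n])
  moreover have "2 * R ^ 2 * R ^ min 2 2 = 2 * R ^ 4" by (simp add: eval_nat_numeral)
  ultimately obtain g where g: "geo \<alpha> n - int n = 2 * R ^ 4 * g" by (metis dvdE)
  have "comm (a [^] int n) b = cj (a [^] (- int n)) (c [^] int n) \<otimes> a [^] (geo \<alpha> n - int n)"
    by (rule comm_a_b')
  also have "\<dots> \<in> ucs (Suc (Suc (Suc 0)))" unfolding g by (intro ucs_mult ucs_cj cn ucs_mono[OF ucs2]) simp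
  finally have "comm (a [^] int n) b \<in> ucs (Suc (Suc (Suc 0)))" .
  then have "a [^] int n \<in> ucs (Suc (Suc (Suc (Suc 0))))" by (rule ucs_SucI[rotated 2]) (simp_all only: comm_self ucs_one a_in int_pow_closed)
  then show ?thesis using n by simp
qed

lemma ucs4: "a [^] (2 * R ^ 2 * i) \<in> ucs (Suc (Suc (Suc (Suc 0))))"
  using ucs_pow[OF ucs4_gen, of i] by (simp only: int_pow_pow a_in)

lemma ucs4_b: "b [^] (2 * R ^ 2 * i) \<in> ucs (Suc (Suc (Suc (Suc 0))))"
proof -
  interpret s: two_mac G b a "inv c" \<beta> \<alpha> L r R u' u "- k" by (rule swap_two)
  show ?thesis by (rule s.ucs4)
qed

lemma ucs5: "c \<in> ucs (Suc (Suc (Suc (Suc (Suc 0)))))"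
proof (rule ucs_SucI)
  have "comm c a = a [^] (1 - \<alpha>)" using comm_c_a[of 1] by simp
  also have "1 - \<alpha> = 2 * R ^ 2 * (- u)" by (simp add: \<alpha>_def)
  finally show "comm c a \<in> ucs (Suc (Suc (Suc (Suc 0))))" by (simp only: ucs4)
  have "comm c b = cj (c [^] (- int 1)) (b [^] (\<beta> - 1))" using comm_c_b[of 1] by simp
  also have "\<beta> - 1 = 2 * R ^ 2 * u'" by (simp add: \<beta>_def)
  finally show "comm c b \<in> ucs (Suc (Suc (Suc (Suc 0))))" by (simp only:) (intro ucs_cj ucs4_b, simp)
qed simp

lemma comm_ab: "comm a b = c" unfolding comm_def by (rule c_eq[symmetric])

lemma ucs6: "ucs 6 = carrier G"
proof -
  have "comm b a \<in> ucs (Suc (Suc (Suc (Suc (Suc 0)))))" using comm_rev[of a b] comm_ab ucs_inv[OF ucs5] by simp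
  then have "b \<in> ucs 6" using ucs_SucI[of b 5] comm_self[of b 1] ucs_one by (simp add: eval_nat_numeral)
  moreover have "a \<in> ucs 6" using ucs_SucI[of a 5] comm_self[of a 1] ucs_one ucs5 comm_ab by (simp add: eval_nat_numeral)
  ultimately have "generate G {a, b} \<subseteq> ucs 6" by (intro generate_subgroup_incl ucs_subgroup) simp
  then show ?thesis using gen subgroup.subset[OF ucs_subgroup] by blast
qed

lemma lower_central_6: "lower_central G (Suc 5) = {\<one>}"
proof -
  have six: "Suc 5 = (6::nat)" by simp
  have "lower_central G (Suc 5) \<subseteq> ucs (Suc 5 - Suc 5)"
  proof (rule lower_central_subset)
    show "ucs (Suc i) \<subseteq> cen (ucs i)" for i unfolding ucs_Suc ..
    show "ucs (Suc 5) = carrier G" unfolding six by (rule ucs6)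
  qed (rule ucs_normal, rule order_refl)
  moreover have "ucs (Suc 5 - Suc 5) = {\<one>}" unfolding ucs_def by (simp only: diff_self_eq_0 funpow_0)
  moreover have "\<one> \<in> lower_central G (Suc 5)" unfolding lower_central_Suc by (rule generate.one)
  ultimately show ?thesis by (simp only:) (rule subset_antisym, assumption, rule subsetI, simp only: singleton_iff)
qed

text \<open>The chain of commutators is c = [a,b], a^(1-\<open>\<alpha>\<close>) = [c,a], v =
  [a^n,b], a^(1-\<open>\<alpha>\<close>^n) = [v,a] and finally [a^n2,b] = c^n2, with n2 equal to
  4R^4 times an odd number. By \<open>c_pow_one_iff\<close> the last is trivial only if a^(8R^5)
  is.\<close>

lemma lower_central_5:
  assumes "a [^] (8 * R ^ 5) \<noteq> \<one>" shows "lower_central G 5 \<noteq> {\<one>}"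
proof -
  have step: "comm x y \<in> lower_central G (Suc i)" if "x \<in> lower_central G i" "y \<in> carrier G" for x y i
    unfolding lower_central_Suc by (rule generate.incl) (use that in blast)
  have c1: "c \<in> lower_central G (Suc 0)" using step[of a 0 b] comm_ab by simp
  obtain n where n: "2 ^ L dvd int n - (1 - \<alpha>)" by (rule nat_rep_L)
  have "comm c a = a [^] (1 - \<alpha>)" using comm_c_a[of 1] by simp
  also have "\<dots> = a [^] int n" by (rule a_eq[OF n, symmetric])
  finally have a2: "a [^] int n \<in> lower_central G (Suc (Suc 0))" using step[OF c1 a_in] by simp
  let ?v = "comm (a [^] int n) b"
  have v3: "?v \<in> lower_central G (Suc (Suc (Suc 0)))" by (rule step[OF a2 b_in])
  \<comment> \<open>The outer powers of a commute with a, so only c^n contributes to [v,a].\<close>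
  have "?v = a [^] (- int n) \<otimes> (c [^] int n \<otimes> a [^] geo \<alpha> n)" unfolding comm_a_b by (simp add: m_assoc)
  then have "comm ?v a = comm (c [^] int n \<otimes> a [^] geo \<alpha> n) a"
    by (simp add: comm_mult_left comm_self)
  also have "\<dots> = cj (inv (a [^] geo \<alpha> n)) (a [^] (1 - \<alpha> ^ n))"
    by (simp add: comm_mult_left comm_self comm_c_a)
  also have "\<dots> = a [^] (1 - \<alpha> ^ n)"
    by (subst cj_inv_eq_iff) (simp_all add: pow_comm)
  finally have v: "comm ?v a = a [^] (1 - \<alpha> ^ n)" .
  obtain n2 where n2: "2 ^ L dvd int n2 - (1 - \<alpha> ^ n)" by (rule nat_rep_L)
  have "comm ?v a = a [^] int n2" unfolding v by (rule a_eq[OF n2, symmetric])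
  then have a4: "a [^] int n2 \<in> lower_central G (Suc (Suc (Suc (Suc 0))))" using step[OF v3 a_in] by simp
  have c5: "comm (a [^] int n2) b \<in> lower_central G (Suc (Suc (Suc (Suc (Suc 0)))))" by (rule step[OF a4 b_in])
  obtain n' where n': "int n - (1 - \<alpha>) = 8 * R ^ 6 * n'" using dvd_trans[OF R6_dvd_L n] by (rule dvdE)
  define j where "j = 4 * R ^ 4 * n' - u"
  have "int n = (1 - \<alpha>) + 8 * R ^ 6 * n'" using n' by simp
  also have "\<dots> = 2 * R ^ 2 * j" unfolding \<alpha>_def j_def by Groebner_Basis.algebra
  finally have nj: "int n = 2 * R ^ 2 * j" .
  have oj: "odd j" using odd_u by (simp add: j_def)
  obtain p where "\<alpha> ^ n - (1 + int n * (2 * R ^ 2 * u) + tri (int n - 1) * (4 * R ^ 4 * u ^ 2)) = 8 * R ^ 6 * p"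
    using odd_power_expand(1)[OF \<alpha>_def, of n] by (rule dvdE)
  then have p: "\<alpha> ^ n = 1 + int n * (2 * R ^ 2 * u) + tri (int n - 1) * (4 * R ^ 4 * u ^ 2) + 8 * R ^ 6 * p" by simp
  have tri: "tri (int n - 1) = R ^ 2 * (j * (int n - 1))"
  proof (rule half_eq)
    show "2 * tri (int n - 1) = 2 * (R ^ 2 * (j * (int n - 1)))" unfolding two_tri unfolding nj by Groebner_Basis.algebra
  qed
  obtain n3 where n3: "int n2 - (1 - \<alpha> ^ n) = 8 * R ^ 6 * n3" using dvd_trans[OF R6_dvd_L n2] by (rule dvdE)
  define i where "i = 2 * R ^ 2 * n3 - j * u - R ^ 2 * (j * (int n - 1)) * u ^ 2 - 2 * R ^ 2 * p"
  have oi: "odd i" unfolding i_def using oj odd_u R_even by simp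
  have "int n2 = 1 - \<alpha> ^ n + 8 * R ^ 6 * n3" using n3 by simp
  also have "\<dots> = 2 * R ^ 4 * (2 * i)" unfolding p tri i_def unfolding nj by Groebner_Basis.algebra
  finally have n2i: "int n2 = 2 * R ^ 4 * (2 * i)" .
  have "comm (a [^] int n2) b = cj (a [^] (- int n2)) (c [^] int n2) \<otimes> a [^] (geo \<alpha> n2 - int n2)" by (rule comm_a_b')
  \<comment> \<open>The factor 2 in n2 = 2R^4 * 2i is what lifts this exponent to a multiple of
    4R^6.\<close>
  also have "a [^] (geo \<alpha> n2 - int n2) = \<one>"
    by (rule pow_eq_one_dvd[OF a_in a_R6]) (rule geo_diff_multiple(3)[OF \<alpha>_def n2i HOL.refl], simp)
  also have "cj (a [^] (- int n2)) (c [^] int n2) = c [^] int n2"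
  proof -
    have "cj a (c [^] int n2) = c [^] int n2" unfolding n2i by (subst cj_eq_iff) (simp_all only: c_central a_in c_in int_pow_closed)
    then show ?thesis by (rule cj_pow_id[OF a_in, rotated]) simp
  qed
  finally have "c [^] int n2 \<in> lower_central G 5" using c5 by (simp add: eval_nat_numeral)
  moreover have "c [^] int n2 \<noteq> \<one>"
  proof
    assume "c [^] int n2 = \<one>"
    then have "a [^] (4 * R ^ 5 * (2 * i)) = \<one>" unfolding n2i c_pow_one_iff .
    moreover have "4 * R ^ 5 * (2 * i) = 8 * R ^ 5 * i" by simp
    ultimately have "a [^] (8 * R ^ 5 * i) = \<one>" by simp
    then have "a [^] (8 * R ^ 5) = \<one>" by (rule odd_cancel[OF a_in a_e oi])
    then show False using assms by simp
  qed
  ultimately show ?thesis by blast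
qed

lemma class_6: "a [^] (8 * R ^ 5) \<noteq> \<one> \<Longrightarrow> nilpotency_class G = 6"
  using nilpotency_class_eqI[OF lower_central_6 lower_central_5] by simp

end

section \<open>Behaviour of the lower central series under homomorphisms\<close>

lemma lower_central_carrier:
  assumes "group G" shows "lower_central G i \<subseteq> carrier G"
proof (cases i)
  case (Suc j)
  interpret group G by (rule assms)
  have "{inv\<^bsub>G\<^esub> x \<otimes>\<^bsub>G\<^esub> inv\<^bsub>G\<^esub> y \<otimes>\<^bsub>G\<^esub> x \<otimes>\<^bsub>G\<^esub> y | x y. x \<in> lower_central G j \<and> y \<in> carrier G} \<subseteq> carrier G"
    if "lower_central G j \<subseteq> carrier G"
    using that by auto
  moreover have "lower_central G j \<subseteq> carrier G"
  proof (induction j)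
    case (Suc j)
    have "{inv\<^bsub>G\<^esub> x \<otimes>\<^bsub>G\<^esub> inv\<^bsub>G\<^esub> y \<otimes>\<^bsub>G\<^esub> x \<otimes>\<^bsub>G\<^esub> y | x y. x \<in> lower_central G j \<and> y \<in> carrier G} \<subseteq> carrier G"
      using Suc by auto
    then show ?case by (simp only: lower_central.simps) (rule generate_incl)
  qed simp
  ultimately show ?thesis unfolding Suc lower_central.simps by (intro generate_incl) blast
qed simp

lemma (in group_hom) lower_central_image:
  assumes "h ` carrier G = carrier H"
  shows "lower_central H i = h ` lower_central G i"
proof (induction i)
  case 0 then show ?case using assms by simp
next
  case (Suc i)
  let ?S = "{inv\<^bsub>G\<^esub> x \<otimes>\<^bsub>G\<^esub> inv\<^bsub>G\<^esub> y \<otimes>\<^bsub>G\<^esub> x \<otimes>\<^bsub>G\<^esub> y | x y. x \<in> lower_central G i \<and> y \<in> carrier G}"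
  let ?T = "{inv\<^bsub>H\<^esub> x \<otimes>\<^bsub>H\<^esub> inv\<^bsub>H\<^esub> y \<otimes>\<^bsub>H\<^esub> x \<otimes>\<^bsub>H\<^esub> y | x y. x \<in> lower_central H i \<and> y \<in> carrier H}"
  have lc: "\<And>x. x \<in> lower_central G i \<Longrightarrow> x \<in> carrier G" using lower_central_carrier[OF G.is_group] by blast
  have S: "?S \<subseteq> carrier G" using lc by auto
  have hx: "h (inv\<^bsub>G\<^esub> x \<otimes>\<^bsub>G\<^esub> inv\<^bsub>G\<^esub> y \<otimes>\<^bsub>G\<^esub> x \<otimes>\<^bsub>G\<^esub> y) = inv\<^bsub>H\<^esub> (h x) \<otimes>\<^bsub>H\<^esub> inv\<^bsub>H\<^esub> (h y) \<otimes>\<^bsub>H\<^esub> h x \<otimes>\<^bsub>H\<^esub> h y"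
    if "x \<in> carrier G" "y \<in> carrier G" for x y using that by simp
  have "?T = h ` ?S"
  proof (intro equalityI subsetI)
    fix z assume "z \<in> ?T"
    then obtain x y where xy: "x \<in> lower_central H i" "y \<in> carrier H"
      "z = inv\<^bsub>H\<^esub> x \<otimes>\<^bsub>H\<^esub> inv\<^bsub>H\<^esub> y \<otimes>\<^bsub>H\<^esub> x \<otimes>\<^bsub>H\<^esub> y" by blast
    obtain x' where x': "x' \<in> lower_central G i" "x = h x'" using xy(1) Suc by auto
    obtain y' where y': "y' \<in> carrier G" "y = h y'" using xy(2) assms by auto
    have "z = h (inv\<^bsub>G\<^esub> x' \<otimes>\<^bsub>G\<^esub> inv\<^bsub>G\<^esub> y' \<otimes>\<^bsub>G\<^esub> x' \<otimes>\<^bsub>G\<^esub> y')" unfolding xy(3) x'(2) y'(2) using hx[OF lc[OF x'(1)] y'(1)] by simp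
    then show "z \<in> h ` ?S" using x'(1) y'(1) by blast
  next
    fix z assume "z \<in> h ` ?S"
    then obtain x y where xy: "x \<in> lower_central G i" "y \<in> carrier G"
      "z = h (inv\<^bsub>G\<^esub> x \<otimes>\<^bsub>G\<^esub> inv\<^bsub>G\<^esub> y \<otimes>\<^bsub>G\<^esub> x \<otimes>\<^bsub>G\<^esub> y)" by blast
    have "h x \<in> lower_central H i" "h y \<in> carrier H" using xy Suc assms by auto
    then show "z \<in> ?T" using hx[OF lc[OF xy(1)] xy(2)] xy(3) by blast
  qed
  then show ?case using generate_img[OF S] by (simp only: lower_central.simps)
qed

lemma nilpotency_class_iso:
  assumes "group G" "group H" "h \<in> iso G H"
  shows "nilpotency_class G = nilpotency_class H"
proof -
  have hom: "h \<in> hom G H" and bij: "bij_betw h (carrier G) (carrier H)" using assms(3) by (auto simp: iso_def)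
  interpret group_hom G H h using assms(1,2) hom by (simp add: group_hom_def group_hom_axioms_def)
  have img: "h ` carrier G = carrier H" using bij by (simp add: bij_betw_def)
  have "lower_central G i = {\<one>\<^bsub>G\<^esub>} \<longleftrightarrow> lower_central H i = {\<one>\<^bsub>H\<^esub>}" for i
  proof
    assume "lower_central G i = {\<one>\<^bsub>G\<^esub>}"
    then show "lower_central H i = {\<one>\<^bsub>H\<^esub>}" unfolding lower_central_image[OF img] by simp
  next
    assume "lower_central H i = {\<one>\<^bsub>H\<^esub>}"
    then have "h ` lower_central G i = h ` {\<one>\<^bsub>G\<^esub>}" unfolding lower_central_image[OF img] by simp
    moreover have "h ` lower_central G i = h ` {\<one>\<^bsub>G\<^esub>} \<longleftrightarrow> lower_central G i = {\<one>\<^bsub>G\<^esub>}"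
      by (rule inj_on_image_eq_iff[OF _ lower_central_carrier[OF assms(1)]])
        (use bij in \<open>simp_all add: bij_betw_def\<close>)
    ultimately show "lower_central G i = {\<one>\<^bsub>G\<^esub>}" by blast
  qed
  then show ?thesis unfolding nilpotency_class_def by simp
qed

section \<open>The 2-part of an element\<close>

context group begin

text \<open>The 2-part is g^j with j congruent to 1 modulo 2^n and to 0 modulo t, obtained from
  Bezout. Any candidate in \<open>two_part_def\<close> satisfies the same two congruences, which
  gives uniqueness.\<close>

lemma ord_two_part:
  assumes g: "g \<in> carrier G" and o: "ord g = 2 ^ n * t" and t: "odd t"
  shows "ord (two_part G g) = 2 ^ n"
proof -
  have cop: "coprime (2 ^ n) (int t)" using t by simp
  obtain x y where xy: "x * 2 ^ n + y * int t = 1"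
    using bezout_int[of "2 ^ n" "int t"] cop by (metis coprime_iff_gcd_eq_1)
  have t0: "t > 0" using t by (cases t) auto
  define j where "j = nat ((y * int t) mod (2 ^ n * int t))"
  have jj: "int j = (y * int t) mod (2 ^ n * int t)" unfolding j_def using t0 by simp
  have jm: "2 ^ n * int t dvd int j - y * int t" unfolding jj
    by (metis dvd_minus_iff dvd_minus_mod minus_diff_eq)
  have jt: "int t dvd int j"
  proof -
    have "int t dvd (int j - y * int t) + y * int t"
      by (rule dvd_add) (use jm dvd_mult_right in blast, simp)
    then show ?thesis by simp
  qed
  have j2: "2 ^ n dvd int j - 1"
  proof -
    have "2 ^ n dvd (int j - y * int t) - x * 2 ^ n"
      by (rule dvd_diff) (use jm dvd_mult_left in blast, simp)
    moreover have "(int j - y * int t) - x * 2 ^ n = int j - 1" using xy by simp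
    ultimately show ?thesis by simp
  qed
  have io: "int (ord g) = 2 ^ n * int t" using o by simp
  define p where "p = g [^] j"
  have pi: "p [^] (i::int) = \<one> \<longleftrightarrow> 2 ^ n * int t dvd int j * i" for i
  proof -
    have "p [^] i = g [^] (int j * i)" unfolding p_def using g by (simp add: int_pow_int[symmetric] int_pow_pow)
    then show ?thesis using int_pow_eq_id[OF g, of "int j * i"] unfolding io by simp
  qed
  have p_in: "p \<in> carrier G" by (simp add: p_def g)
  have pord: "ord p = 2 ^ n"
  proof -
    have "p [^] ((2::int) ^ n) = \<one>" unfolding pi using jt by (simp add: mult.commute)
    then have "int (ord p) dvd 2 ^ n" using int_pow_eq_id[OF p_in] by blast
    moreover have "2 ^ n dvd int (ord p)"
    proof -
      have "p [^] int (ord p) = \<one>" using p_in by (simp add: int_pow_int)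
      then have "2 ^ n * int t dvd int j * int (ord p)" unfolding pi .
      then have "2 ^ n dvd int j * int (ord p)" using dvd_mult_left by blast
      moreover have "coprime (2 ^ n) (int j)"
      proof (cases "n = 0")
        case False
        then have "even (int j - 1)" using j2 by (meson dvd_power dvd_trans neq0_conv)
        then show ?thesis by simp
      qed simp
      ultimately show ?thesis using coprime_dvd_mult_right_iff by blast
    qed
    ultimately have "int (ord p) = 2 ^ n" by (metis abs_of_nat abs_power_minus abs_numeral zdvd_antisym_abs power_abs)
    then show ?thesis by (metis of_nat_eq_iff of_nat_numeral of_nat_power)
  qed
  have odd_ord: "odd (ord (g \<otimes> inv p))"
  proof -
    have e: "g \<otimes> inv p = g [^] (1 - int j)" unfolding p_def using g by (simp add: int_pow_diff int_pow_int)
    have "(g [^] (1 - int j)) [^] int t = g [^] ((1 - int j) * int t)" using g by (simp add: int_pow_pow)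
    also have "\<dots> = \<one>" unfolding int_pow_eq_id[OF g] io
    proof (rule mult_dvd_mono)
      show "2 ^ n dvd 1 - int j" using j2 by (metis dvd_minus_iff minus_diff_eq)
    qed simp
    finally have "(g \<otimes> inv p) [^] int t = \<one>" unfolding e .
    then have "int (ord (g \<otimes> inv p)) dvd int t" using int_pow_eq_id[of "g \<otimes> inv p"] g p_in by simp
    then have "ord (g \<otimes> inv p) dvd t" by simp
    then show ?thesis using t dvd_trans by blast
  qed
  have "two_part G g = p" unfolding two_part_def
  proof (rule the_equality)
    show "p \<in> carrier G \<and> (\<exists>n::nat. p = g [^] n) \<and> (\<exists>k. ord p = 2 ^ k) \<and> odd (ord (g \<otimes> inv p))"
      using p_in pord odd_ord unfolding p_def by blast
  next
    fix p' assume "p' \<in> carrier G \<and> (\<exists>n::nat. p' = g [^] n) \<and> (\<exists>k. ord p' = 2 ^ k) \<and> odd (ord (g \<otimes> inv p'))"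
    then obtain j' k :: nat where p': "p' = g [^] j'" "ord p' = 2 ^ k" "odd (ord (g \<otimes> inv p'))" "p' \<in> carrier G" by blast
    have "p' [^] int (ord p') = \<one>" using p'(4) by (simp add: int_pow_int)
    then have "g [^] (int j' * 2 ^ k) = \<one>" using p'(1,2) g by (simp add: int_pow_int[symmetric] int_pow_pow)
    then have "2 ^ n * int t dvd int j' * 2 ^ k" unfolding int_pow_eq_id[OF g] io .
    then have "int t dvd int j' * 2 ^ k" using dvd_mult_right by blast
    moreover have "coprime (int t) (2 ^ k)" using t by simp
    ultimately have t': "int t dvd int j'" using coprime_dvd_mult_left_iff by blast
    have e: "g \<otimes> inv p' = g [^] (1 - int j')" unfolding p'(1) using g by (simp add: int_pow_diff int_pow_int)
    have "(g \<otimes> inv p') [^] int (ord (g \<otimes> inv p')) = \<one>" using g p'(4) by (simp add: int_pow_int)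
    then have "g [^] ((1 - int j') * int (ord (g \<otimes> inv p'))) = \<one>" unfolding e using g by (simp add: int_pow_pow)
    then have "2 ^ n * int t dvd (1 - int j') * int (ord (g \<otimes> inv p'))" unfolding int_pow_eq_id[OF g] io .
    then have "2 ^ n dvd (1 - int j') * int (ord (g \<otimes> inv p'))" using dvd_mult_left by blast
    moreover have "coprime (2 ^ n) (int (ord (g \<otimes> inv p')))" using p'(3) by simp
    ultimately have n': "2 ^ n dvd 1 - int j'" using coprime_dvd_mult_left_iff by blast
    have "2 ^ n dvd (1 - int j') + (int j - 1)" by (rule dvd_add[OF n' j2])
    then have 1: "2 ^ n dvd int j - int j'" by simp
    have 2: "int t dvd int j - int j'" by (rule dvd_diff[OF jt t'])
    have "2 ^ n * int t dvd int j - int j'" by (rule divides_mult[OF 1 2 cop])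
    then have "g [^] int j' = g [^] int j" unfolding int_pow_eq[OF g] io .
    then show "p' = p" unfolding p'(1) p_def by (simp add: int_pow_int)
  qed
  then show ?thesis using pord by simp
qed

end

section \<open>Transfer to the Sylow subgroup\<close>

context word_model begin

text \<open>The left side is the number of normal forms, which constitute one orbit of the
  group.\<close>

lemma card_dvd_order:
  assumes fin: "finite (carrier (Gab \<alpha> \<beta>))"
  shows "nat Q * (nat E * nat Q) dvd order (Gab \<alpha> \<beta>)"
proof -
  let ?R = "relators \<alpha> \<beta>"
  interpret P: group "Gab \<alpha> \<beta>" unfolding Gab_def by (rule group_presented)
  \<comment> \<open>The chosen word is immaterial, because equivalent words act equally up to normal
    form.\<close>
  define \<phi> where "\<phi> g = nf (acts (SOME w. word_class ?R w = g) (0, 0, 0))" for g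
  have \<phi>: "\<phi> (word_class ?R w) = nf (acts w (0, 0, 0))" for w
  proof -
    have "word_class ?R (SOME w'. word_class ?R w' = word_class ?R w) = word_class ?R w" by (rule someI) (rule HOL.refl)
    then have "acts (SOME w'. word_class ?R w' = word_class ?R w) (0, 0, 0) \<doteq> acts w (0, 0, 0)"
      unfolding word_class_eq_iff by (rule acts_word_eq)
    then show ?thesis unfolding \<phi>_def eqv_def .
  qed
  have car: "carrier (Gab \<alpha> \<beta>) = range (word_class ?R)" unfolding Gab_def by (rule carrier_presented)
  have "card (\<phi> ` carrier (Gab \<alpha> \<beta>)) dvd order (Gab \<alpha> \<beta>)"
  proof (rule P.card_fibres_dvd_order[OF fin])
    fix g g' h assume "g \<in> carrier (Gab \<alpha> \<beta>)" "g' \<in> carrier (Gab \<alpha> \<beta>)" "h \<in> carrier (Gab \<alpha> \<beta>)" and eq: "\<phi> g = \<phi> g'"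
    then obtain v v' w where vw: "g = word_class ?R v" "g' = word_class ?R v'" "h = word_class ?R w" unfolding car by blast
    have "acts v (0, 0, 0) \<doteq> acts v' (0, 0, 0)" using eq unfolding vw \<phi> eqv_def .
    then have "acts w (acts v (0, 0, 0)) \<doteq> acts w (acts v' (0, 0, 0))" by (rule acts_cong)
    then show "\<phi> (g \<otimes>\<^bsub>Gab \<alpha> \<beta>\<^esub> h) = \<phi> (g' \<otimes>\<^bsub>Gab \<alpha> \<beta>\<^esub> h)"
      unfolding vw Gab_def presented_mult \<phi> acts_append eqv_def .
  qed
  moreover have "\<phi> ` carrier (Gab \<alpha> \<beta>) = {0..<Q} \<times> {0..<E} \<times> {0..<Q}"
  proof (intro equalityI subsetI)
    fix z assume "z \<in> \<phi> ` carrier (Gab \<alpha> \<beta>)"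
    then obtain w where "z = nf (acts w (0, 0, 0))" unfolding car image_image \<phi> by blast
    then show "z \<in> {0..<Q} \<times> {0..<E} \<times> {0..<Q}" using nf_range by simp
  next
    fix z assume "z \<in> {0..<Q} \<times> {0..<E} \<times> {0..<Q}"
    then obtain j i n where z: "z = (j, i, n)" "0 \<le> j" "j < Q" "0 \<le> i" "i < E" "0 \<le> n" "n < Q" by auto
    obtain w where "acts w (0, 0, 0) \<doteq> (int (nat j), int (nat i), int (nat n))" using reachable by blast
    then have "nf (acts w (0, 0, 0)) = nf (j, i, n)" using z unfolding eqv_def by simp
    also have "\<dots> = z" using nf_nf[of j i n] z by simp
    finally have "z = \<phi> (word_class ?R w)" unfolding \<phi> by simp
    then show "z \<in> \<phi> ` carrier (Gab \<alpha> \<beta>)" unfolding car by blast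
  qed
  ultimately show ?thesis by (simp add: card_cartesian_product)
qed

end

lemma macd_Gab:
  fixes \<alpha> \<beta> :: int
  defines "G \<equiv> Gab \<alpha> \<beta>" and "A \<equiv> word_class (relators \<alpha> \<beta>) wA" and "B \<equiv> word_class (relators \<alpha> \<beta>) wB"
  defines "C \<equiv> inv\<^bsub>G\<^esub> A \<otimes>\<^bsub>G\<^esub> inv\<^bsub>G\<^esub> B \<otimes>\<^bsub>G\<^esub> A \<otimes>\<^bsub>G\<^esub> B"
  shows "macd G A B C \<alpha> \<beta>" and "carrier G = generate G {A, B}"
proof -
  let ?R = "relators \<alpha> \<beta>"
  have G: "G = presented ?R" by (simp add: G_def Gab_def)
  interpret group G unfolding G by (rule group_presented)
  have car: "carrier G = range (word_class ?R)" unfolding G by (rule carrier_presented)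
  have mem [simp]: "word_class ?R w \<in> carrier G" for w unfolding car by blast
  have mult: "word_class ?R v \<otimes>\<^bsub>G\<^esub> word_class ?R w = word_class ?R (v @ w)" for v w unfolding G by (rule presented_mult)
  have inv: "inv\<^bsub>G\<^esub> word_class ?R w = word_class ?R (winv w)" for w unfolding G by (rule inv_word_class)
  have pow: "word_class ?R w [^]\<^bsub>G\<^esub> (n::int) = word_class ?R (wpow w n)" for w n unfolding G by (rule int_pow_word_class)
  have C: "C = word_class ?R wC" unfolding C_def A_def B_def inv mult wC_def by simp
  have [simp]: "A \<in> carrier G" "B \<in> carrier G" "C \<in> carrier G" unfolding A_def B_def C by simp_all
  have "word_class ?R (winv wC @ wA @ wC @ wpow wA (- \<alpha>)) = \<one>\<^bsub>G\<^esub>"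
    unfolding G by (rule relator_word_class) (simp add: relators_def)
  then have r1: "inv\<^bsub>G\<^esub> C \<otimes>\<^bsub>G\<^esub> (A \<otimes>\<^bsub>G\<^esub> (C \<otimes>\<^bsub>G\<^esub> A [^]\<^bsub>G\<^esub> (- \<alpha>))) = \<one>\<^bsub>G\<^esub>"
    unfolding C A_def inv mult pow .
  have "word_class ?R (wC @ wB @ winv wC @ wpow wB (- \<beta>)) = \<one>\<^bsub>G\<^esub>"
    unfolding G by (rule relator_word_class) (simp add: relators_def)
  then have r2: "C \<otimes>\<^bsub>G\<^esub> (B \<otimes>\<^bsub>G\<^esub> (inv\<^bsub>G\<^esub> C \<otimes>\<^bsub>G\<^esub> B [^]\<^bsub>G\<^esub> (- \<beta>))) = \<one>\<^bsub>G\<^esub>"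
    unfolding C B_def inv mult pow .
  show "macd G A B C \<alpha> \<beta>"
  proof unfold_locales
    show "A \<otimes>\<^bsub>G\<^esub> B = B \<otimes>\<^bsub>G\<^esub> A \<otimes>\<^bsub>G\<^esub> C" unfolding C_def by (simp add: m_assoc cancel_inv)
    have "cj (inv\<^bsub>G\<^esub> C) A \<otimes>\<^bsub>G\<^esub> inv\<^bsub>G\<^esub> (A [^]\<^bsub>G\<^esub> \<alpha>) = \<one>\<^bsub>G\<^esub>"
      using r1 by (simp add: cj_def m_assoc int_pow_neg)
    then have "cj (inv\<^bsub>G\<^esub> C) A = A [^]\<^bsub>G\<^esub> \<alpha>" using inv_equality[of "cj (inv\<^bsub>G\<^esub> C) A" "inv\<^bsub>G\<^esub> (A [^]\<^bsub>G\<^esub> \<alpha>)"] by simp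
    then show "A \<otimes>\<^bsub>G\<^esub> C = C \<otimes>\<^bsub>G\<^esub> A [^]\<^bsub>G\<^esub> \<alpha>" by (simp add: cj_inv_eq_iff)
    have "cj C B \<otimes>\<^bsub>G\<^esub> inv\<^bsub>G\<^esub> (B [^]\<^bsub>G\<^esub> \<beta>) = \<one>\<^bsub>G\<^esub>"
      using r2 by (simp add: cj_def m_assoc int_pow_neg)
    then have "cj C B = B [^]\<^bsub>G\<^esub> \<beta>" using inv_equality[of "cj C B" "inv\<^bsub>G\<^esub> (B [^]\<^bsub>G\<^esub> \<beta>)"] by simp
    then show "C \<otimes>\<^bsub>G\<^esub> B = B [^]\<^bsub>G\<^esub> \<beta> \<otimes>\<^bsub>G\<^esub> C" by (simp add: cj_eq_iff)
  qed simp_all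
  show "carrier G = generate G {A, B}"
  proof
    have "word_class ?R w \<in> generate G {A, B}" for w
      unfolding A_def B_def G by (rule word_class_generate)
    then show "carrier G \<subseteq> generate G {A, B}" unfolding car by blast
    show "generate G {A, B} \<subseteq> carrier G" by (rule generate_incl) simp
  qed
qed

context group begin

lemma subgroup_pow_card:
  assumes N: "subgroup N G" and x: "x \<in> N" shows "x [^] card N = \<one>"
proof -
  interpret N: group "G\<lparr>carrier := N\<rparr>" by (rule subgroup.subgroup_is_group[OF N group_axioms])
  have "x [^]\<^bsub>G\<lparr>carrier := N\<rparr>\<^esub> order (G\<lparr>carrier := N\<rparr>) = \<one>\<^bsub>G\<lparr>carrier := N\<rparr>\<^esub>"
    by (rule N.pow_order_eq_1) (simp add: x)
  then show ?thesis by (simp add: order_def nat_pow_consistent[symmetric])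
qed

text \<open>Dividing by a normal subgroup of odd order can only remove odd factors from the order of
  an element.\<close>

lemma ord_quotient:
  assumes N: "N \<lhd> G" and odd: "odd (card N)" and g: "g \<in> carrier G"
    and o: "group.ord (G Mod N) (N #> g) = 2 ^ n"
  shows "\<exists>t. ord g = 2 ^ n * t \<and> odd t"
proof -
  interpret normal N G by (rule N)
  interpret H: group "G Mod N" by (rule factorgroup_is_group)
  have s: "subgroup N G" by (rule normal_imp_subgroup[OF N])
  have c: "N #> g \<in> carrier (G Mod N)" using g by (auto simp: carrier_FactGroup)
  have pow: "(N #> g) [^]\<^bsub>G Mod N\<^esub> i = N #> (g [^] i)" for i :: nat
    using FactGroup_pow[OF g] by blast
  have "(N #> g) [^]\<^bsub>G Mod N\<^esub> ((2::nat) ^ n) = \<one>\<^bsub>G Mod N\<^esub>" using H.pow_ord_eq_1[OF c] unfolding o .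
  then have "N #> (g [^] ((2::nat) ^ n)) = N" unfolding pow by simp
  then have "g [^] ((2::nat) ^ n) \<in> N" by (rule coset_join1[OF _ _ s]) (use g in simp)
  then have "(g [^] ((2::nat) ^ n)) [^] card N = \<one>" by (rule subgroup_pow_card[OF s])
  then have "g [^] (2 ^ n * card N) = \<one>" using g by (simp add: nat_pow_pow)
  then have d1: "ord g dvd 2 ^ n * card N" using g pow_eq_id by blast
  have "(N #> g) [^]\<^bsub>G Mod N\<^esub> ord g = N #> \<one>" unfolding pow using g by simp
  also have "\<dots> = \<one>\<^bsub>G Mod N\<^esub>" using coset_mult_one[OF subgroup.subset[OF s]] by simp
  finally have "2 ^ n dvd ord g" using H.pow_eq_id[OF c] unfolding o by blast
  then obtain t where t: "ord g = 2 ^ n * t" by (rule dvdE)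
  then have "t dvd card N" using d1 by simp
  then have "odd t" using odd dvd_trans by blast
  then show ?thesis using t by blast
qed

text \<open>P meets N trivially since their orders are coprime, and equal cardinality makes the
  resulting injection surjective.\<close>

lemma sylow_quotient_iso:
  assumes fin: "finite (carrier G)" and N: "N \<lhd> G" and odd: "odd (card N)"
    and P: "subgroup P G" "card P = 2 ^ K" and Q: "card (carrier (G Mod N)) = 2 ^ K"
  shows "(\<lambda>x. N #> x) \<in> iso (G\<lparr>carrier := P\<rparr>) (G Mod N)"
proof -
  interpret normal N G by (rule N)
  have s: "subgroup N G" by (rule normal_imp_subgroup[OF N])
  note Pc = subgroup.mem_carrier[OF P(1)]
  have hom: "(\<lambda>x. N #> x) \<in> hom (G\<lparr>carrier := P\<rparr>) (G Mod N)"
    using r_coset_hom_Mod Pc unfolding hom_def by (simp add: Pi_def)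
  have triv: "x = \<one>" if x: "x \<in> P" "x \<in> N" for x
  proof -
    have xc: "x \<in> carrier G" by (rule Pc[OF x(1)])
    have "x [^] card P = \<one>" "x [^] card N = \<one>" using subgroup_pow_card[OF P(1) x(1)] subgroup_pow_card[OF s x(2)] .
    then have "ord x dvd 2 ^ K" "ord x dvd card N" using pow_eq_id[OF xc] unfolding P(2) by blast+
    moreover have "coprime (2 ^ K) (card N)" using odd by simp
    ultimately have "ord x = 1" by (metis coprime_common_divisor_nat nat_dvd_1_iff_1 One_nat_def)
    then show ?thesis using ord_eq_1[OF xc] by simp
  qed
  have inj: "inj_on (\<lambda>x. N #> x) P"
  proof (rule inj_onI)
    fix x y assume xy: "x \<in> P" "y \<in> P" "N #> x = N #> y"
    have xc: "x \<in> carrier G" "y \<in> carrier G" using Pc xy by blast+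
    have "x \<in> N #> y" using rcos_self[OF xc(1) s] xy(3) by simp
    then have "x \<otimes> inv y \<in> N" using subgroup.rcos_module[OF s group_axioms xc(2,1)] by simp
    moreover have "x \<otimes> inv y \<in> P" by (rule subgroup.m_closed[OF P(1) xy(1) subgroup.m_inv_closed[OF P(1) xy(2)]])
    ultimately have "x \<otimes> inv y = \<one>" using triv by simp
    then have "x \<otimes> inv y \<otimes> y = y" using xc by simp
    then show "x = y" using xc by (simp add: m_assoc)
  qed
  have "(\<lambda>x. N #> x) ` P \<subseteq> carrier (G Mod N)" using Pc by (auto simp: carrier_FactGroup)
  moreover have "finite (carrier (G Mod N))" using fin by (simp add: carrier_FactGroup)
  moreover have "card ((\<lambda>x. N #> x) ` P) = card (carrier (G Mod N))" using card_image[OF inj] P(2) Q by simp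
  ultimately have "(\<lambda>x. N #> x) ` P = carrier (G Mod N)" by (intro card_subset_eq)
  then show ?thesis using hom inj by (simp add: iso_def bij_betw_def)
qed

end

context macd_fin begin

text \<open>The 2^K-th power of any element has order dividing t, so all three factors in
  \<open>card_BCA_dvd\<close> are odd.\<close>

lemma odd_card_BCA:
  assumes "odd \<alpha>" "odd \<beta>" and o: "order G = 2 ^ K * t" "odd t"
  shows "odd (card (BCA (2 ^ K)))"
proof -
  have "odd (ord (x [^] int (2 ^ K)))" if x: "x \<in> carrier G" for x
  proof -
    have "(x [^] int (2 ^ K)) [^] t = x [^] order G" using x unfolding o int_pow_int by (simp add: nat_pow_pow)
    then have "(x [^] int (2 ^ K)) [^] t = \<one>" using pow_order_eq_1[OF x] by simp
    then have "ord (x [^] int (2 ^ K)) dvd t" using pow_eq_id x by blast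
    then show ?thesis using o(2) dvd_trans by blast
  qed
  then have "odd (ord (b [^] int (2 ^ K)) * ord (c [^] int (2 ^ K)) * ord (a [^] int (2 ^ K)))" by simp
  then show ?thesis using card_BCA_dvd[OF good_power2[OF assms(1,2)], of K] dvd_trans by blast
qed

text \<open>In the quotient the 2^L-th powers of the generators vanish, so the exponents matter only
  modulo 2^L. The freedom in \<open>\<alpha>'\<close> and \<open>\<beta>'\<close> is used to make
  them positive.\<close>

lemma quotient_macd_fin:
  fixes K L :: nat and \<alpha>' \<beta>' :: int
  defines "N \<equiv> BCA (2 ^ K)"
  assumes "odd \<alpha>" "odd \<beta>" "K \<le> L" "2 ^ L dvd \<alpha>' - \<alpha>" "2 ^ L dvd \<beta>' - \<beta>"
  shows "macd_fin (G Mod N) (N #> a) (N #> b) (N #> c) \<alpha>' \<beta>' (2 ^ L)"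
proof -
  have N: "N \<lhd> G" unfolding N_def by (rule BCA_normal[OF good_power2[OF assms(2,3)]])
  have ba: "b \<otimes> a \<in> carrier G" by simp
  interpret normal N G by (rule N)
  interpret H: group "G Mod N" by (rule factorgroup_is_group)
  let ?h = "\<lambda>x. N #> x"
  interpret h: group_hom G "G Mod N" ?h using r_coset_hom_Mod by unfold_locales
  have s: "subgroup N G" by (rule normal_imp_subgroup[OF N])
  have dv: "int (2 ^ K) dvd 2 ^ L" using assms(4) by (simp add: le_imp_power_dvd)
  have tor: "?h x [^]\<^bsub>G Mod N\<^esub> ((2::int) ^ L) = \<one>\<^bsub>G Mod N\<^esub>" if "x \<in> carrier G" "x [^] ((2::int) ^ L) \<in> N" for x
    using h.hom_int_pow[OF that(1), of "2 ^ L"] coset_join2[OF _ s that(2)] that(1) by simp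
  have ta: "?h a [^]\<^bsub>G Mod N\<^esub> ((2::int) ^ L) = \<one>\<^bsub>G Mod N\<^esub>" "?h b [^]\<^bsub>G Mod N\<^esub> ((2::int) ^ L) = \<one>\<^bsub>G Mod N\<^esub>"
    "?h c [^]\<^bsub>G Mod N\<^esub> ((2::int) ^ L) = \<one>\<^bsub>G Mod N\<^esub>"
    using BCA_gens[OF dv] by (simp_all only: tor a_in b_in c_in N_def[symmetric])
  have A: "?h a [^]\<^bsub>G Mod N\<^esub> \<alpha>' = ?h a [^]\<^bsub>G Mod N\<^esub> \<alpha>" by (rule H.pow_eqI[OF _ ta(1) assms(5)]) (rule h.hom_closed, simp)
  have B: "?h b [^]\<^bsub>G Mod N\<^esub> \<beta>' = ?h b [^]\<^bsub>G Mod N\<^esub> \<beta>" by (rule H.pow_eqI[OF _ ta(2) assms(6)]) (rule h.hom_closed, simp)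
  show ?thesis
  proof unfold_locales
    show "?h a \<otimes>\<^bsub>G Mod N\<^esub> ?h b = ?h b \<otimes>\<^bsub>G Mod N\<^esub> ?h a \<otimes>\<^bsub>G Mod N\<^esub> ?h c"
      using arg_cong[OF ab, of ?h] by (simp only: h.hom_mult ba a_in b_in c_in)
    show "?h a \<otimes>\<^bsub>G Mod N\<^esub> ?h c = ?h c \<otimes>\<^bsub>G Mod N\<^esub> ?h a [^]\<^bsub>G Mod N\<^esub> \<alpha>'"
      unfolding A using arg_cong[OF ac, of ?h] by (simp only: h.hom_mult h.hom_int_pow int_pow_closed a_in b_in c_in)
    show "?h c \<otimes>\<^bsub>G Mod N\<^esub> ?h b = ?h b [^]\<^bsub>G Mod N\<^esub> \<beta>' \<otimes>\<^bsub>G Mod N\<^esub> ?h c"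
      unfolding B using arg_cong[OF cb, of ?h] by (simp only: h.hom_mult h.hom_int_pow int_pow_closed a_in b_in c_in)
    have "carrier (G Mod N) = ?h ` carrier G" by (rule carrier_FactGroup)
    also have "\<dots> = ?h ` generate G {a, b}" using gen by simp
    also have "\<dots> = generate (G Mod N) (?h ` {a, b})" by (rule h.generate_img[symmetric]) simp
    finally show "carrier (G Mod N) = generate (G Mod N) {?h a, ?h b}" by simp
  qed (use ta h.hom_closed a_in b_in c_in in \<open>simp_all only:\<close>, simp)
qed

lemma card_power2:
  assumes e: "e = 2 ^ L" shows "\<exists>n. card (carrier G) = 2 ^ n"
proof -
  have "\<exists>n. ord x = 2 ^ n" if "x \<in> carrier G" "x [^] e = \<one>" for x
  proof -
    have "int (ord x) dvd int (2 ^ L)" using that int_pow_eq_id unfolding e by simp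
    then have "ord x dvd 2 ^ L" by (simp only: int_dvd_int_iff)
    then show ?thesis using divides_primepow_nat[OF two_is_prime_nat] by blast
  qed
  then obtain i j k where "ord a = 2 ^ i" "ord b = 2 ^ j" "ord c = 2 ^ k" using a_e b_e c_e a_in b_in c_in by meson
  then have "card (carrier G) dvd 2 ^ j * 2 ^ k * 2 ^ i"
    using card_BCA_dvd[OF good_1] unfolding carrier_eq by simp
  then have "card (carrier G) dvd 2 ^ (j + k + i)" by (simp add: power_add)
  then show ?thesis using divides_primepow_nat[OF two_is_prime_nat] by blast
qed

end

context group begin

lemma ord_dvd_of_power2:
  assumes "g \<in> carrier G" "g [^] ((2::int) ^ n) = \<one>" shows "ord g dvd 2 ^ n"
proof -
  have "int (ord g) dvd int (2 ^ n)" using assms int_pow_eq_id by simp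
  then show ?thesis by (simp only: int_dvd_int_iff)
qed

lemma ord_eq_power2:
  assumes g: "g \<in> carrier G" and 1: "g [^] ((2::int) ^ Suc n) = \<one>" and 2: "g [^] ((2::int) ^ n) \<noteq> \<one>"
  shows "ord g = 2 ^ Suc n"
proof -
  obtain i where i: "i \<le> Suc n" "ord g = 2 ^ i"
    using ord_dvd_of_power2[OF g 1] divides_primepow_nat[OF two_is_prime_nat] by blast
  have "\<not> i \<le> n"
  proof
    assume "i \<le> n"
    then have "int (ord g) dvd 2 ^ n" unfolding i(2) by (simp add: le_imp_power_dvd)
    then show False using 2 g int_pow_eq_id by blast
  qed
  then show ?thesis using i by (simp add: le_antisym not_less_eq_eq)
qed

end

context two_mac begin

lemma pow_gcd:
  assumes "gcd (8 * R ^ 5 * (k ^ 2 - u ^ 3)) (4 * R ^ 6) = 2 ^ e"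
  shows "a [^] ((2::int) ^ e) = \<one>" "b [^] ((2::int) ^ e) = \<one>"
proof -
  have "g [^] ((2::int) ^ e) = \<one>" if "g \<in> carrier G" "g [^] (8 * R ^ 5 * (k ^ 2 - u ^ 3)) = \<one>" "g [^] (4 * R ^ 6) = \<one>" for g
  proof -
    have "int (ord g) dvd 8 * R ^ 5 * (k ^ 2 - u ^ 3)" "int (ord g) dvd 4 * R ^ 6" using that int_pow_eq_id by blast+
    then have "int (ord g) dvd 2 ^ e" unfolding assms[symmetric] by (rule gcd_greatest)
    then show ?thesis using that(1) int_pow_eq_id by blast
  qed
  then show "a [^] ((2::int) ^ e) = \<one>" "b [^] ((2::int) ^ e) = \<one>" using a_s b_s' a_R6 b_R6 a_in b_in by simp_all
qed

text \<open>By \<open>card_le\<close> the assumed lower bound on the group order forces 2^e \<le>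
  ord a, against ord a dividing 2^e; then both bounds are sharp.\<close>

lemma ord_a_eq:
  assumes a: "a [^] ((2::int) ^ e) = \<one>" and card: "2 ^ (8 * r + 2 + e) \<le> card (carrier G)"
  shows "ord a = 2 ^ e" "card (carrier G) = 2 ^ (8 * r + 2 + e)"
proof -
  have "2 * R ^ 5 = int (2 * 2 ^ (5 * r))" "2 * R ^ 3 = int (2 * 2 ^ (3 * r))"
    unfolding R_def by (simp_all add: power_mult[symmetric] mult.commute)
  then have n: "nat (2 * R ^ 5) = 2 * 2 ^ (5 * r)" "nat (2 * R ^ 3) = 2 * 2 ^ (3 * r)" by (simp_all only: nat_int)
  have "(2::nat) ^ (8 * r + 2) = 2 * 2 ^ (5 * r) * (2 * 2 ^ (3 * r))" by (simp add: power_add[symmetric])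
  then have le: "card (carrier G) \<le> 2 ^ (8 * r + 2) * ord a" using card_le unfolding n by (simp only: mult.assoc)
  have "(2::nat) ^ (8 * r + 2) * 2 ^ e \<le> 2 ^ (8 * r + 2) * ord a" using card le unfolding power_add[of _ _ e] by (rule order_trans)
  then have "2 ^ e \<le> ord a" by simp
  moreover have "ord a \<le> 2 ^ e" using ord_dvd_of_power2[OF a_in a] by (rule dvd_imp_le) simp
  ultimately show o: "ord a = 2 ^ e" by simp
  show "card (carrier G) = 2 ^ (8 * r + 2 + e)" using card le unfolding o power_add[of _ _ e] by simp
qed

text \<open>The bound on e expresses a^(8R^5) \<noteq> 1, as 8R^5 = 2^(5r+3). The order of c is read
  off from \<open>c_pow_one_iff\<close>, where 2R^4 = 2^(4r+1) corresponds to 4R^5 =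
  2^(5r+2).\<close>

lemma orders:
  assumes g: "gcd (8 * R ^ 5 * (k ^ 2 - u ^ 3)) (4 * R ^ 6) = 2 ^ e" and e: "5 * r + 4 \<le> e"
    and card: "2 ^ (8 * r + 2 + e) \<le> card (carrier G)"
  shows "ord a = 2 ^ e" "ord b = 2 ^ e" "ord c = 2 ^ (e - r - 1)" "nilpotency_class G = 6"
proof -
  interpret s: two_mac G b a "inv c" \<beta> \<alpha> L r R u' u "- k" by (rule swap_two)
  show oa: "ord a = 2 ^ e" by (rule ord_a_eq(1)[OF pow_gcd(1)[OF g] card])
  show "ord b = 2 ^ e" by (rule s.ord_a_eq(1)[OF pow_gcd(2)[OF g] card])
  have a_iff: "a [^] ((2::int) ^ i) = \<one> \<longleftrightarrow> e \<le> i" for i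
  proof -
    have "int (ord a) dvd 2 ^ i \<longleftrightarrow> e \<le> i" unfolding oa by (simp add: dvd_power_iff)
    then show ?thesis using a_in int_pow_eq_id by blast
  qed
  have R5: "4 * R ^ 5 * 2 ^ i = 2 ^ (5 * r + 2 + i)" and R4: "2 * R ^ 4 * 2 ^ i = 2 ^ (4 * r + 1 + i)" for i
    unfolding R_def by (simp_all add: power_mult[symmetric] power_add mult.commute)
  have c_iff: "c [^] ((2::int) ^ (4 * r + 1 + i)) = \<one> \<longleftrightarrow> e \<le> 5 * r + 2 + i" for i
    using c_pow_one_iff[of "2 ^ i"] unfolding R5 R4 a_iff .
  obtain f where f: "e = 5 * r + 4 + f" using e le_Suc_ex by blast
  have "ord c = 2 ^ Suc (4 * r + 1 + (f + 1))"
    using ord_eq_power2[OF c_in, of "4 * r + 1 + (f + 1)"] c_iff[of "f + 1"] c_iff[of "f + 2"] by (simp add: f)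
  moreover have "Suc (4 * r + 1 + (f + 1)) = e - r - 1" by (simp add: f)
  ultimately show "ord c = 2 ^ (e - r - 1)" by (simp only:)
  have "8 * R ^ 5 = 2 ^ (5 * r + 3)" using R5[of 1] by (simp add: power_add)
  then show "nilpotency_class G = 6" using class_6 a_iff[of "5 * r + 3"] e by simp
qed

end

section \<open>Combining the two bounds for the presented group\<close>

lemma power_dvd_order_Gab:
  fixes \<alpha> \<beta> u k R :: int and r e :: nat
  assumes r: "r \<ge> 2" and R: "R = 2 ^ r" and u: "odd u" and k: "odd k"
    and g: "gcd (8 * R ^ 5 * (k ^ 2 - u ^ 3)) (4 * R ^ 6) = 2 ^ e"
    and \<alpha>: "32 * R ^ 6 dvd \<alpha> - (1 + 2 * R ^ 2 * u)" "1 + 2 * R ^ 2 * u > 0"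
    and \<beta>: "4 * R ^ 6 dvd \<beta> - (1 + 2 * R ^ 2 * (u - R * k))"
    and fin: "finite (carrier (Gab \<alpha> \<beta>))"
  shows "2 ^ (8 * r + 2 + e) dvd order (Gab \<alpha> \<beta>)"
proof -
  have "even R" using r R by simp
  then have "coprime ((u - R * k) ^ 2) 2" using u by simp
  then have "coprime ((u - R * k) ^ 2) (2 ^ (6 * r + 2))" unfolding coprime_power_right_iff ..
  moreover have "4 * R ^ 6 = 2 ^ (6 * r + 2)" unfolding R by (simp add: power_mult[symmetric] power_add mult.commute)
  ultimately have "coprime ((u - R * k) ^ 2) (4 * R ^ 6)" by simp
  then obtain t q where "t * (u - R * k) ^ 2 + q * (4 * R ^ 6) = 1"
    using bezout_int[of "(u - R * k) ^ 2" "4 * R ^ 6"] by (metis coprime_iff_gcd_eq_1)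
  then have t: "t * (u - R * k) ^ 2 - 1 = 4 * R ^ 6 * - q" by (simp add: algebra_simps)
  have "R > 0" by (simp add: R)
  then have N: "int (nat (32 * R ^ 6)) = 32 * R ^ 6" by simp
  interpret word_model r e u k t R "u - R * k" "2 * R ^ 2 * u" "2 * R ^ 2 * (u - R * k)" "2 * R ^ 4" "2 ^ e"
    "2 * R ^ 3 * k * t" "- (2 * R ^ 4) * u ^ 2 * t" "t * (2 * R ^ 6 + 4 * R ^ 5 * k * u)"
    "2 * R ^ 3 * k * t * (2 * R ^ 2 * u)" "nat (32 * R ^ 6)" \<alpha> \<beta>
  proof unfold_locales
    show "4 * R ^ 6 dvd t * (u - R * k) ^ 2 - 1" unfolding t by (rule dvd_triv_left)
    show "2 ^ e dvd 4 * R ^ 6" "2 ^ e dvd 8 * R ^ 5 * (k ^ 2 - u ^ 3)" unfolding g[symmetric] by simp_all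
    show "int (nat (32 * R ^ 6)) dvd \<alpha> - (1 + 2 * R ^ 2 * u)" unfolding N by (rule \<alpha>(1))
  qed (use r R u k \<alpha>(2) \<beta> N in simp_all)
  have "2 * R ^ 4 = int (2 * 2 ^ (4 * r))" "(2::int) ^ e = int (2 ^ e)"
    unfolding R by (simp_all add: power_mult[symmetric] mult.commute)
  then have n: "nat (2 * R ^ 4) = 2 * 2 ^ (4 * r)" "nat (2 ^ e) = 2 ^ e" by (simp_all only: nat_int)
  have "(2::nat) ^ (8 * r + 2 + e) = 2 * 2 ^ (4 * r) * (2 ^ e * (2 * 2 ^ (4 * r)))"
    by (simp add: power_add[symmetric] mult.assoc mult.left_commute)
  then show ?thesis using card_dvd_order[OF fin] unfolding n by simp
qed

lemma sylow_Gab: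
  fixes \<alpha> \<beta> u k R :: int and r e :: nat and P :: "word set set"
  defines "G \<equiv> Gab \<alpha> \<beta>" and "A \<equiv> word_class (relators \<alpha> \<beta>) wA" and "B \<equiv> word_class (relators \<alpha> \<beta>) wB"
  defines "C \<equiv> inv\<^bsub>G\<^esub> A \<otimes>\<^bsub>G\<^esub> inv\<^bsub>G\<^esub> B \<otimes>\<^bsub>G\<^esub> A \<otimes>\<^bsub>G\<^esub> B"
  assumes r: "r \<ge> 2" and R: "R = 2 ^ r" and u: "odd u" and k: "odd k"
    and g: "gcd (8 * R ^ 5 * (k ^ 2 - u ^ 3)) (4 * R ^ 6) = 2 ^ e" and e: "5 * r + 4 \<le> e"
    and \<alpha>: "\<alpha> = 1 + 2 * R ^ 2 * u" and \<beta>: "\<beta> = 1 + 2 * R ^ 2 * (u - R * k)"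
    and P: "subgroup P G" "card P = 2 ^ multiplicity 2 (order G)"
  shows "nilpotency_class (G\<lparr>carrier := P\<rparr>) = 6" "card P = 2 ^ (8 * r + 2 + e)"
    "group.ord G (two_part G A) = 2 ^ e" "group.ord G (two_part G B) = 2 ^ e"
    "group.ord G (two_part G C) = 2 ^ (e - r - 1)"
proof -
  have Rev: "even R" "R > 0" using r R by simp_all
  have odd: "odd \<alpha>" "odd \<beta>" unfolding \<alpha> \<beta> by simp_all
  have ne: "\<alpha> \<noteq> 1" "\<beta> \<noteq> 1" unfolding \<alpha> \<beta> using Rev u k by auto
  interpret macd G A B C \<alpha> \<beta> unfolding G_def A_def B_def C_def by (rule macd_Gab(1))
  obtain i j :: int where ij: "i > 0" "A [^]\<^bsub>G\<^esub> i = \<one>\<^bsub>G\<^esub>" "j > 0" "B [^]\<^bsub>G\<^esub> j = \<one>\<^bsub>G\<^esub>"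
    using a_torsion[OF odd(1) ne(1)] b_torsion[OF odd(2) ne(2)] by blast
  have ci: "C [^]\<^bsub>G\<^esub> (i * i) = \<one>\<^bsub>G\<^esub>" using c_torsion[of "nat i"] ij by simp
  have tor: "A [^]\<^bsub>G\<^esub> (i * i * j) = \<one>\<^bsub>G\<^esub>" "B [^]\<^bsub>G\<^esub> (i * i * j) = \<one>\<^bsub>G\<^esub>" "C [^]\<^bsub>G\<^esub> (i * i * j) = \<one>\<^bsub>G\<^esub>"
    by (rule pow_eq_one_dvd[OF a_in ij(2)], simp, rule pow_eq_one_dvd[OF b_in ij(4)], simp, rule pow_eq_one_dvd[OF c_in ci], simp)
  interpret macd_fin G A B C \<alpha> \<beta> "i * i * j"
  proof unfold_locales
    show "carrier G = generate G {A, B}" unfolding G_def A_def B_def by (rule macd_Gab(2))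
  qed (use ij tor in simp_all)
  define K where "K = multiplicity 2 (order G)"
  have "order G > 0" using finite_carrier order_gt_0_iff_finite by blast
  then obtain t where t: "order G = 2 ^ K * t" "odd t"
    unfolding K_def using multiplicity_decompose'[of "order G" 2] by (metis nat_neq_iff not_is_unit_0 odd_one one_dvd)
  define N where "N = BCA (2 ^ K)"
  have N: "N \<lhd> G" "odd (card N)" unfolding N_def
    using BCA_normal[OF good_power2[OF odd]] odd_card_BCA[OF odd t] by simp_all
  define L where "L = K + 8 * r + 8"
  \<comment> \<open>Replacing u by u + d adds D = 2R^2d to both \<open>\<alpha>\<close> and
    \<open>\<beta>\<close> and leaves k unchanged. D is a multiple of 2^L large enough to make both
    positive; the exponents match because (2r + 1) + (K + 6r + 7) = L.\<close>
  define d where "d = 2 ^ (K + 6 * r + 7) * (\<bar>\<alpha>\<bar> + \<bar>\<beta>\<bar> + 1)"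
  define D where "D = 2 ^ L * (\<bar>\<alpha>\<bar> + \<bar>\<beta>\<bar> + 1)"
  have dD: "2 * R ^ 2 * d = D"
  proof -
    have "2 * R ^ 2 = 2 ^ (2 * r + 1)" unfolding R by (simp add: power_mult[symmetric] mult.commute)
    then have "2 * R ^ 2 * 2 ^ (K + 6 * r + 7) = 2 ^ (2 * r + 1 + (K + 6 * r + 7))" by (simp only: power_add)
    also have "2 * r + 1 + (K + 6 * r + 7) = L" by (simp add: L_def)
    finally show ?thesis unfolding d_def D_def by (simp only: mult.assoc[symmetric])
  qed
  have R6d: "4 * R ^ 6 dvd d"
  proof -
    have "4 * R ^ 6 = 2 ^ (6 * r + 2)" unfolding R by (simp add: power_mult[symmetric] power_add mult.commute)
    also have "\<dots> dvd 2 ^ (K + 6 * r + 7)" by (rule le_imp_power_dvd) simp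
    finally show ?thesis unfolding d_def by (rule dvd_mult2)
  qed
  have "d \<ge> 0" "even d" unfolding d_def by simp_all
  have "\<bar>\<alpha>\<bar> + \<bar>\<beta>\<bar> + 1 \<le> D" unfolding D_def using mult_right_mono[of 1 "2 ^ L" "\<bar>\<alpha>\<bar> + \<bar>\<beta>\<bar> + 1"] by simp
  then have pos: "\<alpha> + D > 0" "\<beta> + D > 0" by linarith+
  have \<alpha>': "\<alpha> + D = 1 + 2 * R ^ 2 * (u + d)" and \<beta>': "\<beta> + D = 1 + 2 * R ^ 2 * (u + d - R * k)"
    unfolding \<alpha> \<beta> dD[symmetric] by Groebner_Basis.algebra+
  have ud: "odd (u + d)" using u \<open>even d\<close> by simp
  \<comment> \<open>The shift d is a multiple of 4R^6, so the gcd is not affected.\<close>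
  have g': "gcd (8 * R ^ 5 * (k ^ 2 - (u + d) ^ 3)) (4 * R ^ 6) = 2 ^ e"
  proof -
    obtain w where w: "d = 4 * R ^ 6 * w" using R6d by (rule dvdE)
    have "8 * R ^ 5 * (k ^ 2 - (u + d) ^ 3) = 8 * R ^ 5 * (k ^ 2 - u ^ 3) + - (8 * R ^ 5 * w * (3 * u ^ 2 + 3 * u * d + d ^ 2)) * (4 * R ^ 6)"
      unfolding w by Groebner_Basis.algebra
    then show ?thesis unfolding g[symmetric] by (metis gcd.commute gcd_add_mult add.commute)
  qed
  let ?h = "\<lambda>x. N #>\<^bsub>G\<^esub> x"
  have KL: "K \<le> L" unfolding L_def by simp
  interpret H: macd_fin "G Mod N" "?h A" "?h B" "?h C" "\<alpha> + D" "\<beta> + D" "2 ^ L"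
    unfolding N_def by (rule quotient_macd_fin[OF odd KL]) (simp_all add: D_def)
  interpret H: two_mac "G Mod N" "?h A" "?h B" "?h C" "\<alpha> + D" "\<beta> + D" L r R "u + d" "u + d - R * k" k
    by unfold_locales (use r R ud k \<alpha>' \<beta>' pos in \<open>simp_all add: L_def\<close>)
  obtain q where q: "card (carrier (G Mod N)) = 2 ^ q" using H.card_power2 by blast
  \<comment> \<open>As N has odd order, the whole 2-part of the group order survives in the
    quotient.\<close>
  have "2 ^ q * card N = order G"
    using lagrange_finite[OF finite_carrier normal_imp_subgroup[OF N(1)]] q by (simp add: FactGroup_def)
  then have "multiplicity 2 (2 ^ q * card N) = K" unfolding K_def by simp
  moreover have "multiplicity 2 (2 ^ q * card N) = q"
    using N(2) by (intro multiplicity_eqI) auto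
  ultimately have qK: "q = K" by simp
  \<comment> \<open>The period of \<open>actA\<close> in the model is 32R^6: d contributes 4R^6, and
    2R^2 the factor 8 because 4 divides R.\<close>
  have "32 * R ^ 6 dvd 2 * R ^ 2 * d"
  proof -
    have "2 ^ 2 dvd R" using le_imp_power_dvd[OF r, of "2::int"] unfolding R .
    then obtain w where "R = 4 * w" by (auto elim: dvdE)
    then have "2 * R ^ 2 = 8 * (4 * w ^ 2)" by (simp add: power_mult_distrib)
    then have "8 dvd 2 * R ^ 2" by (rule dvdI)
    then have "8 * (4 * R ^ 6) dvd 2 * R ^ 2 * d" using R6d by (rule mult_dvd_mono)
    then show ?thesis by simp
  qed
  then have "32 * R ^ 6 dvd - D" unfolding dD by simp
  then have d1: "32 * R ^ 6 dvd \<alpha> - (1 + 2 * R ^ 2 * (u + d))" unfolding \<alpha>'[symmetric] by simp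
  have "4 * R ^ 6 dvd - D" unfolding dD[symmetric] using R6d by simp
  then have d2: "4 * R ^ 6 dvd \<beta> - (1 + 2 * R ^ 2 * (u + d - R * k))" unfolding \<beta>'[symmetric] by simp
  have "2 ^ (8 * r + 2 + e) dvd order G" unfolding G_def
    by (rule power_dvd_order_Gab[OF r R ud k g' d1 _ d2]) (use pos(1) \<alpha>' finite_carrier in \<open>simp_all add: G_def\<close>)
  then have "8 * r + 2 + e \<le> K" unfolding K_def using \<open>order G > 0\<close> by (intro multiplicity_geI) auto
  then have card: "2 ^ (8 * r + 2 + e) \<le> card (carrier (G Mod N))" unfolding q qK by (intro power_increasing) simp_all
  note o = H.orders[OF g' e card]
  have c2: "card (carrier (G Mod N)) = 2 ^ (8 * r + 2 + e)" by (rule H.ord_a_eq(2)[OF H.pow_gcd(1)[OF g'] card])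
  then have cP: "card P = card (carrier (G Mod N))" using P(2) unfolding q qK K_def by simp
  then show "card P = 2 ^ (8 * r + 2 + e)" using c2 by simp
  have "group (G\<lparr>carrier := P\<rparr>)" by (rule subgroup.subgroup_is_group[OF P(1) group_axioms])
  moreover have "?h \<in> iso (G\<lparr>carrier := P\<rparr>) (G Mod N)"
    by (rule sylow_quotient_iso[OF finite_carrier N P(1) _ c2]) (simp only: cP c2)
  ultimately show "nilpotency_class (G\<lparr>carrier := P\<rparr>) = 6"
    using nilpotency_class_iso[OF _ H.group_axioms] o(4) by simp
  have lift: "group.ord G (two_part G x) = 2 ^ n" if "x \<in> carrier G" "group.ord (G Mod N) (?h x) = 2 ^ n" for x n
    using ord_quotient[OF N that] ord_two_part[OF that(1)] by blast
  show "group.ord G (two_part G A) = 2 ^ e" "group.ord G (two_part G B) = 2 ^ e"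
    "group.ord G (two_part G C) = 2 ^ (e - r - 1)"
    by (rule lift[OF a_in o(1)] lift[OF b_in o(2)] lift[OF c_in o(3)])+
qed

text \<open>Zero is treated apart because \<open>multiplicity 2 0\<close> is 0.\<close>

lemma gcd_two_powers:
  fixes z :: int
  shows "z \<noteq> 0 \<Longrightarrow> i + multiplicity 2 z \<le> n \<Longrightarrow> gcd (2 ^ i * z) (2 ^ n) = 2 ^ (i + multiplicity 2 z)"
    and "z = 0 \<or> n \<le> i + multiplicity 2 z \<Longrightarrow> gcd (2 ^ i * z) (2 ^ n) = 2 ^ n"
proof -
  assume z: "z \<noteq> 0" and le: "i + multiplicity 2 z \<le> n"
  obtain t where t: "z = 2 ^ multiplicity 2 z * t" "odd t" using multiplicity_decompose'[of z 2] z by auto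
  obtain f where f: "n = i + multiplicity 2 z + f" using le le_Suc_ex by blast
  have "gcd (2 ^ (i + multiplicity 2 z) * t) (2 ^ (i + multiplicity 2 z) * 2 ^ f) = 2 ^ (i + multiplicity 2 z)"
    using t(2) by (subst gcd_mult_left) (simp add: coprime_imp_gcd_eq_1)
  moreover have "2 ^ i * z = 2 ^ (i + multiplicity 2 z) * t" unfolding power_add using t(1) by (simp add: mult.assoc)
  ultimately show "gcd (2 ^ i * z) (2 ^ n) = 2 ^ (i + multiplicity 2 z)" unfolding f power_add by metis
next
  assume z: "z = 0 \<or> n \<le> i + multiplicity 2 z"
  have "(2::int) ^ n dvd 2 ^ (i + multiplicity 2 z)" if "z \<noteq> 0" using z that le_imp_power_dvd by blast
  moreover have "2 ^ (i + multiplicity 2 z) dvd 2 ^ i * z" unfolding power_add by (intro mult_dvd_mono multiplicity_dvd dvd_refl)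
  ultimately have "2 ^ n dvd 2 ^ i * z" by (cases "z = 0") (auto intro: dvd_trans)
  then show "gcd (2 ^ i * z) (2 ^ n) = 2 ^ n" by (simp add: gcd_proj2_iff)
qed

theorem theorem16p3:
  fixes \<alpha> \<beta> u k :: int and m l s :: nat and P :: "word set set"
  assumes "\<alpha> \<noteq> 1" and "\<beta> \<noteq> 1"
    and "multiplicity 2 (\<alpha> - 1) = m" and "multiplicity 2 (\<beta> - 1) = m" and "m \<ge> 5"
    and "multiplicity 2 (\<alpha> - \<beta>) = l" and "2 * l + 2 = 3 * m + 1"
    and "\<alpha> = 1 + 2 ^ m * u" and "odd u"
    and "\<alpha> - \<beta> = 2 ^ l * k" and "odd k"
    and "s = multiplicity 2 (k ^ 2 - u ^ 3)"
    and "subgroup P (Gab \<alpha> \<beta>)"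
    and "card P = 2 ^ multiplicity 2 (order (Gab \<alpha> \<beta>))"
  shows
    "let G = Gab \<alpha> \<beta>; A = word_class (relators \<alpha> \<beta>) wA;
         B = word_class (relators \<alpha> \<beta>) wB;
         C = inv\<^bsub>G\<^esub> A \<otimes>\<^bsub>G\<^esub> inv\<^bsub>G\<^esub> B \<otimes>\<^bsub>G\<^esub> A \<otimes>\<^bsub>G\<^esub> B;
         a = two_part G A; b = two_part G B; c = two_part G C
     in nilpotency_class (G\<lparr>carrier := P\<rparr>) = 6
      \<and> ((k ^ 2 \<noteq> u ^ 3 \<and> 2 * s + 3 < m) \<longrightarrow>
           m \<ge> 7 \<and> card P = 2 ^ ((13 * m + 2 * s - 3) div 2)
           \<and> group.ord G a = 2 ^ ((5 * m + 2 * s + 1) div 2)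
           \<and> group.ord G b = 2 ^ ((5 * m + 2 * s + 1) div 2)
           \<and> group.ord G c = 2 ^ (2 * m + s))
      \<and> ((k ^ 2 = u ^ 3 \<or> 2 * s + 3 \<ge> m) \<longrightarrow>
           card P = 2 ^ (7 * m - 3)
           \<and> group.ord G a = 2 ^ (3 * m - 1)
           \<and> group.ord G b = 2 ^ (3 * m - 1)
           \<and> group.ord G c = 2 ^ ((5 * m - 3) div 2))"
proof -
  have "odd m" using assms(7) by presburger
  then obtain r where m: "m = 2 * r + 1" by (rule oddE)
  have l: "l = 3 * r + 1" using assms(7) m by simp
  have r: "r \<ge> 2" using assms(5) m by simp
  define R where "R = (2::int) ^ r"
  have \<alpha>: "\<alpha> = 1 + 2 * R ^ 2 * u" unfolding assms(8) m R_def by (simp add: power_mult[symmetric] mult.commute)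
  have "2 ^ l = 2 * R ^ 3" unfolding l R_def by (simp add: power_mult[symmetric] mult.commute)
  then have "\<beta> = \<alpha> - 2 * R ^ 3 * k" using assms(10) by simp
  then have \<beta>: "\<beta> = 1 + 2 * R ^ 2 * (u - R * k)" unfolding \<alpha> by Groebner_Basis.algebra
  have R5: "8 * R ^ 5 = 2 ^ (5 * r + 3)" and R6: "4 * R ^ 6 = 2 ^ (6 * r + 2)"
    unfolding R_def by (simp_all add: power_mult[symmetric] power_add mult.commute)
  note main = sylow_Gab[OF r R_def assms(9,11) _ _ \<alpha> \<beta> assms(13,14)]
  show ?thesis
  proof (cases "k ^ 2 \<noteq> u ^ 3 \<and> 2 * s + 3 < m")
    case True
    then have ne: "k ^ 2 - u ^ 3 \<noteq> 0" by simp
    \<comment> \<open>Hence s is at least 1, which gives both e \<ge> 5r + 4 and, with 2s + 3 < m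
      and m odd, m \<ge> 7.\<close>
    have "even (k ^ 2 - u ^ 3)" using assms(9,11) by simp
    then have s: "s \<ge> 1" unfolding assms(12) using ne by (intro multiplicity_geI) auto
    have g: "gcd (8 * R ^ 5 * (k ^ 2 - u ^ 3)) (4 * R ^ 6) = 2 ^ (5 * r + 3 + s)"
      unfolding R5 R6 assms(12) by (rule gcd_two_powers(1)[OF ne]) (use True m assms(12) in simp)
    have n: "(13 * m + 2 * s - 3) div 2 = 8 * r + 2 + (5 * r + 3 + s)" "(5 * m + 2 * s + 1) div 2 = 5 * r + 3 + s"
      "2 * m + s = 5 * r + 3 + s - r - 1" "m \<ge> 7"
      using m s True by simp_all
    have e: "5 * r + 4 \<le> 5 * r + 3 + s" using s by simp
    show ?thesis unfolding Let_def n(1-3) using main[OF g e] True n(4) by simp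
  next
    case False
    have g: "gcd (8 * R ^ 5 * (k ^ 2 - u ^ 3)) (4 * R ^ 6) = 2 ^ (6 * r + 2)"
      unfolding R5 R6 by (rule gcd_two_powers(2)) (use False m assms(12) in auto)
    have n: "7 * m - 3 = 8 * r + 2 + (6 * r + 2)" "3 * m - 1 = 6 * r + 2" "(5 * m - 3) div 2 = 6 * r + 2 - r - 1"
      using m by simp_all
    \<comment> \<open>Sharp at r = 2, the smallest case m = 5.\<close>
    have e: "5 * r + 4 \<le> 6 * r + 2" using r by simp
    show ?thesis unfolding Let_def n using main[OF g e] False by blast
  qed
qed

end
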